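(* Assume that $u\in H^1_+\cap L^2_s$ for some $s>\frac12$. For every $\lambda\in(0,+\infty)\setminus\sigma_{pp}(\mathbb{L}_u)$ there exist unique functions $\psi_\lambda^+,\psi_\lambda^-\in L^\infty_{-s}$ such that $\mathbb{L}_u\psi_\lambda^\pm=\lambda\psi_\lambda^\pm$, $\lim_{x\to-\infty}\big(\psi_\lambda^+(x)-e^{ix\lambda}\big)=0$, and $\lim_{x\to+\infty}\big(\psi_\lambda^-(x)-e^{ix\lambda}\big)=0$.
   Context: All functions are complex valued on $\mathbb{R}$. $\hat f(\xi)=\int_{\mathbb{R}} f(x)e^{-ix\xi}\,dx$. $H^\sigma_+=\{f\in H^\sigma(\mathbb{R};\mathbb{C}):\mathrm{supp}\,\hat f\subset[0,+\infty)\}$ for $\sigma\ge0$, and $L^2_+=H^0_+$. $\Pi:L^2\to L^2$ is the Cauchy-Szegő projector, $\widehat{\Pi f}(\xi)=\mathbf{1}_{\xi\ge0}\hat f(\xi)$. $\langle x\rangle=\sqrt{1+x^2}$. $L^2_s=\{f:\int_{\mathbb{R}}|f(x)|^2(1+x^2)^s\,dx<\infty\}$. $L^\infty_{-s}=\{f:\|f\|_{L^\infty_{-s}}=\|\langle x\rangle^{-s}f\|_{L^\infty}<\infty\}$. For $u\in H^1_+$ the Lax operator is $\mathbb{L}_u h=-i\partial_xh-u\Pi(\overline u h)$, an unbounded self-adjoint operator on $L^2_+$ with domain $H^1_+$; $\sigma_{pp}(\mathbb{L}_u)$ is its set of eigenvalues. If $u\in L^2_s$ and $h\in L^\infty_{-s}$,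 then $\overline u h\in L^2$ and $\mathbb{L}_u h$ is defined by the same formula, in the sense of distributions. *)

theory Defs
  imports "HOL-Probability.Probability"
begin

(* Elements of the Lebesgue spaces are represented by Borel functions; two functions
   represent the same element iff they agree almost everywhere. *)

definition L2 :: "(real \<Rightarrow> complex) set" where
  "L2 = {f \<in> borel_measurable lborel. integrable lborel (\<lambda>x. (norm (f x))\<^sup>2)}"

(* \<langle>x\<rangle> = sqrt (1 + x^2) *)
definition japanese :: "real \<Rightarrow> real" where
  "japanese x = sqrt (1 + x\<^sup>2)"

definition L2_weighted :: "real \<Rightarrow> (real \<Rightarrow> complex) set" where
  "L2_weighted s = {f \<in> borel_measurable lborel.
     integrable lborel (\<lambda>x. (norm (f x))\<^sup>2 * (1 + x\<^sup>2) powr s)}"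

(* Note the sign: "Linf_neg s" is the space of f with <x>^(-s) f essentially bounded. *)
definition Linf_neg :: "real \<Rightarrow> (real \<Rightarrow> complex) set" where
  "Linf_neg s = {f \<in> borel_measurable lborel.
     esssup lborel (\<lambda>x. ereal (norm (of_real (japanese x powr (- s)) * f x))) < \<infinity>}"

(* The Fourier transform on L2 (Plancherel): the L2 limit, as R tends to infinity, of the
   integrals of f(x) exp(-i x xi) over [-R, R]. The Lebesgue integral in ennreal is used so that
   convergence cannot hold because of the default value of a divergent integral. *)
definition is_fourier :: "(real \<Rightarrow> complex) \<Rightarrow> (real \<Rightarrow> complex) \<Rightarrow> bool" where
  "is_fourier f g \<longleftrightarrow> f \<in> L2 \<and> g \<in> L2 \<and>
     ((\<lambda>R. \<integral>\<^sup>+ \<xi>. ennreal ((norm (g \<xi> -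
          (LINT x:{-R..R}|lborel. f x * exp (- \<i> * of_real x * of_real \<xi>))))\<^sup>2) \<partial>lborel)
        \<longlongrightarrow> 0) at_top"

(* SOME selects a representative of the almost-everywhere class. *)
definition fourier :: "(real \<Rightarrow> complex) \<Rightarrow> real \<Rightarrow> complex" where
  "fourier f = (SOME g. is_fourier f g)"

(* Support of a class of functions: complement of the largest open set on which it vanishes
   almost everywhere. *)
definition ess_support :: "(real \<Rightarrow> complex) \<Rightarrow> real set" where
  "ess_support f = - \<Union>{U. open U \<and> (AE x in lborel. x \<in> U \<longrightarrow> f x = 0)}"

definition Sobolev :: "real \<Rightarrow> (real \<Rightarrow> complex) set" where
  "Sobolev \<sigma> = {f \<in> L2.
     integrable lborel (\<lambda>\<xi>. (1 + \<xi>\<^sup>2) powr \<sigma> * (norm (fourier f \<xi>))\<^sup>2)}"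

definition Sobolev_plus :: "real \<Rightarrow> (real \<Rightarrow> complex) set" where
  "Sobolev_plus \<sigma> = {f \<in> Sobolev \<sigma>. ess_support (fourier f) \<subseteq> {0..}}"

(* The Cauchy-Szego projector on L2; again SOME only selects a representative. *)
definition szego :: "(real \<Rightarrow> complex) \<Rightarrow> real \<Rightarrow> complex" where
  "szego f = (SOME g. g \<in> L2 \<and>
     (AE \<xi> in lborel. fourier g \<xi> = indicator {0..} \<xi> * fourier f \<xi>))"

definition test_functions :: "(real \<Rightarrow> complex) set" where
  "test_functions = {\<phi>. compact (closure {x. \<phi> x \<noteq> 0}) \<and>
     (\<forall>n x. ((\<lambda>f y. vector_derivative f (at y)) ^^ n) \<phi> differentiable (at x))}"

(* Distributions are represented by functionals, compared on test functions only. *)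
type_synonym dist = "(real \<Rightarrow> complex) \<Rightarrow> complex"

definition dist_eq :: "dist \<Rightarrow> dist \<Rightarrow> bool" where
  "dist_eq S T \<longleftrightarrow> (\<forall>\<phi>\<in>test_functions. S \<phi> = T \<phi>)"

(* Bilinear pairing (no complex conjugation). *)
definition dist_of :: "(real \<Rightarrow> complex) \<Rightarrow> dist" where
  "dist_of f = (\<lambda>\<phi>. LINT x|lborel. f x * \<phi> x)"

definition dist_deriv :: "dist \<Rightarrow> dist" where
  "dist_deriv T = (\<lambda>\<phi>. - T (\<lambda>x. vector_derivative \<phi> (at x)))"

(* L_u h = -i h' - u Pi(conj(u) h), as a distribution. It is used when conj(u) h is in L2, in
   particular for h in the domain H^1_+ of the self-adjoint operator and for u in L^2_s, h in
   L^infinity_{-s}; on the domain it is the distribution given by an L2 function. *)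
definition Lax :: "(real \<Rightarrow> complex) \<Rightarrow> (real \<Rightarrow> complex) \<Rightarrow> dist" where
  "Lax u h = (\<lambda>\<phi>. - \<i> * dist_deriv (dist_of h) \<phi>
     - dist_of (\<lambda>x. u x * szego (\<lambda>y. cnj (u y) * h y) x) \<phi>)"

definition sigma_pp :: "(real \<Rightarrow> complex) \<Rightarrow> complex set" where
  "sigma_pp u = {\<mu>. \<exists>h\<in>Sobolev_plus 1. \<not> (AE x in lborel. h x = 0) \<and>
     dist_eq (Lax u h) (dist_of (\<lambda>x. \<mu> * h x))}"

(* Limit of an almost-everywhere class along a filter F (essential limit): equivalently, some
   representative has this limit. For a continuous function and F = at_bot or at_top it is the
   ordinary limit. *)
definition ess_tendsto :: "(real \<Rightarrow> complex) \<Rightarrow> complex \<Rightarrow> real filter \<Rightarrow> bool" where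
  "ess_tendsto f l F \<longleftrightarrow> (f \<longlongrightarrow> l) (inf F (ae_filter lborel))"

(* Unique existence of an element of A with property P, up to almost-everywhere equality. *)
definition ex1_ae :: "(real \<Rightarrow> complex) set \<Rightarrow> ((real \<Rightarrow> complex) \<Rightarrow> bool) \<Rightarrow> bool" where
  "ex1_ae A P \<longleftrightarrow> (\<exists>f\<in>A. P f \<and> (\<forall>g\<in>A. P g \<longrightarrow> (AE x in lborel. g x = f x)))"

end

theory Submission
  imports Defs "HOL-Real_Asymp.Real_Asymp"
begin

text \<open>
  Write \<open>\<psi> x = exp (\<i> \<lambda> x) * w x\<close> and \<open>f = cnj u * \<psi>\<close>, which lies in \<open>L2\<close>. The equation becomes
  \<open>w' = \<i> * cnj \<alpha> * \<Pi> f\<close> with \<open>\<alpha> = cnj u * exp (\<i> \<lambda> x)\<close>, that is, \<open>f = c \<alpha> + K \<Pi> f\<close> with a Volterra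
  operator \<open>K\<close> and \<open>c\<close> the limit of \<open>w\<close> at \<open>-\<infinity>\<close>. As the inner product of \<open>f\<close> and \<open>\<Pi> f\<close> is real, \<open>|w|\<close>
  has the same limit at both ends. If \<open>c = 0\<close>, the weight therefore makes \<open>w\<close> decay
  like \<open>\<langle>x\<rangle>\<close> to the power \<open>-s\<close> at both ends, so \<open>\<psi>\<close> is in \<open>L2\<close>; as \<open>(\<xi> - \<lambda>) * \<psi>^\<close> vanishes for negative \<open>\<xi>\<close>
  and \<open>\<lambda> > 0\<close>, \<open>\<psi>\<close> is an eigenfunction, hence zero. This is uniqueness. Existence follows because \<open>K\<close> is a
  finite-rank operator plus one of small norm, so that injectivity of \<open>1 - K \<Pi>\<close> implies surjectivity. Finally, the solution
  normalised at \<open>+\<infinity>\<close> is the one normalised at \<open>-\<infinity>\<close> divided by the limit of \<open>w\<close> at \<open>+\<infinity>\<close>, of modulus 1.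
\<close>

section \<open>The Hilbert space L2\<close>

text \<open>The projector is defined on \<open>L2\<close> and is nonlocal. Hence the unknown is
  \<open>f\<close>, which lies in \<open>L2\<close>, and not \<open>\<psi>\<close>, which is only
  bounded against a weight; and hence \<open>K \<Pi>\<close> is no Volterra operator although
  \<open>K\<close> is, so that a Fredholm alternative replaces successive approximation. The flux
  argument rests on \<open>(|w|^2)' = - 2 * Im (cnj f * \<Pi> f)\<close>: integrated, the right side
  is the imaginary part of an inner product with an orthogonal projection. That a solution vanishing
  at both ends is an eigenfunction uses every assumption on \<open>u\<close>: \<open>s > 1/2\<close>
  makes \<open>\<langle>x\<rangle>\<close> to the power \<open>-s\<close> square integrable,
  \<open>H^1\<close> makes \<open>u\<close> bounded and so \<open>u * \<Pi> f\<close> square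
  integrable, and the one-sided spectrum of \<open>u\<close> makes \<open>u * \<Pi> f\<close> a
  product of two Hardy functions. Fourier transforms are limits in the mean, so explicit transforms
  are computed on bounded intervals and identified in the limit almost everywhere along a
  subsequence.\<close>

lemma L2_measurable [measurable_dest]: "f \<in> L2 \<Longrightarrow> f \<in> borel_measurable borel"
  by (simp add: L2_def)

lemma L2_integrable: "f \<in> L2 \<Longrightarrow> integrable lborel (\<lambda>x. (norm (f x))\<^sup>2)"
  by (simp add: L2_def)

lemma L2I: "f \<in> borel_measurable borel \<Longrightarrow> integrable lborel (\<lambda>x. (norm (f x))\<^sup>2) \<Longrightarrow> f \<in> L2"
  by (simp add: L2_def)

lemma L2_bound:
  assumes "f \<in> borel_measurable borel" "integrable lborel h" "AE x in lborel. (norm (f x))\<^sup>2 \<le> h x"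
  shows "f \<in> L2"
proof (rule L2I)
  show "integrable lborel (\<lambda>x. (norm (f x))\<^sup>2)"
    using assms by (intro Bochner_Integration.integrable_bound[OF assms(2)]) (auto elim!: eventually_mono)
qed fact

lemma L2_mult_integrable:
  assumes "f \<in> L2" "g \<in> L2"
  shows "integrable lborel (\<lambda>x. f x * g x)"
proof (rule Bochner_Integration.integrable_bound)
  show "integrable lborel (\<lambda>x. (norm (f x))\<^sup>2 + (norm (g x))\<^sup>2)"
    using assms by (intro Bochner_Integration.integrable_add L2_integrable)
  have "norm (f x) * norm (g x) \<le> (norm (f x))\<^sup>2 + (norm (g x))\<^sup>2" for x
    using sum_squares_bound[of "norm (f x)" "norm (g x)"]
      mult_nonneg_nonneg[of "norm (f x)" "norm (g x)"] norm_ge_zero[of "f x"] norm_ge_zero[of "g x"] by linarith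
  then show "AE x in lborel. norm (f x * g x) \<le> norm ((norm (f x))\<^sup>2 + (norm (g x))\<^sup>2)"
    by (simp add: norm_mult)
qed (use assms in measurable)

lemma borel_measurable_cnj [measurable]: "cnj \<in> borel_measurable borel"
  by (intro borel_measurable_continuous_onI continuous_intros)

lemma L2_cnj: "f \<in> L2 \<Longrightarrow> (\<lambda>x. cnj (f x)) \<in> L2"
  by (auto simp: L2_def)

lemma L2_norm: "f \<in> L2 \<Longrightarrow> (\<lambda>x. complex_of_real (norm (f x))) \<in> L2"
  by (auto simp: L2_def)

lemma L2_add:
  assumes "f \<in> L2" "g \<in> L2"
  shows "(\<lambda>x. f x + g x) \<in> L2"
proof (rule L2_bound)
  show "integrable lborel (\<lambda>x. 2 * (norm (f x))\<^sup>2 + 2 * (norm (g x))\<^sup>2)"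
    using assms by (intro Bochner_Integration.integrable_add integrable_mult_right L2_integrable)
  have "(norm (f x + g x))\<^sup>2 \<le> 2 * (norm (f x))\<^sup>2 + 2 * (norm (g x))\<^sup>2" for x
  proof -
    have "(norm (f x + g x))\<^sup>2 \<le> (norm (f x) + norm (g x))\<^sup>2"
      by (intro power_mono norm_triangle_ineq) auto
    also have "\<dots> \<le> 2 * (norm (f x))\<^sup>2 + 2 * (norm (g x))\<^sup>2"
      using sum_squares_bound[of "norm (f x)" "norm (g x)"] by (simp add: power2_sum)
    finally show ?thesis .
  qed
  then show "AE x in lborel. (norm (f x + g x))\<^sup>2 \<le> 2 * (norm (f x))\<^sup>2 + 2 * (norm (g x))\<^sup>2"
    by simp
qed (use assms in measurable)

lemma L2_bounded_mult:
  assumes "f \<in> L2" "m \<in> borel_measurable borel" "\<And>x. norm (m x) \<le> C"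
  shows "(\<lambda>x. m x * f x) \<in> L2"
proof (rule L2_bound)
  show "integrable lborel (\<lambda>x. C\<^sup>2 * (norm (f x))\<^sup>2)"
    using assms by (intro integrable_mult_right L2_integrable)
  show "AE x in lborel. (norm (m x * f x))\<^sup>2 \<le> C\<^sup>2 * (norm (f x))\<^sup>2"
    using assms(3) by (auto simp: norm_mult power_mult_distrib intro!: mult_right_mono power_mono)
qed (use assms in measurable)

lemma L2_cmult: "f \<in> L2 \<Longrightarrow> (\<lambda>x. c * f x) \<in> L2"
  using L2_bounded_mult[of f "\<lambda>_. c" "norm c"] by simp

lemma L2_scaleR: "f \<in> L2 \<Longrightarrow> (\<lambda>x. r *\<^sub>R f x) \<in> L2"
  using L2_cmult[of f "of_real r"] by (simp add: scaleR_conv_of_real)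

lemma L2_minus: "f \<in> L2 \<Longrightarrow> (\<lambda>x. - f x) \<in> L2"
  using L2_cmult[of f "-1"] by simp

lemma L2_diff: "f \<in> L2 \<Longrightarrow> g \<in> L2 \<Longrightarrow> (\<lambda>x. f x - g x) \<in> L2"
  using L2_add[OF _ L2_minus] by simp

lemma L2_zero: "(\<lambda>x. 0) \<in> L2"
  by (auto simp: L2_def)

lemma L2_AE_cong:
  assumes "f \<in> L2" "g \<in> borel_measurable borel" "AE x in lborel. f x = g x"
  shows "g \<in> L2"
proof (rule L2_bound[OF assms(2) L2_integrable[OF assms(1)]])
  show "AE x in lborel. (norm (g x))\<^sup>2 \<le> (norm (f x))\<^sup>2"
    using assms(3) by eventually_elim simp
qed

section \<open>Classes modulo almost-everywhere equality, as an inner product space\<close>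

definition l2rel :: "(real \<Rightarrow> complex) \<Rightarrow> (real \<Rightarrow> complex) \<Rightarrow> bool" where
  "l2rel f g \<longleftrightarrow> f \<in> L2 \<and> g \<in> L2 \<and> (AE x in lborel. f x = g x)"

lemma part_equivp_l2rel: "part_equivp l2rel"
proof (rule part_equivpI)
  show "\<exists>f. l2rel f f" by (rule exI[of _ "\<lambda>x. 0"]) (simp add: l2rel_def L2_zero)
  show "symp l2rel"
  proof (rule sympI)
    fix f g assume "l2rel f g"
    then show "l2rel g f"
      unfolding l2rel_def by (auto elim: eventually_mono)
  qed
  show "transp l2rel"
  proof (rule transpI)
    fix f g h assume *: "l2rel f g" "l2rel g h"
    then have "AE x in lborel. f x = g x" "AE x in lborel. g x = h x"
      by (auto simp: l2rel_def)
    then have "AE x in lborel. f x = h x"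
      by eventually_elim simp
    with * show "l2rel f h" by (simp add: l2rel_def)
  qed
qed

\<comment> \<open>A type, rather than functions modulo null sets, gives access to the type classes:
  spans, closures, Pythagoras and the Banach fixed point theorem all apply to it later. The relation
  is partial because only square-integrable functions have a class.\<close>
quotient_type l2 = "real \<Rightarrow> complex" / partial: l2rel
  by (rule part_equivp_l2rel)

text \<open>Pointwise facts about representatives hold almost everywhere only, and \<open>abs_l2 f\<close> is
  meaningful only if \<open>f\<close> is square integrable.\<close>

lemma rep_L2 [simp]: "rep_l2 x \<in> L2"
  using Quotient_rep_reflp[OF Quotient_l2, of x] by (simp add: l2rel_def)

lemma rep_measurable [measurable]: "rep_l2 x \<in> borel_measurable borel"
  using rep_L2 by (rule L2_measurable)

lemma rep_abs: "f \<in> L2 \<Longrightarrow> AE t in lborel. rep_l2 (abs_l2 f) t = f t"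
  using Quotient_rep_abs[OF Quotient_l2, of f] by (simp add: l2rel_def)

lemma abs_rep [simp]: "abs_l2 (rep_l2 x) = x"
  by (rule Quotient_abs_rep[OF Quotient_l2])

lemma abs_l2_cong: "f \<in> L2 \<Longrightarrow> g \<in> L2 \<Longrightarrow> AE t in lborel. f t = g t \<Longrightarrow> abs_l2 f = abs_l2 g"
  by (rule Quotient_rel_abs[OF Quotient_l2]) (simp add: l2rel_def)

lemma l2_eqI: "AE t in lborel. rep_l2 x t = rep_l2 y t \<Longrightarrow> x = y"
  using abs_l2_cong[of "rep_l2 x" "rep_l2 y"] by simp

lemma l2_eq_absI: "f \<in> L2 \<Longrightarrow> AE t in lborel. rep_l2 x t = f t \<Longrightarrow> x = abs_l2 f"
  using abs_l2_cong[of "rep_l2 x" f] by simp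

text \<open>Conjugate linear in the first argument. The type class only knows real scalars, so the
  complex inner product is kept beside \<open>inner\<close>, which is its real part.\<close>

definition cint :: "l2 \<Rightarrow> l2 \<Rightarrow> complex" where
  "cint x y = (LINT t|lborel. cnj (rep_l2 x t) * rep_l2 y t)"

instantiation l2 :: real_inner
begin

definition zero_l2 :: l2 where "0 = abs_l2 (\<lambda>t. 0)"
definition plus_l2 :: "l2 \<Rightarrow> l2 \<Rightarrow> l2" where "(x::l2) + y = abs_l2 (\<lambda>t. rep_l2 x t + rep_l2 y t)"
definition minus_l2 :: "l2 \<Rightarrow> l2 \<Rightarrow> l2" where "x - y = abs_l2 (\<lambda>t. rep_l2 x t - rep_l2 y t)"
definition uminus_l2 :: "l2 \<Rightarrow> l2" where "- x = abs_l2 (\<lambda>t. - rep_l2 x t)"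
definition scaleR_l2 :: "real \<Rightarrow> l2 \<Rightarrow> l2" where "scaleR r x = abs_l2 (\<lambda>t. r *\<^sub>R rep_l2 x t)"
definition inner_l2 :: "l2 \<Rightarrow> l2 \<Rightarrow> real" where "inner x y = Re (cint x y)"
definition norm_l2 :: "l2 \<Rightarrow> real" where "norm (x::l2) = sqrt (inner x x)"
definition sgn_l2 :: "l2 \<Rightarrow> l2" where "sgn (x::l2) = inverse (norm x) *\<^sub>R x"
definition dist_l2 :: "l2 \<Rightarrow> l2 \<Rightarrow> real" where "dist (x::l2) y = norm (x - y)"
definition uniformity_l2 :: "(l2 \<times> l2) filter" where
  "uniformity_l2 = (INF e\<in>{0 <..}. principal {(x, y). dist x y < e})"
definition open_l2 :: "l2 set \<Rightarrow> bool" where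
  "open_l2 U = (\<forall>x\<in>U. eventually (\<lambda>(x', y). x' = x \<longrightarrow> y \<in> U) uniformity)"

lemma rep_zero: "AE t in lborel. rep_l2 0 t = 0"
  unfolding zero_l2_def by (rule rep_abs[OF L2_zero])
lemma rep_plus: "AE t in lborel. rep_l2 (x + y) t = rep_l2 x t + rep_l2 y t"
  unfolding plus_l2_def by (intro rep_abs L2_add rep_L2)
lemma rep_minus: "AE t in lborel. rep_l2 (x - y) t = rep_l2 x t - rep_l2 y t"
  unfolding minus_l2_def by (intro rep_abs L2_diff rep_L2)
lemma rep_uminus: "AE t in lborel. rep_l2 (- x) t = - rep_l2 x t"
  unfolding uminus_l2_def by (intro rep_abs L2_minus rep_L2)
lemma rep_scaleR: "AE t in lborel. rep_l2 (r *\<^sub>R x) t = r *\<^sub>R rep_l2 x t"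
  unfolding scaleR_l2_def by (intro rep_abs L2_scaleR rep_L2)

lemma cint_integrable: "integrable lborel (\<lambda>t. cnj (rep_l2 x t) * rep_l2 y t)"
  by (intro L2_mult_integrable L2_cnj rep_L2)

lemma cint_add_left: "cint (x + y) z = cint x z + cint y z"
proof -
  have "cint (x + y) z = (LINT t|lborel. cnj (rep_l2 x t) * rep_l2 z t + cnj (rep_l2 y t) * rep_l2 z t)"
    unfolding cint_def
  proof (rule integral_cong_AE)
    show "AE t in lborel. cnj (rep_l2 (x + y) t) * rep_l2 z t
        = cnj (rep_l2 x t) * rep_l2 z t + cnj (rep_l2 y t) * rep_l2 z t"
      using rep_plus[of x y] by eventually_elim (simp add: algebra_simps)
  qed measurable
  then show ?thesis
    by (simp add: cint_def cint_integrable)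
qed

lemma cint_scaleR_left: "cint (r *\<^sub>R x) z = of_real r * cint x z"
proof -
  have "cint (r *\<^sub>R x) z = (LINT t|lborel. of_real r * (cnj (rep_l2 x t) * rep_l2 z t))"
    unfolding cint_def
  proof (rule integral_cong_AE)
    show "AE t in lborel. cnj (rep_l2 (r *\<^sub>R x) t) * rep_l2 z t
        = of_real r * (cnj (rep_l2 x t) * rep_l2 z t)"
      using rep_scaleR[of r x] by eventually_elim (simp add: scaleR_conv_of_real)
  qed measurable
  then show ?thesis
    by (simp add: cint_def)
qed

lemma cint_cnj: "cnj (cint x y) = cint y x"
  unfolding cint_def by (simp add: mult.commute flip: Bochner_Integration.integral_cnj)

lemma cint_self: "cint x x = of_real (LINT t|lborel. (norm (rep_l2 x t))\<^sup>2)"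
  unfolding cint_def integral_complex_of_real[symmetric]
  by (rule Bochner_Integration.integral_cong) (simp_all only: complex_norm_square mult.commute)

instance
proof
  fix x y z :: l2 and a b r :: real
  show "x + y + z = x + (y + z)"
    by (rule l2_eqI)
      (use rep_plus[of x y] rep_plus[of "x + y" z] rep_plus[of y z] rep_plus[of x "y + z"] in
        \<open>eventually_elim, simp add: add.assoc\<close>)
  show "x + y = y + x"
    by (rule l2_eqI) (use rep_plus[of x y] rep_plus[of y x] in \<open>eventually_elim, simp\<close>)
  show "0 + x = x"
    by (rule l2_eqI) (use rep_plus[of 0 x] rep_zero in \<open>eventually_elim, simp\<close>)
  show "- x + x = 0"
    by (rule l2_eqI) (use rep_plus[of "-x" x] rep_uminus[of x] rep_zero in \<open>eventually_elim, simp\<close>)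
  show "x - y = x + - y"
    by (rule l2_eqI) (use rep_plus[of x "-y"] rep_uminus[of y] rep_minus[of x y] in \<open>eventually_elim, simp\<close>)
  show "a *\<^sub>R (x + y) = a *\<^sub>R x + a *\<^sub>R y"
    by (rule l2_eqI) (use rep_plus[of x y] rep_scaleR[of a x] rep_scaleR[of a y] rep_scaleR[of a "x + y"]
      rep_plus[of "a *\<^sub>R x" "a *\<^sub>R y"] in \<open>eventually_elim, simp add: algebra_simps\<close>)
  show "(a + b) *\<^sub>R x = a *\<^sub>R x + b *\<^sub>R x"
    by (rule l2_eqI) (use rep_scaleR[of a x] rep_scaleR[of b x] rep_scaleR[of "a + b" x]
      rep_plus[of "a *\<^sub>R x" "b *\<^sub>R x"] in \<open>eventually_elim, simp add: algebra_simps\<close>)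
  show "a *\<^sub>R b *\<^sub>R x = (a * b) *\<^sub>R x"
    by (rule l2_eqI) (use rep_scaleR[of b x] rep_scaleR[of "a * b" x] rep_scaleR[of a "b *\<^sub>R x"]
      in \<open>eventually_elim, simp add: algebra_simps\<close>)
  show "1 *\<^sub>R x = x"
    by (rule l2_eqI) (use rep_scaleR[of 1 x] in \<open>eventually_elim, simp\<close>)
  show "sgn x = inverse (norm x) *\<^sub>R x" by (rule sgn_l2_def)
  show "dist x y = norm (x - y)" by (rule dist_l2_def)
  show "inner x y = inner y x"
    unfolding inner_l2_def by (subst cint_cnj[symmetric]) simp
  show "inner (x + y) z = inner x z + inner y z"
    by (simp add: inner_l2_def cint_add_left)
  show "inner (r *\<^sub>R x) y = r * inner x y"
    by (simp add: inner_l2_def cint_scaleR_left)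
  show "0 \<le> inner x x"
    by (simp add: inner_l2_def cint_self)
  show "inner x x = 0 \<longleftrightarrow> x = 0"
  proof
    assume "inner x x = 0"
    then have "(LINT t|lborel. (norm (rep_l2 x t))\<^sup>2) = 0"
      by (simp add: inner_l2_def cint_self)
    then have "AE t in lborel. (norm (rep_l2 x t))\<^sup>2 = 0"
      by (subst (asm) integral_nonneg_eq_0_iff_AE) (auto intro: L2_integrable)
    then have "AE t in lborel. rep_l2 x t = rep_l2 0 t"
      using rep_zero by eventually_elim simp
    then show "x = 0" by (rule l2_eqI)
  next
    assume "x = 0"
    have "(LINT t|lborel. (norm (rep_l2 0 t))\<^sup>2) = (LINT t|(lborel :: real measure). (0 :: real))"
      by (rule integral_cong_AE) (use rep_zero in \<open>auto elim: eventually_mono\<close>)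
    with \<open>x = 0\<close> show "inner x x = 0"
      by (simp add: inner_l2_def cint_self)
  qed
  show "norm x = sqrt (inner x x)" by (rule norm_l2_def)
qed (simp_all add: uniformity_l2_def open_l2_def)

end

lemma norm_l2_sq: "(norm x)\<^sup>2 = (LINT t|lborel. (norm (rep_l2 x t))\<^sup>2)"
  by (simp add: norm_l2_def inner_l2_def cint_self)

lemma cint_AE_cong:
  assumes "AE t in lborel. rep_l2 x t = f t" "AE t in lborel. rep_l2 y t = g t"
    "f \<in> borel_measurable borel" "g \<in> borel_measurable borel"
  shows "cint x y = (LINT t|lborel. cnj (f t) * g t)"
  unfolding cint_def
proof (rule integral_cong_AE)
  show "AE t in lborel. cnj (rep_l2 x t) * rep_l2 y t = cnj (f t) * g t"
    using assms(1,2) by eventually_elim simp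
qed (use assms in measurable)

lemma cint_abs:
  "f \<in> L2 \<Longrightarrow> g \<in> L2 \<Longrightarrow> cint (abs_l2 f) (abs_l2 g) = (LINT t|lborel. cnj (f t) * g t)"
  by (intro cint_AE_cong rep_abs) (auto dest: L2_measurable)

lemma norm_abs_sq: "f \<in> L2 \<Longrightarrow> (norm (abs_l2 f))\<^sup>2 = (LINT t|lborel. (norm (f t))\<^sup>2)"
proof -
  assume f: "f \<in> L2"
  show ?thesis
    unfolding norm_l2_sq
    by (rule integral_cong_AE) (use rep_abs[OF f] L2_measurable[OF f] in \<open>auto elim: eventually_mono\<close>)
qed

lemma cint_self': "cint x x = of_real ((norm x)\<^sup>2)"
  by (simp add: cint_self norm_l2_sq)

lemma abs_add:
  assumes "f \<in> L2" "g \<in> L2"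
  shows "abs_l2 (\<lambda>t. f t + g t) = abs_l2 f + abs_l2 g"
  by (rule l2_eqI)
    (use rep_abs[OF assms(1)] rep_abs[OF assms(2)] rep_abs[OF L2_add[OF assms]]
      rep_plus[of "abs_l2 f" "abs_l2 g"] in \<open>eventually_elim, simp\<close>)

lemma abs_diff:
  assumes "f \<in> L2" "g \<in> L2"
  shows "abs_l2 (\<lambda>t. f t - g t) = abs_l2 f - abs_l2 g"
  by (rule l2_eqI)
    (use rep_abs[OF assms(1)] rep_abs[OF assms(2)] rep_abs[OF L2_diff[OF assms]]
      rep_minus[of "abs_l2 f" "abs_l2 g"] in \<open>eventually_elim, simp\<close>)

lemma abs_scaleR:
  assumes "f \<in> L2"
  shows "abs_l2 (\<lambda>t. r *\<^sub>R f t) = r *\<^sub>R abs_l2 f"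
  by (rule l2_eqI)
    (use rep_abs[OF assms] rep_abs[OF L2_scaleR[OF assms, of r]]
      rep_scaleR[of r "abs_l2 f"] in \<open>eventually_elim, simp\<close>)

text \<open>Replacing a representative by its modulus costs nothing in norm. This turns the real
  inequalities of the type class into estimates for integrals of moduli.\<close>

lemma norm_abs_norm: "norm (abs_l2 (\<lambda>t. complex_of_real (norm (rep_l2 x t)))) = norm x"
proof (rule power2_eq_imp_eq)
  have "(norm (abs_l2 (\<lambda>t. complex_of_real (norm (rep_l2 x t)))))\<^sup>2
      = (LINT t|lborel. (norm (complex_of_real (norm (rep_l2 x t))))\<^sup>2)"
    by (intro norm_abs_sq L2_norm rep_L2)
  then show "(norm (abs_l2 (\<lambda>t. complex_of_real (norm (rep_l2 x t)))))\<^sup>2 = (norm x)\<^sup>2"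
    by (simp add: norm_l2_sq)
qed auto

lemma rep_sum: "AE t in lborel. rep_l2 (sum f A) t = (\<Sum>i\<in>A. rep_l2 (f i) t)"
proof (induction A rule: infinite_finite_induct)
  case (insert a A)
  show ?case
    using rep_plus[of "f a" "sum f A"] insert.IH by eventually_elim (use insert.hyps in simp)
qed (use rep_zero in auto)

lemma norm_le_bound:
  assumes "integrable lborel h" "AE t in lborel. (norm (rep_l2 x t))\<^sup>2 \<le> h t"
  shows "(norm x)\<^sup>2 \<le> (LINT t|lborel. h t)"
  unfolding norm_l2_sq by (rule integral_mono_AE) (use assms L2_integrable in auto)

text \<open>Cauchy-Schwarz for \<open>inner\<close> controls real parts only. Applied to the moduli
  of the representatives it bounds the integral of the product of the moduli, which dominates the
  complex number \<open>cint x y\<close>.\<close>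

lemma norm_cint_le: "norm (cint x y) \<le> norm x * norm y"
proof -
  let ?ax = "abs_l2 (\<lambda>t. of_real (norm (rep_l2 x t)))" and ?ay = "abs_l2 (\<lambda>t. of_real (norm (rep_l2 y t)))"
  have "norm (cint x y) \<le> (LINT t|lborel. norm (rep_l2 x t) * norm (rep_l2 y t))"
    unfolding cint_def using integral_norm_bound[of lborel "\<lambda>t. cnj (rep_l2 x t) * rep_l2 y t"]
    by (simp add: norm_mult)
  also have "\<dots> = Re (cint ?ax ?ay)"
    by (subst cint_abs) (auto intro: L2_norm simp flip: of_real_mult)
  also have "\<dots> \<le> norm ?ax * norm ?ay"
    using norm_cauchy_schwarz[of ?ax ?ay] by (simp add: inner_l2_def)
  finally show ?thesis by (simp add: norm_abs_norm)
qed

text \<open>The Riesz-Fischer argument. The partial sums \<open>h N\<close> of the moduli are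
  bounded in norm by \<open>B\<close>, so by monotone convergence their limit \<open>H\<close> is
  square integrable and finite almost everywhere. The series of representatives then converges
  almost everywhere, and its remainders are dominated by \<open>H\<close>.\<close>

lemma l2_summable:
  fixes Y :: "nat \<Rightarrow> l2"
  assumes "summable (\<lambda>n. norm (Y n))"
  shows "\<exists>s. (\<lambda>N. \<Sum>n<N. Y n) \<longlonglongrightarrow> s"
proof -
  define B where "B = (\<Sum>n. norm (Y n))"
  define h where "h N t = (\<Sum>n<N. norm (rep_l2 (Y n) t))" for N t
  have h_meas [measurable]: "h N \<in> borel_measurable borel" for N
    unfolding h_def by measurable
  have h_bound: "(\<integral>\<^sup>+ t. ennreal ((h N t)\<^sup>2) \<partial>lborel) \<le> ennreal (B\<^sup>2)" for N
  proof -
    \<comment> \<open>Applying the triangle inequality to the classes of the moduli bounds the norm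
      of the sum of the moduli, and not only that of the modulus of the sum.\<close>
    define Z where "Z n = abs_l2 (\<lambda>t. complex_of_real (norm (rep_l2 (Y n) t)))" for n
    have nZ: "norm (Z n) = norm (Y n)" for n
      unfolding Z_def by (rule norm_abs_norm)
    have "AE t in lborel. \<forall>n. rep_l2 (Z n) t = complex_of_real (norm (rep_l2 (Y n) t))"
      unfolding AE_all_countable Z_def by (auto intro!: rep_abs L2_norm)
    then have Zh: "AE t in lborel. rep_l2 (\<Sum>n<N. Z n) t = complex_of_real (h N t)"
      using rep_sum[of Z "{..<N}"] by eventually_elim (simp add: h_def)
    have "(\<integral>\<^sup>+ t. ennreal ((h N t)\<^sup>2) \<partial>lborel) = (\<integral>\<^sup>+ t. ennreal ((norm (rep_l2 (\<Sum>n<N. Z n) t))\<^sup>2) \<partial>lborel)"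
      by (rule nn_integral_cong_AE) (use Zh in \<open>eventually_elim, simp\<close>)
    also have "\<dots> = ennreal ((norm (\<Sum>n<N. Z n))\<^sup>2)"
      unfolding norm_l2_sq by (rule nn_integral_eq_integral) (auto intro: L2_integrable)
    also have "norm (\<Sum>n<N. Z n) \<le> B"
    proof -
      have "norm (\<Sum>n<N. Z n) \<le> (\<Sum>n<N. norm (Y n))"
        using norm_sum[of Z "{..<N}"] by (simp add: nZ)
      also have "\<dots> \<le> B"
        unfolding B_def by (rule sum_le_suminf[OF assms]) auto
      finally show ?thesis .
    qed
    then have "ennreal ((norm (\<Sum>n<N. Z n))\<^sup>2) \<le> ennreal (B\<^sup>2)"
      by (intro ennreal_leI power_mono) auto
    finally show ?thesis .
  qed
  have h_mono: "h N t \<le> h (Suc N) t" for N t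
    by (simp add: h_def)
  have h_nonneg: "0 \<le> h N t" for N t
    by (simp add: h_def sum_nonneg)
  have "(\<integral>\<^sup>+ t. (SUP N. ennreal ((h N t)\<^sup>2)) \<partial>lborel) = (SUP N. \<integral>\<^sup>+ t. ennreal ((h N t)\<^sup>2) \<partial>lborel)"
    by (rule nn_integral_monotone_convergence_SUP)
      (auto simp: incseq_Suc_iff le_fun_def intro!: ennreal_leI power_mono h_mono h_nonneg)
  also have "\<dots> \<le> ennreal (B\<^sup>2)"
    by (rule SUP_least) (rule h_bound)
  finally have sup: "(\<integral>\<^sup>+ t. (SUP N. ennreal ((h N t)\<^sup>2)) \<partial>lborel) \<le> ennreal (B\<^sup>2)" .
  then have "(\<integral>\<^sup>+ t. (SUP N. ennreal ((h N t)\<^sup>2)) \<partial>lborel) \<noteq> \<infinity>"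
    by (auto simp: top_unique)
  then have "AE t in lborel. (SUP N. ennreal ((h N t)\<^sup>2)) \<noteq> \<infinity>"
    by (intro nn_integral_noteq_infinite) auto
  then have sumAE: "AE t in lborel. summable (\<lambda>n. norm (rep_l2 (Y n) t))"
  proof eventually_elim
    case (elim t)
    then obtain C where C: "(SUP N. ennreal ((h N t)\<^sup>2)) = ennreal C" "0 \<le> C"
      by (cases "SUP N. ennreal ((h N t)\<^sup>2)") auto
    have "(h N t)\<^sup>2 \<le> C" for N
      using SUP_upper[of N UNIV "\<lambda>N. ennreal ((h N t)\<^sup>2)"] C by simp
    then have "h N t \<le> sqrt C" for N
      by (rule real_le_rsqrt)
    then have "(\<Sum>k\<le>N. norm (rep_l2 (Y k) t)) \<le> sqrt C" for N
      unfolding h_def lessThan_Suc_atMost[symmetric] by blast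
    then show ?case
      by (intro bounded_imp_summable[of _ "sqrt C"]) auto
  qed
  define H where "H t = (\<Sum>n. norm (rep_l2 (Y n) t))" for t
  define s where "s t = (\<Sum>n. rep_l2 (Y n) t)" for t
  have H_meas [measurable]: "H \<in> borel_measurable borel" and s_meas [measurable]: "s \<in> borel_measurable borel"
    unfolding H_def[abs_def] s_def[abs_def] by measurable
  have H_int: "integrable lborel (\<lambda>t. (H t)\<^sup>2)"
  proof (rule integrableI_bounded)
    have "(\<integral>\<^sup>+ t. ennreal (norm ((H t)\<^sup>2)) \<partial>lborel) = (\<integral>\<^sup>+ t. (SUP N. ennreal ((h N t)\<^sup>2)) \<partial>lborel)"
    proof (rule nn_integral_cong_AE)
      show "AE t in lborel. ennreal (norm ((H t)\<^sup>2)) = (SUP N. ennreal ((h N t)\<^sup>2))"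
        using sumAE
      proof eventually_elim
        case (elim t)
        have "(\<lambda>N. h N t) \<longlonglongrightarrow> H t"
          unfolding h_def H_def using elim by (rule summable_LIMSEQ)
        then have "(\<lambda>N. ennreal ((h N t)\<^sup>2)) \<longlonglongrightarrow> ennreal ((H t)\<^sup>2)"
          by (intro tendsto_ennrealI tendsto_power)
        moreover have "(\<lambda>N. ennreal ((h N t)\<^sup>2)) \<longlonglongrightarrow> (SUP N. ennreal ((h N t)\<^sup>2))"
          by (rule LIMSEQ_SUP) (auto simp: incseq_Suc_iff intro!: ennreal_leI power_mono h_mono h_nonneg)
        ultimately show ?case
          by (auto intro: LIMSEQ_unique)
      qed
    qed
    with sup show "(\<integral>\<^sup>+ t. ennreal (norm ((H t)\<^sup>2)) \<partial>lborel) < \<infinity>"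
      using le_less_trans[OF _ ennreal_less_top] by simp
  qed measurable
  have s_bound: "AE t in lborel. norm (s t) \<le> H t"
    using sumAE unfolding s_def H_def by eventually_elim (rule summable_norm)
  have s_L2: "s \<in> L2"
    by (rule L2_bound[OF s_meas H_int]) (use s_bound in \<open>auto elim!: eventually_mono intro: power_mono\<close>)
  have "(\<lambda>N. (norm (abs_l2 s - (\<Sum>n<N. Y n)))\<^sup>2) \<longlonglongrightarrow> 0"
  proof -
    have eq: "(norm (abs_l2 s - (\<Sum>n<N. Y n)))\<^sup>2 = (LINT t|lborel. (norm (s t - (\<Sum>n<N. rep_l2 (Y n) t)))\<^sup>2)" for N
      unfolding norm_l2_sq
    proof (rule integral_cong_AE)
      show "AE t in lborel. (norm (rep_l2 (abs_l2 s - (\<Sum>n<N. Y n)) t))\<^sup>2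
          = (norm (s t - (\<Sum>n<N. rep_l2 (Y n) t)))\<^sup>2"
        using rep_minus[of "abs_l2 s" "\<Sum>n<N. Y n"] rep_sum[of Y "{..<N}"] rep_abs[OF s_L2]
        by eventually_elim simp
    qed measurable
    have "(\<lambda>N. LINT t|lborel. (norm (s t - (\<Sum>n<N. rep_l2 (Y n) t)))\<^sup>2) \<longlonglongrightarrow> (LINT t|(lborel :: real measure). (0 :: real))"
    proof (rule integral_dominated_convergence[where w = "\<lambda>t. (H t)\<^sup>2"])
      show "AE t in lborel. (\<lambda>N. (norm (s t - (\<Sum>n<N. rep_l2 (Y n) t)))\<^sup>2) \<longlonglongrightarrow> 0"
        using sumAE
      proof eventually_elim
        case (elim t)
        have "(\<lambda>N. \<Sum>n<N. rep_l2 (Y n) t) \<longlonglongrightarrow> s t"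
          unfolding s_def using elim by (rule summable_LIMSEQ[OF summable_norm_cancel])
        then have "(\<lambda>N. s t - (\<Sum>n<N. rep_l2 (Y n) t)) \<longlonglongrightarrow> s t - s t"
          by (rule tendsto_diff[OF tendsto_const])
        then have "(\<lambda>N. (norm (s t - (\<Sum>n<N. rep_l2 (Y n) t)))\<^sup>2) \<longlonglongrightarrow> (norm (s t - s t))\<^sup>2"
          by (rule tendsto_power[OF tendsto_norm])
        then show ?case by (simp only: diff_self norm_zero zero_power2)
      qed
      show "AE t in lborel. norm ((norm (s t - (\<Sum>n<N. rep_l2 (Y n) t)))\<^sup>2) \<le> (H t)\<^sup>2" for N
        using sumAE
      proof eventually_elim
        case (elim t)
        have sm: "summable (\<lambda>n. rep_l2 (Y n) t)"
          using elim by (rule summable_norm_cancel)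
        have "s t - (\<Sum>n<N. rep_l2 (Y n) t) = (\<Sum>n. rep_l2 (Y (n + N)) t)"
          unfolding s_def using suminf_minus_initial_segment[OF sm, of N] by simp
        also have "norm \<dots> \<le> (\<Sum>n. norm (rep_l2 (Y (n + N)) t))"
          by (rule summable_norm) (rule summable_ignore_initial_segment[OF elim])
        also have "\<dots> \<le> H t"
        proof -
          have "0 \<le> (\<Sum>n<N. norm (rep_l2 (Y n) t))" by (intro sum_nonneg) simp
          then show ?thesis
            unfolding H_def using suminf_minus_initial_segment[OF elim, of N] by linarith
        qed
        finally have "(norm (s t - (\<Sum>n<N. rep_l2 (Y n) t)))\<^sup>2 \<le> (H t)\<^sup>2"
          by (rule power_mono) simp
        then show ?case by (simp only: real_norm_def abs_power2)
      qed
      show "integrable lborel (\<lambda>t. (H t)\<^sup>2)" by (rule H_int)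
    qed measurable
    then show ?thesis by (simp add: eq)
  qed
  then have "(\<lambda>N. sqrt ((norm (abs_l2 s - (\<Sum>n<N. Y n)))\<^sup>2)) \<longlonglongrightarrow> sqrt 0"
    by (rule tendsto_real_sqrt)
  then have "(\<lambda>N. norm ((\<Sum>n<N. Y n) - abs_l2 s)) \<longlonglongrightarrow> 0"
    by (simp add: norm_minus_commute)
  then have "(\<lambda>N. \<Sum>n<N. Y n) \<longlonglongrightarrow> abs_l2 s"
    by (simp only: tendsto_norm_zero_iff LIM_zero_iff)
  then show ?thesis ..
qed

text \<open>A Cauchy sequence converges as soon as a subsequence does, and a subsequence with
  increments at most \<open>(1/2) ^ n\<close> telescopes into an absolutely convergent
  series.\<close>

instance l2 :: complete_space
proof
  fix X :: "nat \<Rightarrow> l2"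
  assume C: "Cauchy X"
  have "\<forall>n. \<exists>N. \<forall>m\<ge>N. \<forall>k\<ge>N. dist (X m) (X k) < (1/2) ^ n"
  proof
    fix n
    have "(0::real) < (1/2) ^ n" by simp
    then show "\<exists>N. \<forall>m\<ge>N. \<forall>k\<ge>N. dist (X m) (X k) < (1/2) ^ n"
      using C unfolding Cauchy_def by blast
  qed
  then obtain N where N': "\<forall>n. \<forall>m\<ge>N n. \<forall>k\<ge>N n. dist (X m) (X k) < (1/2) ^ n"
    by (rule choice[THEN exE])
  have N: "m \<ge> N n \<Longrightarrow> k \<ge> N n \<Longrightarrow> dist (X m) (X k) < (1/2) ^ n" for n m k
    using N' by blast
  \<comment> \<open>Summing instead of taking a maximum makes \<open>r\<close> strictly increasing,
    thanks to \<open>Suc\<close>, and still gives \<open>N n \<le> r n\<close>.\<close>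
  define r where "r n = (\<Sum>i\<le>n. Suc (N i))" for n
  have r_mono: "strict_mono r"
    by (rule strict_monoI_Suc) (simp add: r_def)
  have r_ge: "N n \<le> r n" for n
    by (cases n) (auto simp: r_def)
  have step: "norm (X (r (Suc n)) - X (r n)) \<le> (1/2) ^ n" for n
  proof -
    have "N n \<le> r (Suc n)"
      using r_ge[of n] strict_monoD[OF r_mono, of n "Suc n"] by simp
    then show ?thesis
      using N[of n "r (Suc n)" "r n"] r_ge[of n] by (simp add: dist_norm less_imp_le)
  qed
  have "summable (\<lambda>n. norm (X (r (Suc n)) - X (r n)))"
  proof (rule summable_comparison_test'[where g = "\<lambda>n. (1/2::real) ^ n" and N = 0])
    show "summable (\<lambda>n. (1/2::real) ^ n)" by (rule summable_geometric) simp
    show "norm (norm (X (r (Suc n)) - X (r n))) \<le> (1/2) ^ n" for n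
      using step[of n] by (simp only: real_norm_def abs_norm_cancel)
  qed
  then obtain s where "(\<lambda>M. \<Sum>n<M. X (r (Suc n)) - X (r n)) \<longlonglongrightarrow> s"
    by (rule exE[OF l2_summable])
  then have "(\<lambda>M. X (r M) - X (r 0)) \<longlonglongrightarrow> s"
    by (simp add: sum_lessThan_telescope[of "\<lambda>n. X (r n)"])
  then have "(\<lambda>M. X (r M) - X (r 0) + X (r 0)) \<longlonglongrightarrow> s + X (r 0)"
    by (rule tendsto_add[OF _ tendsto_const])
  then have "(X \<circ> r) \<longlonglongrightarrow> s + X (r 0)"
    by (simp add: o_def)
  then show "convergent X"
    by (rule convergentI[OF Cauchy_converges_subseq[OF C r_mono]])
qed

instance l2 :: banach ..


section \<open>Convergence in \<open>l2\<close> and convergence almost everywhere\<close>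

lemma l2_subseq_AE:
  assumes "x \<longlonglongrightarrow> (y :: l2)"
  shows "\<exists>r. strict_mono r \<and> (AE t in lborel. (\<lambda>n. rep_l2 (x (r n)) t) \<longlonglongrightarrow> rep_l2 y t)"
proof -
  let ?u = "\<lambda>n t. (norm (rep_l2 (x n - y) t))\<^sup>2"
  have "(\<lambda>n. (norm (x n - y))\<^sup>2) \<longlonglongrightarrow> 0\<^sup>2"
    using assms by (intro tendsto_power tendsto_norm_zero) (simp add: LIM_zero)
  then have lim: "(\<lambda>n. LINT t|lborel. norm (?u n t)) \<longlonglongrightarrow> 0"
    by (simp only: norm_l2_sq real_norm_def abs_power2 zero_power2)
  have "integrable lborel (?u n)" for n
    by (intro L2_integrable rep_L2)
  from tendsto_L1_AE_subseq[OF this lim]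
  obtain r where r: "strict_mono r" "AE t in lborel. (\<lambda>n. ?u (r n) t) \<longlonglongrightarrow> 0"
    by blast
  have "AE t in lborel. \<forall>n. rep_l2 (x n - y) t = rep_l2 (x n) t - rep_l2 y t"
    unfolding AE_all_countable by (auto intro: rep_minus)
  with r(2) have "AE t in lborel. (\<lambda>n. rep_l2 (x (r n)) t) \<longlonglongrightarrow> rep_l2 y t"
  proof eventually_elim
    case (elim t)
    then have "(\<lambda>n. sqrt ((norm (rep_l2 (x (r n)) t - rep_l2 y t))\<^sup>2)) \<longlonglongrightarrow> sqrt 0"
      by (intro tendsto_real_sqrt) simp
    then show ?case
      by (simp add: tendsto_norm_zero_iff LIM_zero_iff)
  qed
  with r(1) show ?thesis by blast
qed

text \<open>The standard way below to compute a limit in \<open>l2\<close>: a subsequence converges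
  almost everywhere to the representative of the limit, so a pointwise limit found by other means
  agrees with it.\<close>

lemma l2_limit_AE:
  assumes "x \<longlonglongrightarrow> (y :: l2)" "AE t in lborel. (\<lambda>n. rep_l2 (x n) t) \<longlonglongrightarrow> f t"
  shows "AE t in lborel. rep_l2 y t = f t"
proof -
  obtain r where r: "strict_mono r" "AE t in lborel. (\<lambda>n. rep_l2 (x (r n)) t) \<longlonglongrightarrow> rep_l2 y t"
    using l2_subseq_AE[OF assms(1)] by blast
  from r(2) assms(2) show ?thesis
  proof eventually_elim
    case (elim t)
    then show ?case
      using LIMSEQ_subseq_LIMSEQ[OF elim(2) r(1)] by (auto simp: o_def intro: LIMSEQ_unique)
  qed
qed

lemma l2_dominated_convergence:
  fixes f :: "nat \<Rightarrow> real \<Rightarrow> complex"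
  assumes [measurable]: "\<And>n. f n \<in> borel_measurable borel" "F \<in> borel_measurable borel"
    and g: "g \<in> L2"
    and lim: "AE t in lborel. (\<lambda>n. f n t) \<longlonglongrightarrow> F t"
    and bound: "\<And>n. AE t in lborel. norm (f n t) \<le> norm (g t)"
  shows "f n \<in> L2" "F \<in> L2" "(\<lambda>n. abs_l2 (f n)) \<longlonglongrightarrow> abs_l2 F"
proof -
  show f: "f n \<in> L2" for n
    by (rule L2_bound[OF _ L2_integrable[OF g]]) (use bound[of n] in \<open>auto elim!: eventually_mono intro: power_mono\<close>)
  have "AE t in lborel. \<forall>n. norm (f n t) \<le> norm (g t)"
    unfolding AE_all_countable using bound by blast
  with lim have bF: "AE t in lborel. norm (F t) \<le> norm (g t) \<and> (\<forall>n. norm (f n t) \<le> norm (g t))"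
    by eventually_elim (auto intro: LIMSEQ_le_const2[OF tendsto_norm])
  show F: "F \<in> L2"
    by (rule L2_bound[OF _ L2_integrable[OF g]]) (use bF in \<open>auto elim!: eventually_mono intro: power_mono\<close>)
  have "(\<lambda>n. LINT t|lborel. (norm (f n t - F t))\<^sup>2) \<longlonglongrightarrow> (LINT t|(lborel :: real measure). (0::real))"
  proof (rule integral_dominated_convergence[where w = "\<lambda>t. 4 * (norm (g t))\<^sup>2"])
    show "AE t in lborel. (\<lambda>n. (norm (f n t - F t))\<^sup>2) \<longlonglongrightarrow> 0"
      using lim
    proof eventually_elim
      case (elim t)
      then have "(\<lambda>n. (norm (f n t - F t))\<^sup>2) \<longlonglongrightarrow> (norm (F t - F t))\<^sup>2"
        by (intro tendsto_intros)
      then show ?case by simp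
    qed
    show "AE t in lborel. norm ((norm (f n t - F t))\<^sup>2) \<le> 4 * (norm (g t))\<^sup>2" for n
      using bF
    proof eventually_elim
      case (elim t)
      then have "norm (f n t - F t) \<le> 2 * norm (g t)"
        using norm_triangle_ineq4[of "f n t" "F t"] by (smt (verit))
      then have "(norm (f n t - F t))\<^sup>2 \<le> (2 * norm (g t))\<^sup>2"
        by (intro power_mono) auto
      then show ?case by (simp add: power_mult_distrib)
    qed
  qed (use g in \<open>auto intro: L2_integrable\<close>)
  then have "(\<lambda>n. (norm (abs_l2 (f n) - abs_l2 F))\<^sup>2) \<longlonglongrightarrow> 0"
    by (simp add: abs_diff[OF f F, symmetric] norm_abs_sq[OF L2_diff[OF f F]])
  then have "(\<lambda>n. sqrt ((norm (abs_l2 (f n) - abs_l2 F))\<^sup>2)) \<longlonglongrightarrow> sqrt 0"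
    by (rule tendsto_real_sqrt)
  then show "(\<lambda>n. abs_l2 (f n)) \<longlonglongrightarrow> abs_l2 F"
    by (simp add: tendsto_norm_zero_iff LIM_zero_iff)
qed

subsection \<open>Multiplication by bounded functions and conjugation\<close>

definition bmeas :: "(real \<Rightarrow> complex) \<Rightarrow> bool" where
  "bmeas m \<longleftrightarrow> m \<in> borel_measurable borel \<and> bounded (range m)"

definition bmul :: "(real \<Rightarrow> complex) \<Rightarrow> l2 \<Rightarrow> l2" where
  "bmul m x = abs_l2 (\<lambda>t. m t * rep_l2 x t)"

text \<open>\<open>bmul m\<close> is multiplication by \<open>m\<close> only if \<open>bmeas m\<close>; complex scalars are constant multipliers.\<close>

lemma bmeasI: "m \<in> borel_measurable borel \<Longrightarrow> (\<And>t. norm (m t) \<le> C) \<Longrightarrow> bmeas m"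
  by (auto simp: bmeas_def bounded_iff)

lemma bmeas_measurable [measurable_dest]: "bmeas m \<Longrightarrow> m \<in> borel_measurable borel"
  by (simp add: bmeas_def)

lemma bmeas_bound: "bmeas m \<Longrightarrow> \<exists>C. \<forall>t. norm (m t) \<le> C"
  by (auto simp: bmeas_def bounded_iff)

lemma bmeas_const [simp]: "bmeas (\<lambda>t. c)"
  by (rule bmeasI[of _ "norm c"]) auto

lemma bmeas_indicator [simp]: "A \<in> sets borel \<Longrightarrow> bmeas (indicator A)"
  by (rule bmeasI[of _ 1]) (auto simp: indicator_def)

lemma bmeas_mult: "bmeas m \<Longrightarrow> bmeas n \<Longrightarrow> bmeas (\<lambda>t. m t * n t)"
proof -
  assume m: "bmeas m" "bmeas n"
  then obtain C D where "\<And>t. norm (m t) \<le> C" "\<And>t. norm (n t) \<le> D"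
    using bmeas_bound by metis
  then have "norm (m t * n t) \<le> C * D" for t
    unfolding norm_mult by (intro mult_mono) (auto intro: order_trans[OF norm_ge_zero])
  then show ?thesis
    using m by (intro bmeasI[of _ "C * D"]) (auto dest: bmeas_measurable)
qed

lemma bmeas_cnj: "bmeas m \<Longrightarrow> bmeas (\<lambda>t. cnj (m t))"
  using bmeas_bound[of m] by (auto intro!: bmeasI dest: bmeas_measurable)

lemma L2_bmul: "bmeas m \<Longrightarrow> f \<in> L2 \<Longrightarrow> (\<lambda>t. m t * f t) \<in> L2"
  using bmeas_bound[of m] by (auto intro: L2_bounded_mult dest: bmeas_measurable)

lemma rep_bmul: "bmeas m \<Longrightarrow> AE t in lborel. rep_l2 (bmul m x) t = m t * rep_l2 x t"
  unfolding bmul_def by (intro rep_abs L2_bmul rep_L2)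

lemma bmul_abs:
  assumes "bmeas m" "f \<in> L2"
  shows "bmul m (abs_l2 f) = abs_l2 (\<lambda>t. m t * f t)"
  by (rule l2_eqI) (use rep_bmul[OF assms(1), of "abs_l2 f"] rep_abs[OF assms(2)]
    rep_abs[OF L2_bmul[OF assms]] in \<open>eventually_elim, simp\<close>)

lemma bmul_bmul:
  assumes "bmeas m" "bmeas n"
  shows "bmul m (bmul n x) = bmul (\<lambda>t. m t * n t) x"
  by (rule l2_eqI) (use rep_bmul[OF assms(1), of "bmul n x"] rep_bmul[OF assms(2), of x]
    rep_bmul[OF bmeas_mult[OF assms], of x] in \<open>eventually_elim, simp\<close>)

lemma bmul_add:
  assumes "bmeas m"
  shows "bmul m (x + y) = bmul m x + bmul m y"
  by (rule l2_eqI) (use rep_bmul[OF assms, of x] rep_bmul[OF assms, of y] rep_bmul[OF assms, of "x + y"]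
    rep_plus[of x y] rep_plus[of "bmul m x" "bmul m y"] in \<open>eventually_elim, simp add: algebra_simps\<close>)

lemma bmul_scaleR:
  assumes "bmeas m"
  shows "bmul m (r *\<^sub>R x) = r *\<^sub>R bmul m x"
  by (rule l2_eqI) (use rep_bmul[OF assms, of x] rep_bmul[OF assms, of "r *\<^sub>R x"]
    rep_scaleR[of r x] rep_scaleR[of r "bmul m x"] in \<open>eventually_elim, simp\<close>)

lemma bmul_of_real: "bmul (\<lambda>t. of_real r) x = r *\<^sub>R x"
  by (rule l2_eqI) (use rep_bmul[OF bmeas_const, of "of_real r" x] rep_scaleR[of r x] in
    \<open>eventually_elim, simp add: scaleR_conv_of_real\<close>)

text \<open>Reduces complex linearity to real linearity and compatibility with \<open>\<i>\<close>;
  this is how \<open>FT\<close> becomes complex linear.\<close>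

lemma bmul_const_eq: "bmul (\<lambda>t. c) x = Re c *\<^sub>R x + Im c *\<^sub>R bmul (\<lambda>t. \<i>) x"
proof (rule l2_eqI)
  show "AE t in lborel. rep_l2 (bmul (\<lambda>t. c) x) t = rep_l2 (Re c *\<^sub>R x + Im c *\<^sub>R bmul (\<lambda>t. \<i>) x) t"
    using rep_bmul[OF bmeas_const, of c x] rep_scaleR[of "Re c" x] rep_scaleR[of "Im c" "bmul (\<lambda>t. \<i>) x"]
      rep_bmul[OF bmeas_const, of \<i> x] rep_plus[of "Re c *\<^sub>R x" "Im c *\<^sub>R bmul (\<lambda>t. \<i>) x"]
    by eventually_elim (simp add: complex_eq_iff algebra_simps)
qed

lemma norm_bmul_le:
  assumes "bmeas m" "\<And>t. norm (m t) \<le> C"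
  shows "norm (bmul m x) \<le> C * norm x"
proof -
  have C: "0 \<le> C" using assms(2)[of 0] norm_ge_zero order_trans by blast
  have "(norm (bmul m x))\<^sup>2 \<le> (LINT t|lborel. C\<^sup>2 * (norm (rep_l2 x t))\<^sup>2)"
  proof (rule norm_le_bound)
    show "AE t in lborel. (norm (rep_l2 (bmul m x) t))\<^sup>2 \<le> C\<^sup>2 * (norm (rep_l2 x t))\<^sup>2"
      using rep_bmul[OF assms(1), of x]
      by eventually_elim (auto simp: norm_mult power_mult_distrib intro!: mult_right_mono power_mono assms(2))
  qed (auto intro: L2_integrable)
  also have "\<dots> = (C * norm x)\<^sup>2"
    by (simp add: norm_l2_sq power_mult_distrib)
  finally show ?thesis
    using C by (auto intro: power2_le_imp_le)
qed

lemma bounded_linear_bmul: "bmeas m \<Longrightarrow> bounded_linear (bmul m)"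
proof -
  assume m: "bmeas m"
  then obtain C where "\<And>t. norm (m t) \<le> C" using bmeas_bound by blast
  with m show ?thesis
    by (intro bounded_linear_intro[of _ C]) (auto simp: bmul_add bmul_scaleR mult.commute[of _ C] intro: norm_bmul_le)
qed

lemma cint_bmul_left:
  assumes "bmeas m"
  shows "cint (bmul m x) y = cint x (bmul (\<lambda>t. cnj (m t)) y)"
proof -
  have "cint (bmul m x) y = (LINT t|lborel. cnj (m t * rep_l2 x t) * rep_l2 y t)"
    by (rule cint_AE_cong) (use rep_bmul[OF assms] bmeas_measurable[OF assms] in auto)
  also have "\<dots> = (LINT t|lborel. cnj (rep_l2 x t) * (cnj (m t) * rep_l2 y t))"
    by (simp add: mult_ac)
  also have "\<dots> = cint x (bmul (\<lambda>t. cnj (m t)) y)"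
    by (rule cint_AE_cong[symmetric]) (use rep_bmul[OF bmeas_cnj[OF assms]] bmeas_measurable[OF assms] in auto)
  finally show ?thesis .
qed

lemma cint_add_right: "cint z (x + y) = cint z x + cint z y"
  by (subst (1 2 3) cint_cnj[symmetric]) (simp add: cint_add_left)

lemma cint_bmul_const_right: "cint x (bmul (\<lambda>t. c) y) = c * cint x y"
proof -
  have "cint x (bmul (\<lambda>t. c) y) = (LINT t|lborel. cnj (rep_l2 x t) * (c * rep_l2 y t))"
    by (rule cint_AE_cong) (use rep_bmul[of "\<lambda>_. c"] in auto)
  also have "\<dots> = (LINT t|lborel. c * (cnj (rep_l2 x t) * rep_l2 y t))"
    by (simp add: mult_ac)
  finally show ?thesis by (simp add: cint_def)
qed

text \<open>Since the imaginary part is a real inner product too, \<open>cint\<close> inherits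
  continuity from \<open>inner\<close>.\<close>

lemma cint_eq_inner: "cint x y = Complex (inner x y) (inner (bmul (\<lambda>t. \<i>) x) y)"
proof -
  have "cint (bmul (\<lambda>t. \<i>) x) y = - \<i> * cint x y"
    by (simp add: cint_bmul_left cint_bmul_const_right del: mult_minus_left)
  then show ?thesis
    by (simp add: inner_l2_def complex_eq_iff)
qed

definition cj :: "l2 \<Rightarrow> l2" where
  "cj x = abs_l2 (\<lambda>t. cnj (rep_l2 x t))"

lemma rep_cj: "AE t in lborel. rep_l2 (cj x) t = cnj (rep_l2 x t)"
  unfolding cj_def by (intro rep_abs L2_cnj rep_L2)

lemma cj_cj [simp]: "cj (cj x) = x"
  by (rule l2_eqI) (use rep_cj[of x] rep_cj[of "cj x"] in \<open>eventually_elim, simp\<close>)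

lemma cj_bmul:
  assumes "bmeas m"
  shows "cj (bmul m x) = bmul (\<lambda>t. cnj (m t)) (cj x)"
  by (rule l2_eqI) (use rep_cj[of "bmul m x"] rep_bmul[OF assms, of x] rep_cj[of x]
    rep_bmul[OF bmeas_cnj[OF assms], of "cj x"] in \<open>eventually_elim, simp\<close>)

lemma bounded_linear_cj: "bounded_linear cj"
proof (rule bounded_linear_intro[of _ 1])
  fix x y r
  show "cj (x + y) = cj x + cj y"
    by (rule l2_eqI) (use rep_cj[of "x + y"] rep_cj[of x] rep_cj[of y] rep_plus[of x y] rep_plus[of "cj x" "cj y"] in
      \<open>eventually_elim, simp\<close>)
  show "cj (r *\<^sub>R x) = r *\<^sub>R cj x"
    by (rule l2_eqI) (use rep_cj[of "r *\<^sub>R x"] rep_cj[of x] rep_scaleR[of r x] rep_scaleR[of r "cj x"] in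
      \<open>eventually_elim, simp\<close>)
  have "(norm (cj x))\<^sup>2 = (LINT t|lborel. (norm (cnj (rep_l2 x t)))\<^sup>2)"
    unfolding cj_def by (rule norm_abs_sq[OF L2_cnj[OF rep_L2]])
  also have "\<dots> = (norm x)\<^sup>2"
    by (simp add: norm_l2_sq)
  finally show "norm (cj x) \<le> norm x * 1" by simp
qed

subsection \<open>Density of step functions\<close>

lemma L2_indicator_subset:
  assumes "A \<in> sets borel" "A \<subseteq> {a..b}"
  shows "(indicator A :: real \<Rightarrow> complex) \<in> L2"
proof (rule L2_bound)
  show "integrable lborel (indicat_real {a..b})"
    by (intro integrable_real_indicator) (auto simp: emeasure_lborel_Icc_eq)
  show "AE x in lborel. (norm (indicator A x :: complex))\<^sup>2 \<le> indicat_real {a..b} x"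
    using assms(2) by (intro AE_I2) (auto simp: indicator_def)
qed (use assms in measurable)

lemma L2_Ioc: "(indicator {a<..b} :: real \<Rightarrow> complex) \<in> L2"
  by (rule L2_indicator_subset[of _ a b]) auto

definition ivl :: "real \<Rightarrow> real \<Rightarrow> l2" where
  "ivl a b = abs_l2 (indicator {a<..b})"

text \<open>Induction over the Dynkin system generated by half-open intervals. Cutting with a
  bounded interval keeps every indicator square integrable, so that complements become differences
  and disjoint unions become limits in \<open>l2\<close>.\<close>

lemma step_indicator:
  assumes "closed S" "subspace S" and ivl: "\<And>a b. ivl a b \<in> S" and A: "A \<in> sets borel"
  shows "abs_l2 (indicator (A \<inter> {-c<..c})) \<in> S"
proof -
  let ?G = "range (\<lambda>(a, b). {a<..b::real})"
  have L: "(indicator (B \<inter> {-c<..c}) :: real \<Rightarrow> complex) \<in> L2" if "B \<in> sets borel" for B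
    by (rule L2_indicator_subset[of _ "-c" c]) (use that in auto)
  have sets: "sigma_sets UNIV ?G = sets borel"
    by (subst borel_sigma_sets_Ioc) simp
  have "Int_stable ?G"
  proof (rule Int_stableI)
    fix A B assume "A \<in> ?G" "B \<in> ?G"
    then obtain a b a' b' where "A = {a<..b}" "B = {a'<..b'}" by auto
    then have "A \<inter> B = (\<lambda>(a, b). {a<..b}) (max a a', min b b')" by auto
    then show "A \<inter> B \<in> ?G" by blast
  qed
  moreover have "?G \<subseteq> Pow UNIV" by simp
  moreover have "A \<in> sigma_sets UNIV ?G" using A sets by simp
  ultimately show ?thesis
  proof (induction rule: sigma_sets_induct_disjoint)
    case (basic A)
    then obtain a b where "A = {a<..b}" by auto
    then have "A \<inter> {-c<..c} = {max a (-c)<..min b c}" by auto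
    then show ?case using ivl by (simp add: ivl_def)
  next
    case empty
    have "(indicator ({} \<inter> {-c<..c}) :: real \<Rightarrow> complex) = (\<lambda>t. 0)"
      by (auto simp: indicator_def)
    then have "abs_l2 (indicator ({} \<inter> {-c<..c})) = 0"
      by (simp only: zero_l2_def)
    then show ?case using subspace_0[OF assms(2)] by (simp only:)
  next
    case (compl A)
    then have A: "A \<in> sets borel" by (simp add: sets)
    have LI: "(indicator {-c<..c} :: real \<Rightarrow> complex) \<in> L2"
      by (rule L2_Ioc)
    have "(indicator ((UNIV - A) \<inter> {-c<..c}) :: real \<Rightarrow> complex)
       = (\<lambda>t. indicator {-c<..c} t - indicator (A \<inter> {-c<..c}) t)"
      by (auto simp: indicator_def fun_eq_iff)
    then have "abs_l2 (indicator ((UNIV - A) \<inter> {-c<..c})) = ivl (-c) c - abs_l2 (indicator (A \<inter> {-c<..c}))"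
      unfolding ivl_def by (simp add: abs_diff[OF LI L[OF A]])
    then show ?case
      using compl.IH ivl assms(2) by (simp add: subspace_diff)
  next
    case (union A)
    then have A: "A i \<in> sets borel" for i using sets by auto
    have sm: "(indicator ((\<Union>i<n. A i) \<inter> {-c<..c}) :: real \<Rightarrow> complex)
        = (\<lambda>t. \<Sum>i<n. indicator (A i \<inter> {-c<..c}) t)" for n
      using union.hyps(1)
    proof (induction n)
      case (Suc n)
      have "A n \<inter> A i = {}" if "i < n" for i
        using Suc.prems that by (simp add: disjoint_family_on_def)
      then have "A n \<inter> (\<Union>i<n. A i) = {}"
        by auto
      then have "(indicator ((\<Union>i<Suc n. A i) \<inter> {-c<..c}) t :: complex)
          = indicator ((\<Union>i<n. A i) \<inter> {-c<..c}) t + indicator (A n \<inter> {-c<..c}) t" for t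
        by (auto simp: indicator_def lessThan_Suc)
      then show ?case using Suc by (simp add: fun_eq_iff)
    qed (simp add: indicator_def fun_eq_iff)
    have abssum: "(\<lambda>t. \<Sum>i<n. indicator (A i \<inter> {-c<..c}) t :: complex) \<in> L2
        \<and> abs_l2 (\<lambda>t. \<Sum>i<n. indicator (A i \<inter> {-c<..c}) t) \<in> S" for n
    proof (induction n)
      case (Suc n)
      then show ?case
        using L2_add[of "\<lambda>t. \<Sum>i<n. indicator (A i \<inter> {-c<..c}) t", OF _ L[OF A]] union.IH assms(2)
        by (simp add: abs_add[OF _ L[OF A]] subspace_add)
    qed (use assms(2) L2_zero in \<open>auto simp: subspace_0 simp flip: zero_l2_def\<close>)
    have "(\<lambda>n. abs_l2 (indicator ((\<Union>i<n. A i) \<inter> {-c<..c}))) \<longlonglongrightarrow> abs_l2 (indicator ((\<Union>i. A i) \<inter> {-c<..c}))"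
    proof (rule l2_dominated_convergence(3)[where g = "indicator {-c<..c}"])
      show "AE t in lborel. (\<lambda>n. indicator ((\<Union>i<n. A i) \<inter> {-c<..c}) t :: complex)
          \<longlonglongrightarrow> indicator ((\<Union>i. A i) \<inter> {-c<..c}) t"
      proof (rule AE_I2)
        fix t
        have "(\<lambda>n. indicator (\<Union>i<n. A i) t * indicator {-c<..c} t :: complex) \<longlonglongrightarrow> indicator (\<Union>i. A i) t * indicator {-c<..c} t"
          by (intro tendsto_intros LIMSEQ_indicator_UN)
        then show "(\<lambda>n. indicator ((\<Union>i<n. A i) \<inter> {-c<..c}) t :: complex) \<longlonglongrightarrow> indicator ((\<Union>i. A i) \<inter> {-c<..c}) t"
          by (simp add: indicator_inter_arith)
      qed
    qed (use A in \<open>auto simp: L2_Ioc indicator_def intro!: borel_measurable_indicator\<close>)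
    moreover have "abs_l2 (indicator ((\<Union>i<n. A i) \<inter> {-c<..c})) \<in> S" for n
      using abssum by (simp add: sm)
    ultimately show ?case
      using assms(1) by (meson closed_sequentially)
  qed
qed

text \<open>Simple functions approximating a representative, cut to bounded intervals, converge to
  it in \<open>l2\<close> by domination. It serves as an induction rule: an identity between
  continuous operators is checked on intervals and extended by density.\<close>

lemma l2_induct:
  fixes S :: "l2 set"
  assumes "closed S" "subspace S" "\<And>a b. ivl a b \<in> S" "\<And>x. x \<in> S \<Longrightarrow> bmul (\<lambda>t. \<i>) x \<in> S"
  shows "x \<in> S"
proof -
  obtain F where F: "\<And>i. simple_function lborel (F i)" "\<And>t. (\<lambda>i. F i t) \<longlonglongrightarrow> rep_l2 x t"
    "\<And>i t. norm (F i t) \<le> 2 * norm (rep_l2 x t)"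
    using borel_measurable_implies_sequence_metric[of "rep_l2 x" lborel 0] by (auto simp: dist_norm)
  let ?I = "\<lambda>n. {- real n<..real n}"
  define H where "H n t = F n t * indicator (?I n) t" for n t
  have F_meas [measurable]: "F n \<in> borel_measurable borel" for n
    using borel_measurable_simple_function[OF F(1)] by simp
  have ind: "(indicator (A \<inter> ?I n) :: real \<Rightarrow> complex) \<in> L2" if "A \<in> sets borel" for A n
    by (rule L2_indicator_subset[of _ "- real n" "real n"]) (use that in auto)
  have cS: "abs_l2 (\<lambda>t. c * f t) \<in> S" if f: "f \<in> L2" "abs_l2 f \<in> S" for c f
  proof -
    have "abs_l2 (\<lambda>t. c * f t) = Re c *\<^sub>R abs_l2 f + Im c *\<^sub>R bmul (\<lambda>t. \<i>) (abs_l2 f)"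
      by (simp only: bmul_abs[OF bmeas_const f(1), symmetric] bmul_const_eq[of c])
    then show ?thesis
      using f(2) assms(2,4) by (simp add: subspace_add subspace_scale)
  qed
  have sumS: "(\<lambda>t. \<Sum>i\<in>J. c i * f i t) \<in> L2 \<and> abs_l2 (\<lambda>t. \<Sum>i\<in>J. c i * f i t) \<in> S"
    if "finite J" "\<And>i. i \<in> J \<Longrightarrow> f i \<in> L2 \<and> abs_l2 (f i) \<in> S" for J and c :: "complex \<Rightarrow> complex" and f :: "complex \<Rightarrow> real \<Rightarrow> complex"
    using that
  proof (induction J rule: finite_induct)
    case empty
    then show ?case using assms(2) L2_zero by (auto simp: subspace_0 simp flip: zero_l2_def)
  next
    case (insert i J)
    then show ?case
      using cS[of "f i" "c i"] assms(2) by (auto simp: abs_add L2_add L2_cmult subspace_add)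
  qed
  have HS: "abs_l2 (H n) \<in> S" for n
  proof -
    have fin: "finite (range (F n))"
      using F(1)[of n] by (simp add: simple_function_def)
    have pre: "F n -` {c} \<in> sets borel" for c
      using measurable_sets[OF F_meas[of n], of "{c}"] by simp
    have "H n = (\<lambda>t. \<Sum>c\<in>range (F n). c * indicator (F n -` {c} \<inter> ?I n) t)"
    proof
      fix t
      have "(\<Sum>c\<in>range (F n). c * indicator (F n -` {c} \<inter> ?I n) t) = (\<Sum>c\<in>range (F n). if c = F n t then c * indicator (?I n) t else 0)"
        by (rule sum.cong) (auto simp: indicator_def)
      also have "\<dots> = H n t"
        using fin by (simp add: H_def sum.delta)
      finally show "H n t = (\<Sum>c\<in>range (F n). c * indicator (F n -` {c} \<inter> ?I n) t)" ..
    qed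
    then show ?thesis
      using sumS[OF fin, of "\<lambda>c. indicator (F n -` {c} \<inter> ?I n)" "\<lambda>c. c"]
        step_indicator[OF assms(1,2,3) pre] ind[OF pre] by simp
  qed
  have "(\<lambda>n. abs_l2 (H n)) \<longlonglongrightarrow> abs_l2 (rep_l2 x)"
  proof (rule l2_dominated_convergence(3)[where g = "\<lambda>t. 2 * rep_l2 x t"])
    show "AE t in lborel. (\<lambda>n. H n t) \<longlonglongrightarrow> rep_l2 x t"
    proof (rule AE_I2)
      fix t
      obtain N where N: "\<bar>t\<bar> < real N" using reals_Archimedean2 by blast
      have "\<forall>\<^sub>F n in sequentially. F n t = H n t"
        using eventually_ge_at_top[of N]
        by eventually_elim (use N in \<open>auto simp: H_def indicator_def\<close>)
      then show "(\<lambda>n. H n t) \<longlonglongrightarrow> rep_l2 x t"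
        using F(2)[of t] by (rule Lim_transform_eventually[rotated])
    qed
    show "AE t in lborel. norm (H n t) \<le> norm (2 * rep_l2 x t)" for n
      using F(3)[of n] by (auto simp: H_def norm_mult indicator_def)
  qed (auto simp: H_def[abs_def] intro: L2_cmult)
  then show ?thesis
    using closed_sequentially[OF assms(1), of "\<lambda>n. abs_l2 (H n)"] HS by simp
qed


section \<open>The Fourier transform of a step function\<close>

lemma has_bochner_integral_even:
  fixes f :: "real \<Rightarrow> real"
  assumes f: "has_bochner_integral lborel (\<lambda>x. indicator {0<..} x * f x) I" and even: "\<And>x. f (- x) = f x"
    and [measurable]: "f \<in> borel_measurable borel"
  shows "has_bochner_integral lborel f (2 * I)"
proof -
  have "has_bochner_integral lborel (\<lambda>x. indicator {0<..} (0 + (-1) * x) * f (0 + (-1) * x)) (I /\<^sub>R \<bar>-1\<bar>)"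
    by (subst lborel_has_bochner_integral_real_affine_iff[symmetric]) (use f in auto)
  then have "has_bochner_integral lborel (\<lambda>x. indicator {0<..} (- x) * f x) I"
    by (simp add: even)
  with f have "has_bochner_integral lborel (\<lambda>x. indicator {0<..} x * f x + indicator {0<..} (- x) * f x) (I + I)"
    by (rule has_bochner_integral_add)
  moreover have "AE x in lborel. indicator {0<..} x * f x + indicator {0<..} (- x) * f x = f x"
    using AE_lborel_singleton[of 0] by eventually_elim (auto simp: indicator_def)
  ultimately show ?thesis
    by (subst (asm) has_bochner_integral_cong_AE[where g = f]) auto
qed

lemma integral_odd:
  fixes f :: "real \<Rightarrow> real"
  assumes "\<And>x. f (- x) = - f x"
  shows "(LINT x|lborel. f x) = 0"
  using lborel_integral_real_affine[of "-1" f 0] by (simp add: assms)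

text \<open>Integration by parts reduces the integral to the sine integral \<open>Si\<close>, whose
  limit is \<open>pi / 2\<close>. The integrand is nonnegative, so the improper fundamental theorem
  also gives absolute integrability. All inner products of transforms of intervals are combinations
  of these integrals.\<close>

lemma has_bochner_integral_one_minus_cos:
  "has_bochner_integral lborel (\<lambda>x. (1 - cos (t * x)) / x\<^sup>2) (pi * \<bar>t\<bar>)"
proof -
  have pos: "has_bochner_integral lborel (\<lambda>x. (1 - cos (t * x)) / x\<^sup>2) (pi * t)" if t: "t > 0" for t
  proof -
    let ?F = "\<lambda>x. - (1 - cos (t * x)) / x + t * Si (t * x)" and ?f = "\<lambda>x. (1 - cos (t * x)) / x\<^sup>2"
    have D: "DERIV ?F x :> ?f x" if "0 < x" for x
    proof -
      have "DERIV ?F x :> - ((sin (t * x) * t) * x - (1 - cos (t * x)) * 1) / (x * x) + t * (sinc (t * x) * t)"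
        by (rule derivative_eq_intros DERIV_chain2[OF DERIV_Si] refl | use that in simp)+
      also have "- ((sin (t * x) * t) * x - (1 - cos (t * x)) * 1) / (x * x) + t * (sinc (t * x) * t) = ?f x"
        using that t by (simp add: field_simps power2_eq_square)
      finally show ?thesis .
    qed
    have "((\<lambda>x. - (1 - cos (t * x)) / x) \<longlongrightarrow> 0) (at_right 0)"
      by real_asymp
    moreover have "((\<lambda>x. t * Si (t * x)) \<longlongrightarrow> t * Si (t * 0)) (at_right 0)"
      by (intro tendsto_intros isCont_tendsto_compose[OF isCont_Si])
    ultimately have "(?F \<longlongrightarrow> 0 + t * Si (t * 0)) (at_right 0)"
      by (rule tendsto_add)
    then have A: "(?F \<longlongrightarrow> 0) (at_right 0)"
      using Si_neg[of 0] by simp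
    have "((\<lambda>x. - (1 - cos (t * x)) / x) \<longlongrightarrow> 0) at_top"
      by real_asymp
    moreover have "filterlim (\<lambda>x. t * x) at_top at_top"
      using t by real_asymp
    then have "((\<lambda>x. t * Si (t * x)) \<longlongrightarrow> t * (pi / 2)) at_top"
      by (intro tendsto_intros filterlim_compose[OF Si_at_top])
    ultimately have B: "(?F \<longlongrightarrow> 0 + t * (pi / 2)) at_top"
      by (rule tendsto_add)
    have D': "DERIV ?F x :> ?f x" if "0 < ereal x" "ereal x < \<infinity>" for x
      using D that by (simp add: zero_ereal_def)
    have C: "isCont ?f x" if "0 < ereal x" "ereal x < \<infinity>" for x
      using that by (intro continuous_intros) (auto simp: zero_ereal_def)
    have N: "AE x in lborel. 0 < ereal x \<longrightarrow> ereal x < \<infinity> \<longrightarrow> 0 \<le> ?f x"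
      by simp
    have A': "((?F \<circ> real_of_ereal) \<longlongrightarrow> 0) (at_right 0)"
      unfolding zero_ereal_def ereal_tendsto_simps using A .
    have B': "((?F \<circ> real_of_ereal) \<longlongrightarrow> 0 + t * (pi / 2)) (at_left \<infinity>)"
      unfolding ereal_tendsto_simps using B .
    have "set_integrable lborel (einterval 0 \<infinity>) ?f"
      by (rule interval_integral_FTC_nonneg(1)[OF _ D' C N A' B']) auto
    moreover have "(LBINT x=0..\<infinity>. ?f x) = 0 + t * (pi / 2) - 0"
      by (rule interval_integral_FTC_nonneg(2)[OF _ D' C N A' B']) auto
    moreover have "einterval 0 \<infinity> = {0<..}"
      by (auto simp: einterval_def zero_ereal_def)
    moreover have "(LBINT x=0..\<infinity>. ?f x) = (LBINT x:{0<..}. ?f x)"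
      unfolding zero_ereal_def by (rule interval_integral_to_infinity_eq)
    ultimately have "set_integrable lborel {0<..} ?f" "(LBINT x:{0<..}. ?f x) = t * (pi / 2)"
      by simp_all
    then have "has_bochner_integral lborel (\<lambda>x. indicator {0<..} x * ?f x) (t * (pi / 2))"
      by (simp add: set_integrable_def set_lebesgue_integral_def has_bochner_integral_iff)
    from has_bochner_integral_even[OF this] show ?thesis
      by (simp add: mult.commute)
  qed
  consider "t > 0" | "t = 0" | "t < 0" by linarith
  then show ?thesis
  proof cases
    case 1
    with pos[OF this] show ?thesis by simp
  next
    case 2
    then show ?thesis by (simp add: has_bochner_integral_zero)
  next
    case 3
    with pos[of "-t"] show ?thesis by simp
  qed
qed

text \<open>The Fourier integral of the indicator of \<open>{a<..b}\<close> at
  \<open>\<xi> \<noteq> 0\<close>. At \<open>\<xi> = 0\<close> division by zero yields 0 instead of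
  \<open>b - a\<close>, which affects only a null set; the case distinction accounts for empty
  intervals.\<close>

definition hat :: "real \<Rightarrow> real \<Rightarrow> real \<Rightarrow> complex" where
  "hat a b \<xi> = (if a \<le> b then (cis (- (a * \<xi>)) - cis (- (b * \<xi>))) / (\<i> * of_real \<xi>) else 0)"

lemma exp_eq_cis: "exp (- \<i> * of_real x * of_real \<xi>) = cis (- (x * \<xi>))"
  by (simp add: cis_conv_exp mult.assoc)

lemma measurable_cis [measurable]: "cis \<in> borel_measurable borel"
  by (intro borel_measurable_continuous_onI continuous_intros)

lemma hat_measurable [measurable]: "hat a b \<in> borel_measurable borel"
  unfolding hat_def[abs_def] by measurable

lemma hat_product:
  assumes "a \<le> b" "c \<le> d"
  shows "cnj (hat a b \<xi>) * hat c d \<xi>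
    = cnj (cis (- (a * \<xi>)) - cis (- (b * \<xi>))) * (cis (- (c * \<xi>)) - cis (- (d * \<xi>))) / of_real (\<xi>\<^sup>2)"
proof -
  have sq: "- (\<i> * z) * (\<i> * z) = z\<^sup>2" for z
    by (simp add: complex_eq_iff power2_eq_square algebra_simps)
  have "cnj (\<i> * of_real \<xi>) = - (\<i> * of_real \<xi>)"
    by simp
  then show ?thesis
    using assms by (simp only: hat_def if_True complex_cnj_divide times_divide_times_eq sq of_real_power)
qed

text \<open>The signs of the four cosines sum to zero, so each cosine can be replaced by its
  difference from 1, which makes every term integrable by itself.\<close>

lemma Re_hat_product:
  assumes "a \<le> b" "c \<le> d"
  shows "Re (cnj (hat a b \<xi>) * hat c d \<xi>) = (1 - cos ((a - d) * \<xi>)) / \<xi>\<^sup>2 + (1 - cos ((b - c) * \<xi>)) / \<xi>\<^sup>2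
    - (1 - cos ((a - c) * \<xi>)) / \<xi>\<^sup>2 - (1 - cos ((b - d) * \<xi>)) / \<xi>\<^sup>2"
  unfolding hat_product[OF assms] Re_divide_of_real left_diff_distrib cos_diff
  by (simp add: add_divide_distrib[symmetric] diff_divide_distrib[symmetric] algebra_simps)

lemma hat_L2: "hat a b \<in> L2"
proof (cases "a \<le> b")
  case True
  have "integrable lborel (\<lambda>\<xi>. 2 * ((1 - cos ((b - a) * \<xi>)) / \<xi>\<^sup>2))"
    using has_bochner_integral_one_minus_cos[of "b - a"] by (intro integrable_mult_right) (auto simp: has_bochner_integral_iff)
  moreover have "(norm (hat a b \<xi>))\<^sup>2 = 2 * ((1 - cos ((b - a) * \<xi>)) / \<xi>\<^sup>2)" for \<xi>
  proof -
    have "complex_of_real ((norm (hat a b \<xi>))\<^sup>2) = cnj (hat a b \<xi>) * hat a b \<xi>"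
      by (simp only: complex_norm_square mult.commute)
    from arg_cong[OF this, of Re] have "(norm (hat a b \<xi>))\<^sup>2 = Re (cnj (hat a b \<xi>) * hat a b \<xi>)"
      by (simp only: Re_complex_of_real)
    also have "\<dots> = 2 * ((1 - cos ((b - a) * \<xi>)) / \<xi>\<^sup>2)"
      using cos_minus[of "(b - a) * \<xi>"] by (simp only: Re_hat_product[OF True True]) (simp add: algebra_simps)
    finally show ?thesis .
  qed
  ultimately show ?thesis
    by (intro L2I) auto
next
  case False
  then have "hat a b = (\<lambda>\<xi>. 0)" by (auto simp: hat_def)
  then show ?thesis by (simp add: L2_zero)
qed

lemma integral_hat_product:
  assumes "a \<le> b" "c \<le> d"
  shows "(LINT \<xi>|lborel. cnj (hat a b \<xi>) * hat c d \<xi>)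
    = of_real (pi * (\<bar>a - d\<bar> + \<bar>b - c\<bar> - \<bar>a - c\<bar> - \<bar>b - d\<bar>))"
proof -
  let ?h = "\<lambda>\<xi>. cnj (hat a b \<xi>) * hat c d \<xi>"
  have int: "integrable lborel ?h"
    by (intro L2_mult_integrable L2_cnj hat_L2)
  have "has_bochner_integral lborel (\<lambda>\<xi>. (1 - cos ((a - d) * \<xi>)) / \<xi>\<^sup>2 + (1 - cos ((b - c) * \<xi>)) / \<xi>\<^sup>2
    - (1 - cos ((a - c) * \<xi>)) / \<xi>\<^sup>2 - (1 - cos ((b - d) * \<xi>)) / \<xi>\<^sup>2)
    (pi * \<bar>a - d\<bar> + pi * \<bar>b - c\<bar> - pi * \<bar>a - c\<bar> - pi * \<bar>b - d\<bar>)"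
    by (intro has_bochner_integral_add has_bochner_integral_diff has_bochner_integral_one_minus_cos)
  then have "(LINT \<xi>|lborel. Re (?h \<xi>)) = pi * (\<bar>a - d\<bar> + \<bar>b - c\<bar> - \<bar>a - c\<bar> - \<bar>b - d\<bar>)"
    unfolding Re_hat_product[OF assms] by (simp add: has_bochner_integral_iff algebra_simps)
  moreover have "(LINT \<xi>|lborel. Im (?h \<xi>)) = 0"
  proof (rule integral_odd)
    fix \<xi>
    let ?N = "\<lambda>\<xi>. Im (cnj (cis (- (a * \<xi>)) - cis (- (b * \<xi>))) * (cis (- (c * \<xi>)) - cis (- (d * \<xi>))))"
    have "?N (- \<xi>) = - ?N \<xi>"
      by (simp add: algebra_simps)
    then show "Im (?h (- \<xi>)) = - Im (?h \<xi>)"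
      unfolding hat_product[OF assms] Im_divide_of_real by (simp only: power2_minus minus_divide_left)
  qed
  ultimately show ?thesis
    unfolding complex_eq_iff integral_Re[OF int, symmetric] integral_Im[OF int, symmetric]
    by (simp only: Re_complex_of_real Im_complex_of_real)
qed

text \<open>The length of the overlap is written in this form to match
  \<open>integral_hat_product\<close>; comparing the two gives Plancherel for intervals, with the
  factor \<open>2 * pi\<close>.\<close>

lemma integral_indicator_product:
  assumes "a \<le> b" "c \<le> d"
  shows "(LINT t|lborel. cnj (indicator {a<..b} t) * indicator {c<..d} t :: complex)
    = of_real ((\<bar>a - d\<bar> + \<bar>b - c\<bar> - \<bar>a - c\<bar> - \<bar>b - d\<bar>) / 2)"
proof -
  have "(LINT t|lborel. cnj (indicator {a<..b} t) * indicator {c<..d} t :: complex)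
      = (LINT t|lborel. of_real (indicator {max a c<..min b d} t))"
    by (intro Bochner_Integration.integral_cong) (auto simp: indicator_def)
  also have "\<dots> = of_real (measure lborel {max a c<..min b d})"
    by simp
  also have "measure lborel {max a c<..min b d} = (if max a c \<le> min b d then min b d - max a c else 0)"
  proof (cases "max a c \<le> min b d")
    case False
    then have "{max a c<..min b d} = {}" by auto
    then show ?thesis using False by (simp only: measure_empty if_False)
  qed (simp only: measure_lborel_Ioc if_True)
  also have "\<dots> = (\<bar>a - d\<bar> + \<bar>b - c\<bar> - \<bar>a - c\<bar> - \<bar>b - d\<bar>) / 2"
    using assms unfolding max_def min_def abs_if by (auto split: if_split)
  finally show ?thesis .
qed

lemma cint_hat: "cint (abs_l2 (hat a b)) (abs_l2 (hat c d)) = 2 * of_real pi * cint (ivl a b) (ivl c d)"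
proof (cases "a \<le> b \<and> c \<le> d")
  case True
  then show ?thesis
    unfolding ivl_def cint_abs[OF hat_L2 hat_L2] cint_abs[OF L2_Ioc L2_Ioc]
    by (simp add: integral_hat_product integral_indicator_product)
next
  case False
  then have "cnj (hat a b t) * hat c d t = 0" "cnj (indicator {a<..b} t) * indicator {c<..d} t = (0::complex)" for t
    by (auto simp: hat_def)
  then show ?thesis
    unfolding ivl_def cint_abs[OF hat_L2 hat_L2] cint_abs[OF L2_Ioc L2_Ioc] by (simp only:) simp
qed

section \<open>The Fourier integral of an interval and its inversion\<close>

lemma integral_cis_interval:
  assumes "\<xi> \<noteq> 0"
  shows "(LINT t|lborel. indicator {a<..b} t * cis (- (t * \<xi>))) = hat a b \<xi>"
proof (cases "a \<le> b")
  case True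
  have "(LINT t|lborel. indicator {a<..b} t * cis (- (t * \<xi>))) = (LINT t|lborel. indicator {a..b} t *\<^sub>R cis (- (t * \<xi>)))"
  proof (rule integral_cong_AE)
    show "AE t in lborel. indicator {a<..b} t * cis (- (t * \<xi>)) = indicator {a..b} t *\<^sub>R cis (- (t * \<xi>))"
      using AE_lborel_singleton[of a] by eventually_elim (auto simp: indicator_def)
  qed measurable
  also have "\<dots> = - cis (- (b * \<xi>)) / (\<i> * of_real \<xi>) - (- cis (- (a * \<xi>)) / (\<i> * of_real \<xi>))"
  proof (rule integral_FTC_Icc[OF True])
    fix t assume "a \<le> t" "t \<le> b"
    show "((\<lambda>t. - cis (- (t * \<xi>)) / (\<i> * of_real \<xi>)) has_vector_derivative cis (- (t * \<xi>))) (at t within {a..b})"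
      unfolding has_vector_derivative_complex_iff using assms
      by (auto simp: Re_divide Im_divide power2_eq_square intro!: derivative_eq_intros)
  qed (intro continuous_intros)
  also have "\<dots> = hat a b \<xi>"
    using True assms by (simp add: hat_def field_simps)
  finally show ?thesis .
qed (auto simp: hat_def)

text \<open>Over the symmetric range the imaginary part of the integrand is odd and drops out; the
  real part is a difference of two \<open>sinc\<close> terms with antiderivatives in
  \<open>Si\<close>.\<close>

lemma hat_inversion:
  assumes "0 \<le> R" "a \<le> b"
  shows "(LINT \<xi>|lborel. indicator {-R..R} \<xi> * cis (x * \<xi>) * hat a b \<xi>)
    = of_real (2 * (Si ((x - a) * R) - Si ((x - b) * R)))"
proof -
  let ?h = "\<lambda>\<xi>. indicator {-R..R} \<xi> * cis (x * \<xi>) * hat a b \<xi>"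
  have "(indicator {-R..R} :: real \<Rightarrow> complex) \<in> L2"
    by (rule L2_indicator_subset[of _ "-R" R]) auto
  from L2_bmul[OF bmeasI[of "\<lambda>\<xi>. cis (x * \<xi>)" 1] this]
  have "(\<lambda>\<xi>. indicator {-R..R} \<xi> * cis (x * \<xi>)) \<in> L2"
    by (simp add: mult.commute)
  then have int: "integrable lborel ?h"
    by (intro L2_mult_integrable hat_L2)
  have c: "cis (x * \<xi>) * cis (- (a * \<xi>)) = cis ((x - a) * \<xi>)" for a \<xi>
    by (simp add: cis_mult left_diff_distrib)
  have h: "?h \<xi> = indicator {-R..R} \<xi> * (cis ((x - a) * \<xi>) - cis ((x - b) * \<xi>)) / (\<i> * of_real \<xi>)" for \<xi>
    using assms by (simp only: hat_def if_True times_divide_eq_right right_diff_distrib mult.assoc c)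
  have Si: "has_bochner_integral lborel (\<lambda>\<xi>. \<alpha> * sinc (\<alpha> * \<xi>) * indicator {-R..R} \<xi>) (Si (\<alpha> * R) - Si (\<alpha> * (- R)))" for \<alpha>
  proof (rule has_bochner_integral_FTC_Icc_real)
    fix \<xi>
    show "DERIV (\<lambda>\<xi>. Si (\<alpha> * \<xi>)) \<xi> :> \<alpha> * sinc (\<alpha> * \<xi>)"
      unfolding mult.commute[of \<alpha> "sinc (\<alpha> * \<xi>)"]
      by (rule DERIV_chain2[OF DERIV_Si DERIV_cmult_Id])
    show "isCont (\<lambda>\<xi>. \<alpha> * sinc (\<alpha> * \<xi>)) \<xi>"
      by (intro isCont_mult continuous_const continuous_within_compose3[OF isCont_sinc] continuous_ident)
  qed (use assms in auto)
  have Si_minus: "Si (- T) = - Si T" for T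
    using Si_neg[of T] Si_neg[of "-T"] by (cases "T \<ge> 0") auto
  have "(LINT \<xi>|lborel. Re (?h \<xi>)) = (LINT \<xi>|lborel. (x - a) * sinc ((x - a) * \<xi>) * indicator {-R..R} \<xi>
      - (x - b) * sinc ((x - b) * \<xi>) * indicator {-R..R} \<xi>)"
  proof (rule integral_cong_AE)
    show "AE \<xi> in lborel. Re (?h \<xi>) = (x - a) * sinc ((x - a) * \<xi>) * indicator {-R..R} \<xi>
      - (x - b) * sinc ((x - b) * \<xi>) * indicator {-R..R} \<xi>"
      using AE_lborel_singleton[of 0]
    proof eventually_elim
      case (elim \<xi>)
      have "\<alpha> * sinc (\<alpha> * \<xi>) = sin (\<alpha> * \<xi>) / \<xi>" for \<alpha>
        using elim by simp
      then show ?case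
        unfolding h using elim
        by (simp only:) (auto simp: indicator_def Re_divide power2_eq_square diff_divide_distrib)
    qed
  qed measurable
  also have "\<dots> = 2 * (Si ((x - a) * R) - Si ((x - b) * R))"
    using Si[of "x - a"] Si[of "x - b"] by (simp add: has_bochner_integral_iff Si_minus)
  finally have "(LINT \<xi>|lborel. Re (?h \<xi>)) = 2 * (Si ((x - a) * R) - Si ((x - b) * R))" .
  moreover have "(LINT \<xi>|lborel. Im (?h \<xi>)) = 0"
    unfolding h by (rule integral_odd) (auto simp: indicator_def Im_divide power2_eq_square)
  ultimately show ?thesis
    unfolding complex_eq_iff integral_Re[OF int, symmetric] integral_Im[OF int, symmetric]
    by (simp only: Re_complex_of_real Im_complex_of_real)
qed

text \<open>The limit of \<open>Si\<close> turns the difference into a difference of signs. For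
  \<open>a < b\<close> the value at an endpoint would be half the jump, hence the exclusion of two
  points.\<close>

lemma hat_inversion_limit:
  assumes "a \<le> b" "x \<noteq> a" "x \<noteq> b"
  shows "((\<lambda>R. LINT \<xi>|lborel. indicator {-R..R} \<xi> * cis (x * \<xi>) * hat a b \<xi>)
    \<longlongrightarrow> 2 * of_real pi * indicator {a<..b} x) at_top"
proof -
  have Si_minus: "Si (- T) = - Si T" for T
    using Si_neg[of T] Si_neg[of "-T"] by (cases "T \<ge> 0") auto
  have pos: "((\<lambda>R. Si (\<alpha> * R)) \<longlongrightarrow> pi / 2) at_top" if "\<alpha> > 0" for \<alpha>
  proof -
    have "filterlim (\<lambda>x. \<alpha> * x) at_top at_top" using that by real_asymp
    then show ?thesis by (rule filterlim_compose[OF Si_at_top])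
  qed
  have lim: "((\<lambda>R. Si (\<alpha> * R)) \<longlongrightarrow> sgn \<alpha> * (pi / 2)) at_top" if "\<alpha> \<noteq> 0" for \<alpha>
  proof (cases "\<alpha> > 0")
    case False
    then have "((\<lambda>R. - Si ((- \<alpha>) * R)) \<longlongrightarrow> - (pi / 2)) at_top"
      using that by (intro tendsto_minus pos) auto
    moreover have "- Si ((- \<alpha>) * R) = Si (\<alpha> * R)" for R
      using Si_minus[of "\<alpha> * R"] by simp
    ultimately show ?thesis using False that by simp
  qed (use pos in simp)
  have "((\<lambda>R. 2 * (Si ((x - a) * R) - Si ((x - b) * R)))
      \<longlongrightarrow> 2 * (sgn (x - a) * (pi / 2) - sgn (x - b) * (pi / 2))) at_top"
    using assms by (intro tendsto_mult tendsto_diff tendsto_const lim) auto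
  also have "2 * (sgn (x - a) * (pi / 2) - sgn (x - b) * (pi / 2)) = 2 * pi * indicator {a<..b} x"
    using assms by (auto simp: indicator_def sgn_if)
  finally have "((\<lambda>R. complex_of_real (2 * (Si ((x - a) * R) - Si ((x - b) * R))))
      \<longlongrightarrow> of_real (2 * pi * indicator {a<..b} x)) at_top"
    by (rule tendsto_of_real)
  also have "complex_of_real (2 * pi * indicator {a<..b} x) = 2 * of_real pi * indicator {a<..b} x"
    by (simp add: indicator_def)
  finally show ?thesis
  proof (rule Lim_transform_eventually)
    show "\<forall>\<^sub>F R in at_top. complex_of_real (2 * (Si ((x - a) * R) - Si ((x - b) * R)))
      = (LINT \<xi>|lborel. indicator {-R..R} \<xi> * cis (x * \<xi>) * hat a b \<xi>)"
      using eventually_ge_at_top[of 0] by eventually_elim (simp only: hat_inversion[OF _ assms(1)])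
  qed
qed


section \<open>The Fourier transform on L2\<close>

lemma cnj_indicator [simp]: "cnj (indicator A t) = indicator A t"
  by (simp add: indicator_def)

lemma bmeas_Icc [simp]: "bmeas (indicator {a..b})"
  by simp

text \<open>\<open>span\<close> is taken over the reals; the multiples by \<open>\<i>\<close> make
  it the space of complex step functions.\<close>

definition step_gens :: "l2 set" where
  "step_gens = {ivl a b | a b. True} \<union> {bmul (\<lambda>t. \<i>) (ivl a b) | a b. True}"

definition ft1 :: "l2 \<Rightarrow> real \<Rightarrow> complex" where
  "ft1 x \<xi> = (LINT t|lborel. rep_l2 x t * cis (- (t * \<xi>)))"

text \<open>The domain on which the Fourier integral converges absolutely and stays in
  \<open>L2\<close>. Defining the transform there by its integral makes it well defined without
  choosing an expansion of a step function into intervals.\<close>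

definition ft_good :: "l2 set" where
  "ft_good = {x. integrable lborel (rep_l2 x) \<and> ft1 x \<in> L2}"

lemma integrable_mult_cis:
  fixes f :: "real \<Rightarrow> complex"
  assumes "integrable lborel f" "g \<in> borel_measurable borel"
  shows "integrable lborel (\<lambda>t. f t * cis (g t))"
  by (rule Bochner_Integration.integrable_bound[OF assms(1)]) (use assms in \<open>auto simp: norm_mult\<close>)

lemma ft1_measurable [measurable]: "ft1 x \<in> borel_measurable borel"
  unfolding ft1_def[abs_def] by measurable

lemma ft1_add:
  assumes "integrable lborel (rep_l2 x)" "integrable lborel (rep_l2 y)"
  shows "ft1 (x + y) \<xi> = ft1 x \<xi> + ft1 y \<xi>"
proof -
  have "ft1 (x + y) \<xi> = (LINT t|lborel. rep_l2 x t * cis (- (t * \<xi>)) + rep_l2 y t * cis (- (t * \<xi>)))"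
    unfolding ft1_def
  proof (rule integral_cong_AE)
    show "AE t in lborel. rep_l2 (x + y) t * cis (- (t * \<xi>)) = rep_l2 x t * cis (- (t * \<xi>)) + rep_l2 y t * cis (- (t * \<xi>))"
      using rep_plus[of x y] by eventually_elim (simp add: distrib_right)
  qed measurable
  also have "\<dots> = ft1 x \<xi> + ft1 y \<xi>"
    unfolding ft1_def by (intro Bochner_Integration.integral_add integrable_mult_cis assms) measurable
  finally show ?thesis .
qed

lemma ft1_bmul_const: "ft1 (bmul (\<lambda>t. c) x) \<xi> = c * ft1 x \<xi>"
proof -
  have "ft1 (bmul (\<lambda>t. c) x) \<xi> = (LINT t|lborel. c * (rep_l2 x t * cis (- (t * \<xi>))))"
    unfolding ft1_def
  proof (rule integral_cong_AE)
    show "AE t in lborel. rep_l2 (bmul (\<lambda>t. c) x) t * cis (- (t * \<xi>)) = c * (rep_l2 x t * cis (- (t * \<xi>)))"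
      using rep_bmul[OF bmeas_const, of c x] by eventually_elim simp
  qed measurable
  then show ?thesis by (simp add: ft1_def)
qed

lemma ft1_scaleR: "ft1 (r *\<^sub>R x) \<xi> = r *\<^sub>R ft1 x \<xi>"
  using ft1_bmul_const[of "of_real r" x \<xi>] by (simp add: bmul_of_real scaleR_conv_of_real)

lemma integrable_rep_add:
  "integrable lborel (rep_l2 x) \<Longrightarrow> integrable lborel (rep_l2 y) \<Longrightarrow> integrable lborel (rep_l2 (x + y))"
  by (subst integrable_cong_AE[where g = "\<lambda>t. rep_l2 x t + rep_l2 y t"]) (use rep_plus[of x y] in auto)

lemma integrable_rep_bmul_const:
  "integrable lborel (rep_l2 x) \<Longrightarrow> integrable lborel (rep_l2 (bmul (\<lambda>t. c) x))"
  by (subst integrable_cong_AE[where g = "\<lambda>t. c * rep_l2 x t"]) (use rep_bmul[OF bmeas_const, of c x] in auto)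

lemma subspace_ft_good: "subspace ft_good"
proof (rule subspaceI)
  have "integrable lborel (rep_l2 0)"
    by (subst integrable_cong_AE[where g = "\<lambda>t. 0"]) (use rep_zero in auto)
  moreover have "ft1 0 \<xi> = 0" for \<xi>
    using ft1_scaleR[of 0 0 \<xi>] by simp
  then have "ft1 0 = (\<lambda>\<xi>. 0)" by (rule ext)
  ultimately show "0 \<in> ft_good"
    by (simp add: ft_good_def L2_zero)
  fix x y c
  assume x: "x \<in> ft_good"
  have "ft1 (c *\<^sub>R x) = (\<lambda>\<xi>. c *\<^sub>R ft1 x \<xi>)"
    by (rule ext) (rule ft1_scaleR)
  then show "c *\<^sub>R x \<in> ft_good"
    using x integrable_rep_bmul_const[of x "of_real c"] by (simp add: ft_good_def L2_scaleR bmul_of_real)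
  assume y: "y \<in> ft_good"
  have "ft1 (x + y) = (\<lambda>\<xi>. ft1 x \<xi> + ft1 y \<xi>)"
    using x y by (intro ext ft1_add) (auto simp: ft_good_def)
  then show "x + y \<in> ft_good"
    using x y by (simp add: ft_good_def L2_add integrable_rep_add)
qed

lemma integrable_ivl: "integrable lborel (rep_l2 (ivl a b))"
proof (subst integrable_cong_AE[where g = "\<lambda>t. of_real (indicator {a<..b} t)"])
  show "AE t in lborel. rep_l2 (ivl a b) t = of_real (indicator {a<..b} t)"
    using rep_abs[OF L2_Ioc, of a b] unfolding ivl_def by eventually_elim (simp add: indicator_def)
  have "integrable lborel (indicat_real {a<..b})"
    by (intro integrable_real_indicator)
      (auto intro: le_less_trans[OF emeasure_mono[of _ "{a..b}"]] simp: emeasure_lborel_Icc_eq)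
  then show "integrable lborel (\<lambda>t. complex_of_real (indicator {a<..b} t))"
    by (rule integrable_of_real)
qed auto

lemma ft1_ivl: "\<xi> \<noteq> 0 \<Longrightarrow> ft1 (ivl a b) \<xi> = hat a b \<xi>"
proof -
  assume "\<xi> \<noteq> 0"
  have "ft1 (ivl a b) \<xi> = (LINT t|lborel. indicator {a<..b} t * cis (- (t * \<xi>)))"
    unfolding ft1_def ivl_def
    by (rule integral_cong_AE) (use rep_abs[OF L2_Ioc, of a b] in auto)
  then show ?thesis using integral_cis_interval[OF \<open>\<xi> \<noteq> 0\<close>] by simp
qed

lemma AE_ft1_ivl: "AE \<xi> in lborel. ft1 (ivl a b) \<xi> = hat a b \<xi>"
  using AE_lborel_singleton[of 0] by eventually_elim (rule ft1_ivl)

lemma ivl_ft_good: "ivl a b \<in> ft_good"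
  unfolding ft_good_def
  using integrable_ivl L2_AE_cong[OF hat_L2, of "ft1 (ivl a b)"] AE_ft1_ivl[of a b] by (auto simp: eq_commute)

lemma bmul_ft_good: "x \<in> ft_good \<Longrightarrow> bmul (\<lambda>t. c) x \<in> ft_good"
proof -
  assume "x \<in> ft_good"
  moreover have "ft1 (bmul (\<lambda>t. c) x) = (\<lambda>\<xi>. c * ft1 x \<xi>)"
    by (rule ext) (rule ft1_bmul_const)
  ultimately show ?thesis
    by (simp add: ft_good_def L2_cmult integrable_rep_bmul_const)
qed

lemma span_ft_good: "span step_gens \<subseteq> ft_good"
  by (rule span_minimal[OF _ subspace_ft_good]) (auto simp: step_gens_def ivl_ft_good bmul_ft_good)

abbreviation ft0 :: "l2 \<Rightarrow> l2" where "ft0 x \<equiv> abs_l2 (ft1 x)"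

lemma ft0_add: "x \<in> ft_good \<Longrightarrow> y \<in> ft_good \<Longrightarrow> ft0 (x + y) = ft0 x + ft0 y"
proof -
  assume x: "x \<in> ft_good" "y \<in> ft_good"
  then have "ft1 (x + y) = (\<lambda>\<xi>. ft1 x \<xi> + ft1 y \<xi>)"
    by (intro ext ft1_add) (auto simp: ft_good_def)
  then show ?thesis using x by (simp add: ft_good_def abs_add)
qed

lemma ft0_bmul: "x \<in> ft_good \<Longrightarrow> ft0 (bmul (\<lambda>t. c) x) = bmul (\<lambda>t. c) (ft0 x)"
proof -
  assume x: "x \<in> ft_good"
  have "ft1 (bmul (\<lambda>t. c) x) = (\<lambda>\<xi>. c * ft1 x \<xi>)"
    by (rule ext) (rule ft1_bmul_const)
  then show ?thesis using x by (simp add: ft_good_def bmul_abs)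
qed

lemma ft0_scaleR: "x \<in> ft_good \<Longrightarrow> ft0 (r *\<^sub>R x) = r *\<^sub>R ft0 x"
  using ft0_bmul[of x "of_real r"] by (simp add: bmul_of_real)

lemma ft0_ivl: "ft0 (ivl a b) = abs_l2 (hat a b)"
  using ivl_ft_good[of a b] AE_ft1_ivl[of a b] by (intro abs_l2_cong hat_L2) (auto simp: ft_good_def)

lemma cint_bmul_const_left: "cint (bmul (\<lambda>t. c) x) y = cnj c * cint x y"
  by (simp add: cint_bmul_left cint_bmul_const_right)

lemma cint_scaleR_right: "cint z (r *\<^sub>R x) = of_real r * cint z x"
  using cint_bmul_const_right[of z "of_real r" x] by (simp add: bmul_of_real)

lemma cint_zero_left [simp]: "cint 0 x = 0"
  using cint_scaleR_left[of 0 0 x] by simp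

lemma cint_zero_right [simp]: "cint x 0 = 0"
  using cint_scaleR_right[of x 0 0] by simp

text \<open>Both sides are additive and real homogeneous in each argument. The identity spreads from
  the generators first over \<open>x\<close>, for a generator \<open>y\<close>, and then over
  \<open>y\<close>.\<close>

lemma cint_ft0:
  assumes "x \<in> span step_gens" "y \<in> span step_gens"
  shows "cint (ft0 x) (ft0 y) = 2 * of_real pi * cint x y"
proof -
  have zero: "ft0 0 = 0"
    using ft0_scaleR[of "0" 0] subspace_0[OF subspace_ft_good] by simp
  let ?P = "\<lambda>x y. cint (ft0 x) (ft0 y) = 2 * of_real pi * cint x y"
  have gen: "?P x y" if "x \<in> step_gens" "y \<in> step_gens" for x y
    using that unfolding step_gens_def
    by (auto simp: ft0_bmul ivl_ft_good ft0_ivl cint_bmul_const_left cint_bmul_const_right cint_hat)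
  have sub1: "subspace {x \<in> ft_good. ?P x y}" if "y \<in> ft_good" for y
    using subspace_ft_good
    by (auto simp: subspace_def ft0_add ft0_scaleR cint_add_left cint_scaleR_left zero algebra_simps)
  have sub2: "subspace {y \<in> ft_good. ?P x y}" if "x \<in> ft_good" for x
    using subspace_ft_good
    by (auto simp: subspace_def ft0_add ft0_scaleR cint_add_right cint_scaleR_right zero algebra_simps)
  have sg: "step_gens \<subseteq> ft_good"
    using span_ft_good span_superset by blast
  have "?P x y" if "y \<in> step_gens" for y
  proof -
    have "span step_gens \<subseteq> {x \<in> ft_good. ?P x y}"
      by (rule span_minimal[OF _ sub1]) (use gen that sg in auto)
    then show ?thesis using assms(1) by blast
  qed
  then have "span step_gens \<subseteq> {y \<in> ft_good. ?P x y}"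
    by (intro span_minimal[OF _ sub2]) (use sg assms(1) span_ft_good in auto)
  then show ?thesis using assms(2) by blast
qed

lemma tendsto_cint:
  assumes "f \<longlonglongrightarrow> x" "g \<longlonglongrightarrow> y"
  shows "(\<lambda>n. cint (f n) (g n)) \<longlonglongrightarrow> cint x y"
proof -
  have "(\<lambda>n. Complex (inner (f n) (g n)) (inner (bmul (\<lambda>t. \<i>) (f n)) (g n)))
      \<longlonglongrightarrow> Complex (inner x y) (inner (bmul (\<lambda>t. \<i>) x) y)"
    by (intro tendsto_Complex tendsto_inner assms bounded_linear.tendsto[OF bounded_linear_bmul[OF bmeas_const]])
  then show ?thesis by (simp only: cint_eq_inner)
qed

lemma norm_eq_of_cint:
  assumes "cint y y = 2 * of_real pi * cint x x"
  shows "norm y = sqrt (2 * pi) * norm x"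
proof -
  have "complex_of_real ((norm y)\<^sup>2) = of_real (2 * pi * (norm x)\<^sup>2)"
    using assms by (simp add: cint_self')
  then have "(norm y)\<^sup>2 = (sqrt (2 * pi) * norm x)\<^sup>2"
    unfolding of_real_eq_iff by (simp add: power_mult_distrib)
  then show ?thesis
    by (rule power2_eq_imp_eq) auto
qed

lemma norm_ft0: "x \<in> span step_gens \<Longrightarrow> norm (ft0 x) = sqrt (2 * pi) * norm x"
  by (intro norm_eq_of_cint cint_ft0)

lemma bmul_i_span:
  assumes "x \<in> span step_gens"
  shows "bmul (\<lambda>t. \<i>) x \<in> span step_gens"
proof -
  interpret bounded_linear "bmul (\<lambda>t. \<i>)" by (simp add: bounded_linear_bmul)
  have "span step_gens \<subseteq> {x. bmul (\<lambda>t. \<i>) x \<in> span step_gens}"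
  proof (rule span_minimal)
    show "subspace {x. bmul (\<lambda>t. \<i>) x \<in> span step_gens}"
      by (auto simp: subspace_def add scaleR zero span_0 span_add span_scale)
    have ii: "bmul (\<lambda>t. \<i>) (bmul (\<lambda>t. \<i>) x) = - x" for x
      using bmul_of_real[of "-1" x] by (simp add: bmul_bmul)
    show "step_gens \<subseteq> {x. bmul (\<lambda>t. \<i>) x \<in> span step_gens}"
    proof
      fix x assume "x \<in> step_gens"
      then obtain a b where "x = ivl a b \<or> x = bmul (\<lambda>t. \<i>) (ivl a b)"
        by (auto simp: step_gens_def)
      moreover have "ivl a b \<in> span step_gens" "bmul (\<lambda>t. \<i>) (ivl a b) \<in> span step_gens"
        by (rule span_base, auto simp: step_gens_def)+
      ultimately show "x \<in> {x. bmul (\<lambda>t. \<i>) x \<in> span step_gens}"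
        by (auto simp: ii span_neg)
    qed
  qed
  then show ?thesis using assms by blast
qed

lemma closure_span_step_gens: "closure (span step_gens) = UNIV"
proof -
  have "x \<in> closure (span step_gens)" for x
  proof (rule l2_induct)
    show "subspace (closure (span step_gens))"
    proof (rule subspaceI)
      show "0 \<in> closure (span step_gens)"
        by (rule subsetD[OF closure_subset span_0])
      fix x y c
      assume "x \<in> closure (span step_gens)"
      then obtain f where f: "\<And>n. f n \<in> span step_gens" "f \<longlonglongrightarrow> x"
        unfolding closure_sequential by blast
      show "c *\<^sub>R x \<in> closure (span step_gens)"
        unfolding closure_sequential
        by (intro exI[of _ "\<lambda>n. c *\<^sub>R f n"] conjI allI span_scale f tendsto_scaleR tendsto_const)
      assume "y \<in> closure (span step_gens)"
      then obtain g where g: "\<And>n. g n \<in> span step_gens" "g \<longlonglongrightarrow> y"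
        unfolding closure_sequential by blast
      show "x + y \<in> closure (span step_gens)"
        unfolding closure_sequential
        by (intro exI[of _ "\<lambda>n. f n + g n"] conjI allI span_add f g tendsto_add)
    qed
    show "ivl a b \<in> closure (span step_gens)" for a b
      by (rule subsetD[OF closure_subset], rule span_base) (auto simp: step_gens_def)
    fix x assume "x \<in> closure (span step_gens)"
    then obtain f where f: "\<And>n. f n \<in> span step_gens" "f \<longlonglongrightarrow> x"
      unfolding closure_sequential by blast
    have "(\<lambda>n. bmul (\<lambda>t. \<i>) (f n)) \<longlonglongrightarrow> bmul (\<lambda>t. \<i>) x"
      by (rule bounded_linear.tendsto[OF bounded_linear_bmul f(2)]) simp
    then show "bmul (\<lambda>t. \<i>) x \<in> closure (span step_gens)"
      unfolding closure_sequential
      by (intro exI[of _ "\<lambda>n. bmul (\<lambda>t. \<i>) (f n)"] conjI allI bmul_i_span f(1))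
  qed simp
  then show ?thesis by blast
qed

text \<open>On the dense space of step functions \<open>ft0\<close> multiplies norms by
  \<open>sqrt (2 * pi)\<close>. It is thus uniformly continuous and extends to all of
  \<open>l2\<close>, and every identity passes to the limit.\<close>

lemma ft_exists:
  "\<exists>F. bounded_linear F \<and> (\<forall>x. F (bmul (\<lambda>t. \<i>) x) = bmul (\<lambda>t. \<i>) (F x)) \<and>
    (\<forall>x y. cint (F x) (F y) = 2 * of_real pi * cint x y) \<and> (\<forall>a b. F (ivl a b) = abs_l2 (hat a b))"
proof -
  let ?V = "span step_gens"
  have "uniformly_continuous_on ?V ft0"
    unfolding uniformly_continuous_on_def
  proof (intro allI impI)
    fix e :: real assume "e > 0"
    show "\<exists>d>0. \<forall>x\<in>?V. \<forall>x'\<in>?V. dist x' x < d \<longrightarrow> dist (ft0 x') (ft0 x) < e"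
    proof (intro exI conjI ballI impI)
      show "0 < e / sqrt (2 * pi)" using \<open>e > 0\<close> by simp
      fix x x' assume x: "x \<in> ?V" "x' \<in> ?V" and d: "dist x' x < e / sqrt (2 * pi)"
      have good: "x' \<in> ft_good" "x \<in> ft_good"
        using x span_ft_good by auto
      have "ft0 (x' + (-1) *\<^sub>R x) = ft0 x' + (-1) *\<^sub>R ft0 x"
        by (simp only: ft0_add[OF good(1) subspace_scale[OF subspace_ft_good good(2)]] ft0_scaleR[OF good(2)])
      then have "dist (ft0 x') (ft0 x) = norm (ft0 (x' - x))"
        by (simp add: dist_norm)
      also have "\<dots> = sqrt (2 * pi) * norm (x' - x)"
        by (rule norm_ft0) (use x span_diff in blast)
      also have "\<dots> < e"
        using d by (simp add: dist_norm field_simps)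
      finally show "dist (ft0 x') (ft0 x) < e" .
    qed
  qed
  then obtain F where F: "uniformly_continuous_on (closure ?V) F" "\<And>x. x \<in> ?V \<Longrightarrow> ft0 x = F x"
    by (rule uniformly_continuous_on_extension_on_closure) blast
  have cont: "continuous_on UNIV F"
    using uniformly_continuous_imp_continuous[OF F(1)] by (simp add: closure_span_step_gens)
  have approx: "\<exists>f. (\<forall>n. f n \<in> ?V) \<and> f \<longlonglongrightarrow> x \<and> (\<lambda>n. ft0 (f n)) \<longlonglongrightarrow> F x" for x
  proof -
    have "x \<in> closure ?V" by (simp add: closure_span_step_gens)
    then obtain f where f: "\<And>n. f n \<in> ?V" "f \<longlonglongrightarrow> x"
      unfolding closure_sequential by blast
    have "(\<lambda>n. F (f n)) \<longlonglongrightarrow> F x"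
      using continuous_on_tendsto_compose[OF cont f(2)] by simp
    then show ?thesis using f F(2) by (intro exI[of _ f]) simp
  qed
  have add: "F (x + y) = F x + F y" for x y
  proof -
    obtain f where f: "\<And>n. f n \<in> ?V" "f \<longlonglongrightarrow> x" "(\<lambda>n. ft0 (f n)) \<longlonglongrightarrow> F x" using approx by metis
    obtain g where g: "\<And>n. g n \<in> ?V" "g \<longlonglongrightarrow> y" "(\<lambda>n. ft0 (g n)) \<longlonglongrightarrow> F y" using approx by metis
    have "(\<lambda>n. F (f n + g n)) \<longlonglongrightarrow> F (x + y)"
      by (rule continuous_on_tendsto_compose[OF cont tendsto_add[OF f(2) g(2)]]) auto
    moreover have "F (f n + g n) = ft0 (f n) + ft0 (g n)" for n
    proof -
      have "f n \<in> ft_good" "g n \<in> ft_good"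
        using f(1) g(1) span_ft_good by auto
      then show ?thesis
        unfolding F(2)[OF span_add[OF f(1) g(1)], symmetric] by (rule ft0_add)
    qed
    ultimately show ?thesis
      using tendsto_add[OF f(3) g(3)] by (auto intro: LIMSEQ_unique)
  qed
  \<comment> \<open>Stated for any constant that preserves the step functions, since it is used both
    for real scalars and for \<open>\<i>\<close>.\<close>
  have scale: "F (bmul (\<lambda>t. c) x) = bmul (\<lambda>t. c) (F x)" if V: "\<And>x. x \<in> ?V \<Longrightarrow> bmul (\<lambda>t. c) x \<in> ?V" for c x
  proof -
    obtain f where f: "\<And>n. f n \<in> ?V" "f \<longlonglongrightarrow> x" "(\<lambda>n. ft0 (f n)) \<longlonglongrightarrow> F x" using approx by metis
    have "(\<lambda>n. F (bmul (\<lambda>t. c) (f n))) \<longlonglongrightarrow> F (bmul (\<lambda>t. c) x)"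
      by (rule continuous_on_tendsto_compose[OF cont bounded_linear.tendsto[OF bounded_linear_bmul f(2)]]) auto
    moreover have "F (bmul (\<lambda>t. c) (f n)) = bmul (\<lambda>t. c) (ft0 (f n))" for n
    proof -
      have "f n \<in> ft_good"
        using f(1) span_ft_good by auto
      then show ?thesis
        unfolding F(2)[OF V[OF f(1)], symmetric] by (rule ft0_bmul)
    qed
    moreover have "(\<lambda>n. bmul (\<lambda>t. c) (ft0 (f n))) \<longlonglongrightarrow> bmul (\<lambda>t. c) (F x)"
      by (rule bounded_linear.tendsto[OF bounded_linear_bmul f(3)]) simp
    ultimately show ?thesis by (auto intro: LIMSEQ_unique)
  qed
  have scaleR: "F (r *\<^sub>R x) = r *\<^sub>R F x" for r x
    using scale[of "of_real r" x] by (simp add: bmul_of_real span_scale)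
  have inner: "cint (F x) (F y) = 2 * of_real pi * cint x y" for x y
  proof -
    obtain f where f: "\<And>n. f n \<in> ?V" "f \<longlonglongrightarrow> x" "(\<lambda>n. ft0 (f n)) \<longlonglongrightarrow> F x" using approx by metis
    obtain g where g: "\<And>n. g n \<in> ?V" "g \<longlonglongrightarrow> y" "(\<lambda>n. ft0 (g n)) \<longlonglongrightarrow> F y" using approx by metis
    have "(\<lambda>n. cint (ft0 (f n)) (ft0 (g n))) \<longlonglongrightarrow> cint (F x) (F y)"
      by (rule tendsto_cint[OF f(3) g(3)])
    moreover have "(\<lambda>n. 2 * of_real pi * cint (f n) (g n)) \<longlonglongrightarrow> 2 * of_real pi * cint x y"
      by (rule tendsto_mult[OF tendsto_const tendsto_cint[OF f(2) g(2)]])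
    ultimately show ?thesis
      using f(1) g(1) by (simp add: cint_ft0 LIMSEQ_unique)
  qed
  have nF: "norm (F x) = sqrt (2 * pi) * norm x" for x
    by (rule norm_eq_of_cint[OF inner])
  have "bounded_linear F"
    by (rule bounded_linear_intro[of _ "sqrt (2 * pi)"]) (simp_all add: add scaleR nF)
  moreover have "F (ivl a b) = abs_l2 (hat a b)" for a b
  proof -
    have "ivl a b \<in> span step_gens"
      by (rule span_base) (auto simp: step_gens_def)
    then show ?thesis
      by (simp only: F(2)[symmetric] ft0_ivl)
  qed
  ultimately show ?thesis
    using inner scale[OF bmul_i_span] by (intro exI[of _ F]) simp
qed

text \<open>The properties determine the operator: it is real linear, continuous and commutes with
  \<open>\<i>\<close>, and complex step functions are dense.\<close>

definition FT :: "l2 \<Rightarrow> l2" where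
  "FT = (SOME F. bounded_linear F \<and> (\<forall>x. F (bmul (\<lambda>t. \<i>) x) = bmul (\<lambda>t. \<i>) (F x)) \<and>
    (\<forall>x y. cint (F x) (F y) = 2 * of_real pi * cint x y) \<and> (\<forall>a b. F (ivl a b) = abs_l2 (hat a b)))"

lemma bounded_linear_FT: "bounded_linear FT"
  and FT_i: "FT (bmul (\<lambda>t. \<i>) x) = bmul (\<lambda>t. \<i>) (FT x)"
  and Plancherel: "cint (FT x) (FT y) = 2 * of_real pi * cint x y"
  and FT_ivl: "FT (ivl a b) = abs_l2 (hat a b)"
  using someI_ex[OF ft_exists] unfolding FT_def[symmetric] by blast+

lemma norm_FT: "norm (FT x) = sqrt (2 * pi) * norm x"
  by (rule norm_eq_of_cint[OF Plancherel])

subsection \<open>Truncated integrals\<close>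

definition tch :: "real \<Rightarrow> real \<Rightarrow> l2" where
  "tch R \<xi> = abs_l2 (\<lambda>t. indicator {-R..R} t * cis (t * \<xi>))"

definition tft :: "real \<Rightarrow> l2 \<Rightarrow> real \<Rightarrow> complex" where
  "tft R x \<xi> = cint (tch R \<xi>) x"

abbreviation cut :: "real \<Rightarrow> l2 \<Rightarrow> l2" where
  "cut R \<equiv> bmul (indicator {-R..R})"

text \<open>As an inner product, the truncated transform \<open>tft R x \<xi>\<close> is continuous in \<open>x\<close> for each \<open>\<xi>\<close>.\<close>

lemma tch_L2: "(\<lambda>t. indicator {-R..R} t * cis (t * \<xi>)) \<in> L2"
proof -
  have "(indicator {-R..R} :: real \<Rightarrow> complex) \<in> L2"
    by (rule L2_indicator_subset[of _ "-R" R]) auto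
  from L2_bmul[OF bmeasI[of "\<lambda>t. cis (t * \<xi>)" 1] this] show ?thesis
    by (simp add: mult.commute)
qed

lemma tft_AE:
  assumes "AE t in lborel. rep_l2 x t = f t" "f \<in> borel_measurable borel"
  shows "tft R x \<xi> = (LINT t|lborel. indicator {-R..R} t * f t * cis (- (t * \<xi>)))"
proof -
  have "tft R x \<xi> = (LINT t|lborel. cnj (indicator {-R..R} t * cis (t * \<xi>)) * f t)"
    unfolding tft_def tch_def
    by (rule cint_AE_cong[OF rep_abs[OF tch_L2] assms(1)]) (use assms(2) in measurable)
  then show ?thesis
    by (simp add: cis_cnj mult_ac)
qed

lemma tft_ivl: "\<xi> \<noteq> 0 \<Longrightarrow> tft R (ivl a b) \<xi> = hat (max a (-R)) (min b R) \<xi>"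
proof -
  assume "\<xi> \<noteq> 0"
  have "tft R (ivl a b) \<xi> = (LINT t|lborel. indicator {-R..R} t * indicator {a<..b} t * cis (- (t * \<xi>)))"
    unfolding ivl_def by (rule tft_AE[OF rep_abs[OF L2_Ioc]]) measurable
  also have "\<dots> = (LINT t|lborel. indicator {max a (-R)<..min b R} t * cis (- (t * \<xi>)))"
  proof (rule integral_cong_AE)
    show "AE t in lborel. indicator {-R..R} t * indicator {a<..b} t * cis (- (t * \<xi>))
        = indicator {max a (-R)<..min b R} t * cis (- (t * \<xi>))"
      using AE_lborel_singleton[of "-R"] by eventually_elim (auto simp: indicator_def)
  qed measurable
  finally show ?thesis
    using integral_cis_interval[OF \<open>\<xi> \<noteq> 0\<close>] by simp
qed

lemma cut_ivl: "cut R (ivl a b) = ivl (max a (-R)) (min b R)"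
  unfolding ivl_def
proof (rule l2_eq_absI[OF L2_Ioc])
  show "AE t in lborel. rep_l2 (cut R (abs_l2 (indicator {a<..b}))) t = indicator {max a (-R)<..min b R} t"
    using rep_bmul[OF bmeas_Icc, of "-R" R "abs_l2 (indicator {a<..b})"] rep_abs[OF L2_Ioc, of a b]
      AE_lborel_singleton[of "-R"]
    by eventually_elim (auto simp: indicator_def)
qed

text \<open>Connects the abstract extension with honest integrals. The classes satisfying the
  identity form a closed set because the left sides converge in \<open>l2\<close> and the right
  sides at every \<open>\<xi>\<close>, so that \<open>l2_limit_AE\<close> identifies the limits; on
  intervals both sides are explicit.\<close>

lemma FT_cut: "AE \<xi> in lborel. rep_l2 (FT (cut R x)) \<xi> = tft R x \<xi>"
proof -
  interpret F: bounded_linear FT by (rule bounded_linear_FT)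
  interpret C: bounded_linear "cut R" by (rule bounded_linear_bmul) simp
  let ?S = "{x. AE \<xi> in lborel. rep_l2 (FT (cut R x)) \<xi> = tft R x \<xi>}"
  have "x \<in> ?S"
  proof (rule l2_induct)
    show "closed ?S"
      unfolding closed_sequential_limits
    proof (intro allI impI, elim conjE)
      fix f l assume f: "\<forall>n. f n \<in> ?S" "f \<longlonglongrightarrow> l"
      have lim: "(\<lambda>n. FT (cut R (f n))) \<longlonglongrightarrow> FT (cut R l)"
        by (intro F.tendsto C.tendsto f(2))
      have "AE \<xi> in lborel. \<forall>n. rep_l2 (FT (cut R (f n))) \<xi> = tft R (f n) \<xi>"
        using f(1) by (simp add: AE_all_countable)
      then have "AE \<xi> in lborel. (\<lambda>n. rep_l2 (FT (cut R (f n))) \<xi>) \<longlonglongrightarrow> tft R l \<xi>"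
        by eventually_elim (simp add: tft_def tendsto_cint[OF tendsto_const f(2)])
      from l2_limit_AE[OF lim this] show "l \<in> ?S" by simp
    qed
    show "subspace ?S"
    proof (rule subspaceI)
      show "0 \<in> ?S"
        using rep_zero by (auto simp: F.zero C.zero tft_def)
      fix x y c
      assume x: "x \<in> ?S"
      then have "AE \<xi> in lborel. rep_l2 (FT (cut R x)) \<xi> = tft R x \<xi>" by simp
      with rep_scaleR[of c "FT (cut R x)"]
      have "AE \<xi> in lborel. rep_l2 (FT (cut R (c *\<^sub>R x))) \<xi> = tft R (c *\<^sub>R x) \<xi>"
        by eventually_elim (simp add: F.scaleR C.scaleR tft_def cint_scaleR_right scaleR_conv_of_real)
      then show "c *\<^sub>R x \<in> ?S" by simp
      assume "y \<in> ?S"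
      then have "AE \<xi> in lborel. rep_l2 (FT (cut R y)) \<xi> = tft R y \<xi>" by simp
      with x rep_plus[of "FT (cut R x)" "FT (cut R y)"]
      have "AE \<xi> in lborel. rep_l2 (FT (cut R (x + y))) \<xi> = tft R (x + y) \<xi>"
        unfolding mem_Collect_eq by eventually_elim (simp add: F.add C.add tft_def cint_add_right)
      then show "x + y \<in> ?S" by simp
    qed
    fix a b
    have "AE \<xi> in lborel. rep_l2 (FT (cut R (ivl a b))) \<xi> = hat (max a (-R)) (min b R) \<xi>"
      unfolding cut_ivl FT_ivl by (rule rep_abs[OF hat_L2])
    with AE_lborel_singleton[of 0]
    have "AE \<xi> in lborel. rep_l2 (FT (cut R (ivl a b))) \<xi> = tft R (ivl a b) \<xi>"
      by eventually_elim (simp add: tft_ivl)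
    then show "ivl a b \<in> ?S" by simp
  next
    fix x assume "x \<in> ?S"
    then have "AE \<xi> in lborel. rep_l2 (FT (cut R x)) \<xi> = tft R x \<xi>" by simp
    then have "AE \<xi> in lborel. rep_l2 (bmul (\<lambda>t. \<i>) (FT (cut R x))) \<xi> = tft R (bmul (\<lambda>t. \<i>) x) \<xi>"
      using rep_bmul[OF bmeas_const, of \<i> "FT (cut R x)"]
      by eventually_elim (simp add: tft_def cint_bmul_const_right)
    moreover have "FT (cut R (bmul (\<lambda>t. \<i>) x)) = bmul (\<lambda>t. \<i>) (FT (cut R x))"
      by (simp add: bmul_bmul FT_i[symmetric] mult.commute)
    ultimately show "bmul (\<lambda>t. \<i>) x \<in> ?S" by simp
  qed
  then show ?thesis by simp
qed

lemma tendsto_cut: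
  assumes "filterlim R at_top sequentially"
  shows "(\<lambda>n. cut (R n) x) \<longlonglongrightarrow> x"
proof -
  have "(\<lambda>n. abs_l2 (\<lambda>t. indicator {-R n..R n} t * rep_l2 x t)) \<longlonglongrightarrow> abs_l2 (rep_l2 x)"
  proof (rule l2_dominated_convergence(3)[where g = "rep_l2 x"])
    show "AE t in lborel. (\<lambda>n. indicator {-R n..R n} t * rep_l2 x t) \<longlonglongrightarrow> rep_l2 x t"
    proof (rule AE_I2)
      fix t
      have "\<forall>\<^sub>F n in sequentially. \<bar>t\<bar> \<le> R n"
        using assms by (simp add: filterlim_at_top)
      then have "\<forall>\<^sub>F n in sequentially. rep_l2 x t = indicator {-R n..R n} t * rep_l2 x t"
        by eventually_elim (auto simp: indicator_def)
      then show "(\<lambda>n. indicator {-R n..R n} t * rep_l2 x t) \<longlonglongrightarrow> rep_l2 x t"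
        by (rule Lim_transform_eventually[OF tendsto_const])
    qed
    show "AE t in lborel. norm (indicator {-R n..R n} t * rep_l2 x t) \<le> norm (rep_l2 x t)" for n
      by (auto simp: indicator_def)
  qed auto
  then show ?thesis by (simp add: bmul_def)
qed

lemma set_integral_eq_tft:
  assumes "f \<in> L2"
  shows "(LINT x:{-R..R}|lborel. f x * exp (- \<i> * of_real x * of_real \<xi>)) = tft R (abs_l2 f) \<xi>"
  unfolding tft_AE[OF rep_abs[OF assms] L2_measurable[OF assms]] set_lebesgue_integral_def exp_eq_cis
  by (intro Bochner_Integration.integral_cong) (auto simp: indicator_def)

lemma nn_integral_tft:
  assumes "g \<in> L2"
  shows "(\<integral>\<^sup>+ \<xi>. ennreal ((norm (g \<xi> - tft R x \<xi>))\<^sup>2) \<partial>lborel) = ennreal ((norm (abs_l2 g - FT (cut R x)))\<^sup>2)"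
proof -
  have "(\<integral>\<^sup>+ \<xi>. ennreal ((norm (g \<xi> - tft R x \<xi>))\<^sup>2) \<partial>lborel)
      = (\<integral>\<^sup>+ \<xi>. ennreal ((norm (rep_l2 (abs_l2 g - FT (cut R x)) \<xi>))\<^sup>2) \<partial>lborel)"
  proof (rule nn_integral_cong_AE)
    show "AE \<xi> in lborel. ennreal ((norm (g \<xi> - tft R x \<xi>))\<^sup>2)
        = ennreal ((norm (rep_l2 (abs_l2 g - FT (cut R x)) \<xi>))\<^sup>2)"
      using FT_cut[of R x] rep_abs[OF assms] rep_minus[of "abs_l2 g" "FT (cut R x)"]
      by eventually_elim simp
  qed
  also have "\<dots> = ennreal ((norm (abs_l2 g - FT (cut R x)))\<^sup>2)"
    unfolding norm_l2_sq by (rule nn_integral_eq_integral) (auto intro: L2_integrable)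
  finally show ?thesis .
qed

text \<open>By \<open>FT_cut\<close> the integral in the definition is the squared norm of
  \<open>abs_l2 g - FT (cut R ?x)\<close>. As the cut-off is removed it tends to the squared norm of
  \<open>abs_l2 g - FT ?x\<close>, which is 0 exactly in the case of equality.\<close>

lemma is_fourier_iff: "is_fourier f g \<longleftrightarrow> f \<in> L2 \<and> g \<in> L2 \<and> FT (abs_l2 f) = abs_l2 g"
proof -
  interpret F: bounded_linear FT by (rule bounded_linear_FT)
  let ?x = "abs_l2 f"
  have iff: "((\<lambda>R. \<integral>\<^sup>+ \<xi>. ennreal ((norm (g \<xi> -
          (LINT x:{-R..R}|lborel. f x * exp (- \<i> * of_real x * of_real \<xi>))))\<^sup>2) \<partial>lborel)
        \<longlongrightarrow> 0) at_top \<longleftrightarrow> FT ?x = abs_l2 g" if fg: "f \<in> L2" "g \<in> L2"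
  proof -
    have eq: "(\<integral>\<^sup>+ \<xi>. ennreal ((norm (g \<xi> -
          (LINT x:{-R..R}|lborel. f x * exp (- \<i> * of_real x * of_real \<xi>))))\<^sup>2) \<partial>lborel)
        = ennreal ((norm (abs_l2 g - FT (cut R ?x)))\<^sup>2)" for R
      unfolding set_integral_eq_tft[OF fg(1)] by (rule nn_integral_tft[OF fg(2)])
    have lim: "((\<lambda>R. ennreal ((norm (abs_l2 g - FT (cut R ?x)))\<^sup>2))
        \<longlongrightarrow> ennreal ((norm (abs_l2 g - FT ?x))\<^sup>2)) at_top"
    proof (rule tendsto_at_topI_sequentially)
      fix X :: "nat \<Rightarrow> real" assume "filterlim X at_top sequentially"
      from tendsto_cut[OF this, of ?x]
      show "(\<lambda>n. ennreal ((norm (abs_l2 g - FT (cut (X n) ?x)))\<^sup>2)) \<longlonglongrightarrow> ennreal ((norm (abs_l2 g - FT ?x))\<^sup>2)"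
        by (intro tendsto_ennrealI tendsto_power tendsto_norm tendsto_diff tendsto_const F.tendsto)
    qed
    show ?thesis
      unfolding eq
    proof
      assume "((\<lambda>R. ennreal ((norm (abs_l2 g - FT (cut R ?x)))\<^sup>2)) \<longlongrightarrow> 0) at_top"
      from tendsto_unique[OF _ lim this] show "FT ?x = abs_l2 g"
        by simp
    next
      assume "FT ?x = abs_l2 g"
      then show "((\<lambda>R. ennreal ((norm (abs_l2 g - FT (cut R ?x)))\<^sup>2)) \<longlongrightarrow> 0) at_top"
        using lim by simp
    qed
  qed
  then show ?thesis
    unfolding is_fourier_def by blast
qed

lemma is_fourier_fourier: "f \<in> L2 \<Longrightarrow> is_fourier f (fourier f)"
  unfolding fourier_def
  by (rule someI[of _ "rep_l2 (FT (abs_l2 f))"]) (simp add: is_fourier_iff)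

lemma fourier_L2: "f \<in> L2 \<Longrightarrow> fourier f \<in> L2"
  using is_fourier_fourier[of f] by (simp add: is_fourier_iff)

lemma abs_fourier: "f \<in> L2 \<Longrightarrow> abs_l2 (fourier f) = FT (abs_l2 f)"
  using is_fourier_fourier[of f] by (simp add: is_fourier_iff)

lemma AE_fourier: "f \<in> L2 \<Longrightarrow> AE \<xi> in lborel. fourier f \<xi> = rep_l2 (FT (abs_l2 f)) \<xi>"
  using rep_abs[OF fourier_L2, of f] by (simp add: abs_fourier eq_commute)

subsection \<open>Inversion\<close>

lemma FT_bmul_const: "FT (bmul (\<lambda>t. c) x) = bmul (\<lambda>t. c) (FT x)"
proof -
  interpret F: bounded_linear FT by (rule bounded_linear_FT)
  show ?thesis
    by (simp only: bmul_const_eq[of c] F.add F.scaleR FT_i)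
qed

text \<open>The inversion integral has the opposite sign in the exponent. Conjugating before and
  after \<open>FT\<close> produces that sign, so one construction serves both directions.\<close>

definition IFT :: "l2 \<Rightarrow> l2" where
  "IFT x = (1 / (2 * pi)) *\<^sub>R cj (FT (cj x))"

lemma bounded_linear_IFT: "bounded_linear IFT"
  unfolding IFT_def[abs_def]
  by (intro bounded_linear_scaleR_right[THEN bounded_linear_compose] bounded_linear_compose[OF bounded_linear_cj]
      bounded_linear_compose[OF bounded_linear_FT] bounded_linear_cj)

lemma IFT_cut: "AE t in lborel. rep_l2 (IFT (cut R x)) t
    = (LINT \<xi>|lborel. indicator {-R..R} \<xi> * rep_l2 x \<xi> * cis (t * \<xi>)) / (2 * of_real pi)"
proof -
  have T: "tft R (cj x) t = cnj (LINT \<xi>|lborel. indicator {-R..R} \<xi> * rep_l2 x \<xi> * cis (t * \<xi>))" for t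
  proof -
    have "tft R (cj x) t = (LINT \<xi>|lborel. cnj (indicator {-R..R} \<xi> * rep_l2 x \<xi> * cis (t * \<xi>)))"
      unfolding tft_AE[OF rep_cj borel_measurable_cnj[THEN measurable_compose_rev, OF rep_measurable]]
      by (intro Bochner_Integration.integral_cong) (auto simp: cis_cnj mult.commute)
    then show ?thesis by (simp only: Bochner_Integration.integral_cnj)
  qed
  have C: "cj (cut R x) = cut R (cj x)"
    by (simp add: cj_bmul)
  show ?thesis
    unfolding IFT_def C
    using FT_cut[of R "cj x"] rep_cj[of "FT (cut R (cj x))"] rep_scaleR[of "1 / (2 * pi)" "cj (FT (cut R (cj x)))"]
    by eventually_elim (simp add: T scaleR_conv_of_real)
qed

text \<open>For an interval, the cut-off inversion integrals converge in \<open>l2\<close> by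
  continuity of \<open>IFT\<close> and pointwise off the endpoints by
  \<open>hat_inversion_limit\<close>; the limits agree. Density gives the rest.\<close>

lemma IFT_FT: "IFT (FT x) = x"
proof -
  interpret F: bounded_linear FT by (rule bounded_linear_FT)
  interpret I: bounded_linear IFT by (rule bounded_linear_IFT)
  let ?S = "{x. IFT (FT x) = x}"
  have "x \<in> ?S"
  proof (rule l2_induct)
    show "closed ?S"
      by (intro closed_Collect_eq continuous_on_id I.continuous_on F.continuous_on)
    show "subspace ?S"
      by (auto simp: subspace_def F.zero I.zero F.add I.add F.scaleR I.scaleR)
    fix a b
    show "ivl a b \<in> ?S"
    proof (cases "a \<le> b")
      case True
      have "(\<lambda>n. IFT (cut (real n) (FT (ivl a b)))) \<longlonglongrightarrow> IFT (FT (ivl a b))"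
        by (intro I.tendsto tendsto_cut filterlim_real_sequentially)
      moreover have "AE t in lborel. (\<lambda>n. rep_l2 (IFT (cut (real n) (FT (ivl a b)))) t) \<longlonglongrightarrow> indicator {a<..b} t"
      proof -
        have "AE t in lborel. \<forall>n. rep_l2 (IFT (cut (real n) (FT (ivl a b)))) t
          = (LINT \<xi>|lborel. indicator {-real n..real n} \<xi> * rep_l2 (FT (ivl a b)) \<xi> * cis (t * \<xi>)) / (2 * of_real pi)"
          unfolding AE_all_countable by (intro allI IFT_cut)
        then show ?thesis
          using AE_lborel_singleton[of a] AE_lborel_singleton[of b]
        proof eventually_elim
          case (elim t)
          have eq: "(LINT \<xi>|lborel. indicator {-real n..real n} \<xi> * rep_l2 (FT (ivl a b)) \<xi> * cis (t * \<xi>))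
            = (LINT \<xi>|lborel. indicator {-real n..real n} \<xi> * cis (t * \<xi>) * hat a b \<xi>)" for n
          proof (rule integral_cong_AE)
            show "AE \<xi> in lborel. indicator {-real n..real n} \<xi> * rep_l2 (FT (ivl a b)) \<xi> * cis (t * \<xi>)
              = indicator {-real n..real n} \<xi> * cis (t * \<xi>) * hat a b \<xi>"
              unfolding FT_ivl using rep_abs[OF hat_L2, of a b] by eventually_elim simp
          qed measurable
          have "(\<lambda>n. (LINT \<xi>|lborel. indicator {-real n..real n} \<xi> * cis (t * \<xi>) * hat a b \<xi>) / (2 * of_real pi))
              \<longlonglongrightarrow> (2 * of_real pi * indicator {a<..b} t) / (2 * of_real pi)"
            by (intro tendsto_divide tendsto_const
                filterlim_compose[OF hat_inversion_limit[OF True elim(2,3)] filterlim_real_sequentially]) simp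
          with elim(1) show ?case
            by (simp add: eq)
        qed
      qed
      ultimately have "AE t in lborel. rep_l2 (IFT (FT (ivl a b))) t = indicator {a<..b} t"
        by (rule l2_limit_AE)
      then have "IFT (FT (ivl a b)) = ivl a b"
        unfolding ivl_def by (rule l2_eq_absI[OF L2_Ioc])
      then show ?thesis by simp
    next
      case False
      then have "(indicator {a<..b} :: real \<Rightarrow> complex) = (\<lambda>t. 0)" by auto
      then have "ivl a b = 0" by (simp add: ivl_def zero_l2_def)
      then show ?thesis by (simp add: F.zero I.zero)
    qed
  next
    fix x assume x: "x \<in> ?S"
    have "cj (FT (cj (bmul (\<lambda>t. \<i>) y))) = bmul (\<lambda>t. \<i>) (cj (FT (cj y)))" for y
      by (simp add: cj_bmul FT_bmul_const)
    with x show "bmul (\<lambda>t. \<i>) x \<in> ?S"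
      by (simp add: FT_i IFT_def bmul_scaleR[symmetric])
  qed
  then show ?thesis by simp
qed

text \<open>\<open>IFT\<close> differs from \<open>FT\<close> only by conjugations and a real
  factor, so conjugating the left inverse property turns it into surjectivity of
  \<open>FT\<close>.\<close>

lemma FT_IFT: "FT (IFT x) = x"
proof -
  interpret F: bounded_linear FT by (rule bounded_linear_FT)
  interpret C: bounded_linear cj by (rule bounded_linear_cj)
  have "cj (IFT (FT (cj x))) = cj (cj x)"
    by (simp only: IFT_FT)
  then show ?thesis
    by (simp add: IFT_def F.scaleR C.scaleR)
qed


section \<open>The Szego projector and Hardy spaces\<close>

definition proj :: "l2 \<Rightarrow> l2" where
  "proj x = IFT (bmul (indicator {0..}) (FT x))"

lemma bmeas_atLeast [simp]: "bmeas (indicator {a..})"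
  by simp

lemma bounded_linear_proj: "bounded_linear proj"
  unfolding proj_def[abs_def]
  by (intro bounded_linear_compose[OF bounded_linear_IFT] bounded_linear_compose[OF bounded_linear_bmul]
      bounded_linear_FT bmeas_atLeast)

lemma FT_proj: "FT (proj x) = bmul (indicator {0..}) (FT x)"
  by (simp add: proj_def FT_IFT)

lemma FT_inj: "FT x = FT y \<Longrightarrow> x = y"
  by (metis IFT_FT)

text \<open>On the Fourier side the projector is multiplication by a real idempotent function. That
  the value is real is what conserves the flux.\<close>

lemma cint_proj: "cint x (proj x) = of_real ((norm (proj x))\<^sup>2)"
proof -
  let ?m = "indicator {0..} :: real \<Rightarrow> complex"
  have m: "(\<lambda>t. cnj (?m t)) = ?m" "(\<lambda>t. ?m t * ?m t) = ?m"
    by (auto simp: indicator_def)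
  have "2 * of_real pi * cint x (proj x) = cint (FT x) (bmul ?m (FT x))"
    by (simp only: Plancherel[symmetric] FT_proj)
  also have "bmul ?m (FT x) = bmul ?m (bmul ?m (FT x))"
    by (simp only: bmul_bmul bmeas_atLeast m)
  also have "cint (FT x) (bmul ?m (bmul ?m (FT x))) = cint (bmul ?m (FT x)) (bmul ?m (FT x))"
    by (simp only: cint_bmul_left bmeas_atLeast m)
  also have "\<dots> = 2 * of_real pi * cint (proj x) (proj x)"
    by (simp only: Plancherel[symmetric] FT_proj)
  finally show ?thesis
    by (simp add: cint_self')
qed

lemma norm_proj_le: "norm (proj x) \<le> norm x"
proof -
  have "sqrt (2 * pi) * norm (proj x) = norm (bmul (indicator {0..}) (FT x))"
    by (simp only: norm_FT[symmetric] FT_proj)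
  also have "\<dots> \<le> 1 * norm (FT x)"
    by (rule norm_bmul_le) (auto simp: indicator_def)
  finally show ?thesis
    by (simp add: norm_FT)
qed

lemma proj_bmul_const: "proj (bmul (\<lambda>t. c) x) = bmul (\<lambda>t. c) (proj x)"
  by (rule FT_inj) (simp add: FT_proj FT_bmul_const bmul_bmul mult.commute)

text \<open>Any function admissible in the choice defining \<open>szego f\<close> has the class
  \<open>proj (abs_l2 f)\<close>, because \<open>FT\<close> is injective, and a representative of
  that class is admissible.\<close>

lemma szego:
  assumes f: "f \<in> L2"
  shows szego_L2: "szego f \<in> L2" and abs_szego: "abs_l2 (szego f) = proj (abs_l2 f)"
proof -
  have L: "(\<lambda>\<xi>. indicator {0..} \<xi> * fourier f \<xi>) \<in> L2"
    by (rule L2_bmul[OF bmeas_atLeast fourier_L2[OF f]])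
  have eq: "abs_l2 (\<lambda>\<xi>. indicator {0..} \<xi> * fourier f \<xi>) = FT (proj (abs_l2 f))"
    by (simp only: FT_proj abs_fourier[OF f, symmetric] bmul_abs[OF bmeas_atLeast fourier_L2[OF f]])
  have to: "abs_l2 g = proj (abs_l2 f)"
    if g: "g \<in> L2" and h: "AE \<xi> in lborel. fourier g \<xi> = indicator {0..} \<xi> * fourier f \<xi>" for g
  proof (rule FT_inj)
    have "abs_l2 (fourier g) = FT (proj (abs_l2 f))"
      unfolding eq[symmetric] by (rule abs_l2_cong[OF fourier_L2[OF g] L h])
    then show "FT (abs_l2 g) = FT (proj (abs_l2 f))"
      by (simp only: abs_fourier[OF g])
  qed
  let ?g = "rep_l2 (proj (abs_l2 f))"
  have e: "abs_l2 (fourier ?g) = abs_l2 (\<lambda>\<xi>. indicator {0..} \<xi> * fourier f \<xi>)"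
    by (simp only: eq abs_fourier[OF rep_L2] abs_rep)
  have "AE \<xi> in lborel. fourier ?g \<xi> = indicator {0..} \<xi> * fourier f \<xi>"
    using rep_abs[OF L] rep_abs[OF fourier_L2[OF rep_L2], of "proj (abs_l2 f)", unfolded e]
    by eventually_elim simp
  then have "?g \<in> L2 \<and> (AE \<xi> in lborel. fourier ?g \<xi> = indicator {0..} \<xi> * fourier f \<xi>)"
    by (rule conjI[OF rep_L2])
  then have sz: "szego f \<in> L2 \<and> (AE \<xi> in lborel. fourier (szego f) \<xi> = indicator {0..} \<xi> * fourier f \<xi>)"
    unfolding szego_def
    by (rule someI[where P = "\<lambda>g. g \<in> L2 \<and> (AE \<xi> in lborel. fourier g \<xi> = indicator {0..} \<xi> * fourier f \<xi>)"])
  show "szego f \<in> L2" by (rule conjunct1[OF sz])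
  then show "abs_l2 (szego f) = proj (abs_l2 f)"
    by (rule to[OF _ conjunct2[OF sz]])
qed

definition hardy :: "l2 set" where
  "hardy = {x. AE \<xi> in lborel. \<xi> < 0 \<longrightarrow> rep_l2 (FT x) \<xi> = 0}"

lemma proj_hardy: "proj x \<in> hardy"
  unfolding hardy_def mem_Collect_eq FT_proj
  using rep_bmul[OF bmeas_atLeast, of 0 "FT x"] by eventually_elim (auto simp: indicator_def)

text \<open>The complement of the support is a possibly uncountable union of open sets on which
  \<open>f\<close> vanishes almost everywhere. By Lindelof countably many suffice, so the
  exceptional sets still add up to a null set.\<close>

lemma ess_support_nonneg:
  "ess_support f \<subseteq> {0..} \<longleftrightarrow> (AE \<xi> in lborel. \<xi> < 0 \<longrightarrow> f \<xi> = 0)"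
proof
  assume sub: "ess_support f \<subseteq> {0..}"
  let ?F = "{U. open U \<and> (AE x in lborel. x \<in> U \<longrightarrow> f x = 0)}"
  obtain F where F: "F \<subseteq> ?F" "countable F" "\<Union>F = \<Union>?F"
    by (rule Lindelof[of ?F]) auto
  have "AE x in lborel. \<forall>U\<in>F. x \<in> U \<longrightarrow> f x = 0"
    using F by (simp only: AE_ball_countable, blast)
  then show "AE \<xi> in lborel. \<xi> < 0 \<longrightarrow> f \<xi> = 0"
  proof eventually_elim
    case (elim x)
    show ?case
    proof
      assume "x < 0"
      then have "x \<notin> ess_support f" using subsetD[OF sub, of x] by auto
      then have "x \<in> \<Union>?F" unfolding ess_support_def by (simp only: Compl_iff not_not)
      then obtain U where "U \<in> F" "x \<in> U" unfolding F(3)[symmetric] by blast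
      then show "f x = 0" using elim by blast
    qed
  qed
next
  assume "AE \<xi> in lborel. \<xi> < 0 \<longrightarrow> f \<xi> = 0"
  then have "{..<0} \<in> {U. open U \<and> (AE x in lborel. x \<in> U \<longrightarrow> f x = 0)}" by simp
  then have "{..<0} \<subseteq> \<Union>{U. open U \<and> (AE x in lborel. x \<in> U \<longrightarrow> f x = 0)}" by (rule Union_upper)
  then have "- \<Union>{U. open U \<and> (AE x in lborel. x \<in> U \<longrightarrow> f x = 0)} \<subseteq> - {..<0}"
    by (rule Compl_anti_mono)
  also have "- {..<0} = {0::real..}" by auto
  finally show "ess_support f \<subseteq> {0..}"
    unfolding ess_support_def .
qed

lemma Sobolev_plus_iff:
  "u \<in> Sobolev_plus 1 \<longleftrightarrow> u \<in> L2 \<and> abs_l2 u \<in> hardy \<and>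
    integrable lborel (\<lambda>\<xi>. (1 + \<xi>\<^sup>2) * (norm (rep_l2 (FT (abs_l2 u)) \<xi>))\<^sup>2)"
proof -
  have A: "ess_support (fourier u) \<subseteq> {0..} \<longleftrightarrow> abs_l2 u \<in> hardy" if u: "u \<in> L2"
    unfolding ess_support_nonneg hardy_def mem_Collect_eq
    by (rule eventually_cong[OF AE_fourier[OF u]]) simp
  have B: "integrable lborel (\<lambda>\<xi>. (1 + \<xi>\<^sup>2) powr 1 * (norm (fourier u \<xi>))\<^sup>2)
     \<longleftrightarrow> integrable lborel (\<lambda>\<xi>. (1 + \<xi>\<^sup>2) * (norm (rep_l2 (FT (abs_l2 u)) \<xi>))\<^sup>2)" if u: "u \<in> L2"
  proof (rule integrable_cong_AE)
    show "AE \<xi> in lborel. (1 + \<xi>\<^sup>2) powr 1 * (norm (fourier u \<xi>))\<^sup>2 = (1 + \<xi>\<^sup>2) * (norm (rep_l2 (FT (abs_l2 u)) \<xi>))\<^sup>2"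
      using AE_fourier[OF u] by eventually_elim (simp add: add_nonneg_nonneg)
  qed (use fourier_L2[OF u] in measurable)
  show ?thesis
  proof (cases "u \<in> L2")
    case True
    show ?thesis
      unfolding Sobolev_plus_def Sobolev_def mem_Collect_eq A[OF True] B[OF True] by (simp add: conj_ac)
  next
    case False
    then show ?thesis
      unfolding Sobolev_plus_def Sobolev_def by simp
  qed
qed

text \<open>The Sobolev embedding on the line. Writing the transform as its product with
  \<open>?s = sqrt (1 + \<xi>\<^sup>2)\<close> times \<open>inverse ?s\<close> shows that it is
  integrable; the cut-off inversion integrals are then bounded uniformly, and so is their limit
  almost everywhere.\<close>

lemma Sobolev_bounded:
  assumes u: "u \<in> L2" and int: "integrable lborel (\<lambda>\<xi>. (1 + \<xi>\<^sup>2) * (norm (rep_l2 (FT (abs_l2 u)) \<xi>))\<^sup>2)"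
  shows "\<exists>C. AE x in lborel. norm (u x) \<le> C"
proof -
  let ?g = "rep_l2 (FT (abs_l2 u))"
  have L1: "integrable lborel ?g"
  proof (rule Bochner_Integration.integrable_bound)
    have "set_integrable lborel (einterval (-\<infinity>) \<infinity>) (\<lambda>x. inverse (1 + x\<^sup>2))"
      by (rule integrable_inverse_1_plus_square)
    moreover have "einterval (-\<infinity>) \<infinity> = UNIV"
      by (auto simp: einterval_def)
    ultimately have "integrable lborel (\<lambda>x::real. inverse (1 + x\<^sup>2))"
      by (simp add: set_integrable_def)
    with int show "integrable lborel (\<lambda>\<xi>. (1 + \<xi>\<^sup>2) * (norm (?g \<xi>))\<^sup>2 + inverse (1 + \<xi>\<^sup>2))"
      by (rule Bochner_Integration.integrable_add)
    have bound: "norm (?g \<xi>) \<le> (1 + \<xi>\<^sup>2) * (norm (?g \<xi>))\<^sup>2 + inverse (1 + \<xi>\<^sup>2)" for \<xi>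
    proof -
      let ?s = "sqrt (1 + \<xi>\<^sup>2)"
      have s: "?s > 0" "?s\<^sup>2 = 1 + \<xi>\<^sup>2" by (simp_all add: add_pos_nonneg)
      have "norm (?g \<xi>) = (?s * norm (?g \<xi>)) * inverse ?s"
        using s(1) by simp
      also have "\<dots> \<le> (?s * norm (?g \<xi>))\<^sup>2 + (inverse ?s)\<^sup>2"
      proof -
        have "0 \<le> (?s * norm (?g \<xi>)) * inverse ?s"
          using s(1) by (intro mult_nonneg_nonneg) auto
        then show ?thesis
          using sum_squares_bound[of "?s * norm (?g \<xi>)" "inverse ?s"] by linarith
      qed
      also have "\<dots> = (1 + \<xi>\<^sup>2) * (norm (?g \<xi>))\<^sup>2 + inverse (1 + \<xi>\<^sup>2)"
        by (simp only: power_mult_distrib s(2) power_inverse)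
      finally show ?thesis .
    qed
    show "AE \<xi> in lborel. norm (?g \<xi>) \<le> norm ((1 + \<xi>\<^sup>2) * (norm (?g \<xi>))\<^sup>2 + inverse (1 + \<xi>\<^sup>2))"
      unfolding real_norm_def by (intro AE_I2 order_trans[OF bound abs_ge_self])
  qed measurable
  interpret I: bounded_linear IFT by (rule bounded_linear_IFT)
  have "(\<lambda>n. IFT (cut (real n) (FT (abs_l2 u)))) \<longlonglongrightarrow> IFT (FT (abs_l2 u))"
    by (intro I.tendsto tendsto_cut filterlim_real_sequentially)
  from l2_subseq_AE[OF this, unfolded IFT_FT]
  obtain r where r: "AE t in lborel. (\<lambda>n. rep_l2 (IFT (cut (real (r n)) (FT (abs_l2 u)))) t) \<longlonglongrightarrow> rep_l2 (abs_l2 u) t"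
    by blast
  have "AE t in lborel. \<forall>n. rep_l2 (IFT (cut (real n) (FT (abs_l2 u)))) t
    = (LINT \<xi>|lborel. indicator {-real n..real n} \<xi> * ?g \<xi> * cis (t * \<xi>)) / (2 * of_real pi)"
    unfolding AE_all_countable by (intro allI IFT_cut)
  with r rep_abs[OF u] have "AE x in lborel. norm (u x) \<le> (LINT \<xi>|lborel. norm (?g \<xi>)) / (2 * pi)"
  proof eventually_elim
    case (elim x)
    have "norm (LINT \<xi>|lborel. indicator {-real n..real n} \<xi> * ?g \<xi> * cis (x * \<xi>)) \<le> (LINT \<xi>|lborel. norm (?g \<xi>))" for n
    proof (rule order_trans[OF integral_norm_bound integral_mono])
      show "integrable lborel (\<lambda>\<xi>. norm (indicator {-real n..real n} \<xi> * ?g \<xi> * cis (x * \<xi>)))"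
        by (rule Bochner_Integration.integrable_bound[OF L1]) (auto simp: norm_mult indicator_def)
    qed (use L1 in \<open>auto simp: norm_mult indicator_def\<close>)
    then have "norm (rep_l2 (IFT (cut (real n) (FT (abs_l2 u)))) x) \<le> (LINT \<xi>|lborel. norm (?g \<xi>)) / (2 * pi)" for n
      using elim(3) by (simp add: norm_divide divide_right_mono)
    with LIMSEQ_le_const2[OF tendsto_norm[OF elim(1)]] elim(2) show ?case
      by auto
  qed
  then show ?thesis ..
qed

text \<open>Enclosing the exceptional set in a Borel null set covers predicates such as the
  convergence of a sequence of functions, without a measurability proof for
  \<open>P\<close>.\<close>

lemma AE_lborel_affine:
  fixes P :: "real \<Rightarrow> bool"
  assumes "c \<noteq> 0" "AE x in lborel. P x"
  shows "AE x in lborel. P (t + c * x)"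
proof -
  obtain N where N: "{x. \<not> P x} \<subseteq> N" "N \<in> null_sets lborel"
    using assms(2) by (auto simp: eventually_ae_filter)
  have "AE x in lborel. x \<notin> N"
    by (rule AE_not_in[OF N(2)])
  moreover have "N \<in> sets borel"
    using N(2) by (auto simp: null_sets_def)
  then have "Measurable.pred borel (\<lambda>x. x \<notin> N)"
    by measurable
  ultimately have "AE x in lborel. t + c * x \<notin> N"
    by (intro AE_borel_affine assms(1))
  then show ?thesis
    using N(1) by (auto elim: eventually_mono)
qed

text \<open>For truncated integrals the identity holds at every \<open>\<eta>\<close> by conjugating
  under the integral. It passes to the limit along a subsequence converging almost everywhere,
  transported by the reflection to \<open>\<xi> - \<eta>\<close>.\<close>

lemma FT_reflect:
  "AE \<eta> in lborel. rep_l2 (FT (bmul (\<lambda>t. cis (t * \<xi>)) (cj x))) \<eta> = cnj (rep_l2 (FT x) (\<xi> - \<eta>))"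
proof -
  interpret F: bounded_linear FT by (rule bounded_linear_FT)
  have m: "bmeas (\<lambda>t. cis (t * \<xi>))"
    by (rule bmeasI[of _ 1]) auto
  let ?z = "bmul (\<lambda>t. cis (t * \<xi>)) (cj x)"
  have "AE t in lborel. rep_l2 ?z t = cis (t * \<xi>) * cnj (rep_l2 x t)"
    using rep_bmul[OF m, of "cj x"] rep_cj[of x] by eventually_elim simp
  then have "tft R ?z \<eta> = (LINT t|lborel. indicator {-R..R} t * (cis (t * \<xi>) * cnj (rep_l2 x t)) * cis (- (t * \<eta>)))" for R \<eta>
    by (rule tft_AE) measurable
  also have "\<dots> R \<eta> = (LINT t|lborel. cnj (indicator {-R..R} t * rep_l2 x t * cis (- (t * (\<xi> - \<eta>)))))" for R \<eta>
  proof (rule Bochner_Integration.integral_cong)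
    fix t
    have "cis (t * \<xi>) * cis (- (t * \<eta>)) = cis (t * (\<xi> - \<eta>))"
      by (simp add: cis_mult right_diff_distrib)
    then show "indicator {-R..R} t * (cis (t * \<xi>) * cnj (rep_l2 x t)) * cis (- (t * \<eta>))
       = cnj (indicator {-R..R} t * rep_l2 x t * cis (- (t * (\<xi> - \<eta>))))"
      by (simp add: cis_cnj mult_ac)
  qed simp
  also have "\<dots> R \<eta> = cnj (tft R x (\<xi> - \<eta>))" for R \<eta>
    unfolding tft_AE[OF AE_I2 rep_measurable, OF refl] by (rule Bochner_Integration.integral_cnj)
  finally have T: "tft R ?z \<eta> = cnj (tft R x (\<xi> - \<eta>))" for R \<eta> .
  have "(\<lambda>n. FT (cut (real n) x)) \<longlonglongrightarrow> FT x"
    by (intro F.tendsto tendsto_cut filterlim_real_sequentially)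
  from l2_subseq_AE[OF this]
  obtain r where r: "strict_mono r" "AE t in lborel. (\<lambda>n. rep_l2 (FT (cut (real (r n)) x)) t) \<longlonglongrightarrow> rep_l2 (FT x) t"
    by blast
  have "AE t in lborel. \<forall>n. rep_l2 (FT (cut (real n) x)) t = tft (real n) x t"
    unfolding AE_all_countable by (intro allI FT_cut)
  with r(2) have "AE t in lborel. (\<lambda>n. tft (real (r n)) x t) \<longlonglongrightarrow> rep_l2 (FT x) t"
    by eventually_elim simp
  then have lim: "AE \<eta> in lborel. (\<lambda>n. tft (real (r n)) x (\<xi> + (-1) * \<eta>)) \<longlonglongrightarrow> rep_l2 (FT x) (\<xi> + (-1) * \<eta>)"
    by (intro AE_lborel_affine) auto
  have "AE \<eta> in lborel. \<forall>n. rep_l2 (FT (cut (real (r n)) ?z)) \<eta> = tft (real (r n)) ?z \<eta>"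
    unfolding AE_all_countable by (intro allI FT_cut)
  with lim have L: "AE \<eta> in lborel. (\<lambda>n. rep_l2 (FT (cut (real (r n)) ?z)) \<eta>) \<longlonglongrightarrow> cnj (rep_l2 (FT x) (\<xi> - \<eta>))"
    by eventually_elim (simp add: T tendsto_cnj)
  have "(\<lambda>n. FT (cut (real (r n)) ?z)) \<longlonglongrightarrow> FT ?z"
    by (intro F.tendsto tendsto_cut filterlim_compose[OF filterlim_real_sequentially filterlim_subseq[OF r(1)]])
  from l2_limit_AE[OF this L] show ?thesis .
qed

text \<open>Plancherel turns the integral into the convolution at \<open>\<xi>\<close> of two
  transforms living on the positive half-line. For \<open>\<xi> < 0\<close> every
  \<open>\<eta>\<close> satisfies \<open>\<eta> < 0\<close> or \<open>\<xi> - \<eta> < 0\<close>, so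
  one factor always vanishes.\<close>

lemma hardy_product:
  assumes "x \<in> hardy" "y \<in> hardy" "\<xi> < 0"
  shows "(LINT t|lborel. rep_l2 x t * rep_l2 y t * cis (- (t * \<xi>))) = 0"
proof -
  have m: "bmeas (\<lambda>t. cis (t * \<xi>))"
    by (rule bmeasI[of _ 1]) auto
  let ?z = "bmul (\<lambda>t. cis (t * \<xi>)) (cj x)"
  have "AE t in lborel. rep_l2 ?z t = cis (t * \<xi>) * cnj (rep_l2 x t)"
    using rep_bmul[OF m, of "cj x"] rep_cj[of x] by eventually_elim simp
  then have "cint ?z y = (LINT t|lborel. cnj (cis (t * \<xi>) * cnj (rep_l2 x t)) * rep_l2 y t)"
    by (intro cint_AE_cong) auto
  then have "(LINT t|lborel. rep_l2 x t * rep_l2 y t * cis (- (t * \<xi>))) = cint ?z y"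
    by (simp add: cis_cnj mult_ac)
  moreover have "cint (FT ?z) (FT y) = (LINT \<eta>|(lborel :: real measure). (0 :: complex))"
    unfolding cint_def
  proof (rule integral_cong_AE)
    have "AE \<eta> in lborel. \<eta> < 0 \<longrightarrow> rep_l2 (FT x) \<eta> = 0"
      using assms(1) by (simp add: hardy_def)
    then have "AE \<eta> in lborel. \<xi> + (-1) * \<eta> < 0 \<longrightarrow> rep_l2 (FT x) (\<xi> + (-1) * \<eta>) = 0"
      by (intro AE_borel_affine[of "-1" "\<lambda>\<eta>. \<eta> < 0 \<longrightarrow> rep_l2 (FT x) \<eta> = 0"]) auto
    moreover have "AE \<eta> in lborel. \<eta> < 0 \<longrightarrow> rep_l2 (FT y) \<eta> = 0"
      using assms(2) by (simp add: hardy_def)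
    ultimately show "AE \<eta> in lborel. cnj (rep_l2 (FT ?z) \<eta>) * rep_l2 (FT y) \<eta> = 0"
      using FT_reflect[of \<xi> x]
    proof eventually_elim
      case (elim \<eta>)
      then show ?case using assms(3) by (cases "\<eta> < 0") auto
    qed
  qed measurable
  ultimately show ?thesis
    using Plancherel[of ?z y] by simp
qed


section \<open>Finite-rank perturbations\<close>

text \<open>A vector \<open>v\<close> missed by \<open>T\<close> would, together with the images of
  a basis, form an independent set with more elements than the dimension allows.\<close>

lemma injective_endomorphism_surj:
  fixes T :: "'a::real_vector \<Rightarrow> 'a"
  assumes "linear T" "finite C" "T ` span C \<subseteq> span C" "\<And>x. x \<in> span C \<Longrightarrow> T x = 0 \<Longrightarrow> x = 0"
  shows "T ` span C = span C"
proof -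
  interpret T: linear T by fact
  obtain D where D: "D \<subseteq> span C" "independent D" "span C \<subseteq> span D"
    by (rule basis_exists) blast
  have sD: "span D = span C"
    using span_minimal[OF D(1) subspace_span] D(3) by (rule subset_antisym)
  have finD: "finite D"
    using independent_span_bound[OF assms(2) D(2,1)] by simp
  have inj: "inj_on T (span C)"
  proof (rule inj_onI)
    fix x y assume "x \<in> span C" "y \<in> span C" "T x = T y"
    then show "x = y"
      using assms(4)[of "x - y"] by (simp add: T.diff span_diff)
  qed
  have ind: "independent (T ` D)"
    by (rule linear_independent_injective_image[OF assms(1) D(2)]) (simp only: sD inj)
  have TD: "T ` D \<subseteq> span D"
    using assms(3) D(1) sD by blast
  have card: "card (T ` D) = card D"
    by (rule card_image) (rule inj_on_subset[OF inj D(1)])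
  have "span C \<subseteq> T ` span C"
  proof
    fix v assume v: "v \<in> span C"
    show "v \<in> T ` span C"
    proof (rule ccontr)
      assume n: "v \<notin> T ` span C"
      have "v \<notin> span (T ` D)"
        using n by (simp add: linear_span_image[OF assms(1)] sD)
      then have "independent (insert v (T ` D))"
        by (rule independent_insertI[OF _ ind])
      moreover have "insert v (T ` D) \<subseteq> span D"
        using v TD sD by auto
      ultimately have "card (insert v (T ` D)) \<le> card D"
        using independent_span_bound[OF finD] by blast
      moreover have "v \<notin> T ` D"
        using n D(1) by blast
      ultimately show False
        using card finD by simp
    qed
  qed
  then show ?thesis using assms(3) by blast
qed

text \<open>\<open>R\<close> inverts \<open>1 - E\<close>: its value at \<open>y\<close> is the
  fixed point of the contraction sending \<open>x\<close> to \<open>y + E x\<close>. Uniqueness of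
  the fixed point gives linearity.\<close>

lemma contraction_inverse:
  fixes E :: "'a::banach \<Rightarrow> 'a"
  assumes "linear E" "0 \<le> q" "q < 1" "\<And>x. norm (E x) \<le> q * norm x"
  shows "\<exists>R. linear R \<and> (\<forall>x. R (x - E x) = x) \<and> (\<forall>y. R y - E (R y) = y)"
proof -
  interpret E: linear E by fact
  have ex1: "\<exists>!x. y + E x = x" for y
  proof (rule banach_fix_type[OF assms(2,3)])
    show "\<forall>x x'. dist (y + E x) (y + E x') \<le> q * dist x x'"
      using assms(4) by (simp add: dist_norm E.diff[symmetric])
  qed
  define R where "R y = (THE x. y + E x = x)" for y
  have R: "y + E (R y) = R y" for y
    unfolding R_def by (rule theI'[OF ex1])
  have uniq: "x = R y" if "y + E x = x" for x y
    unfolding R_def by (rule the1_equality[OF ex1 that, symmetric])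
  have 1: "R (x - E x) = x" for x
    by (rule uniq[symmetric]) simp
  have 2: "R y - E (R y) = y" for y
    using R[of y] by (simp add: algebra_simps)
  have "linear R"
  proof (rule linearI)
    show "R (x + y) = R x + R y" for x y
      using R[of x] R[of y] by (intro uniq[symmetric]) (simp add: E.add algebra_simps)
    show "R (c *\<^sub>R x) = c *\<^sub>R R x" for c x
      by (intro uniq[symmetric]) (simp only: E.scale scaleR_add_right[symmetric] R)
  qed
  with 1 2 show ?thesis by (intro exI[of _ R] conjI allI)
qed

text \<open>With \<open>R\<close> inverse to \<open>1 - E\<close> the equation becomes
  \<open>x - R (F x) = R y\<close>. The ansatz \<open>x = R y + w\<close> leaves
  \<open>w - R (F w) = R (F (R y))\<close>, an equation inside the finite-dimensional span of the
  image of \<open>B\<close> under \<open>R\<close>, where injectivity implies surjectivity.\<close>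

lemma finite_rank_perturbation_surj:
  fixes E F :: "'a::banach \<Rightarrow> 'a"
  assumes E: "linear E" "0 \<le> q" "q < 1" "\<And>x. norm (E x) \<le> q * norm x"
    and F: "linear F" "finite B" "\<And>x. F x \<in> span B"
    and inj: "\<And>x. x = E x + F x \<Longrightarrow> x = 0"
  shows "\<exists>x. x = y + E x + F x"
proof -
  obtain R where "linear R \<and> (\<forall>x. R (x - E x) = x) \<and> (\<forall>y. R y - E (R y) = y)"
    using contraction_inverse[OF E] ..
  then have R: "linear R" "R (x - E x) = x" "R y - E (R y) = y" for x y
    by simp_all
  interpret R: linear R by (rule R(1))
  interpret F: linear F by (rule F(1))
  let ?T = "\<lambda>x. x - R (F x)"
  have T: "linear ?T"
    by (rule linearI) (simp_all add: R.add F.add R.scale F.scale algebra_simps)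
  have RF: "R (F x) \<in> span (R ` B)" for x
    unfolding linear_span_image[OF R(1)] using F(3) by (rule imageI)
  have "?T ` span (R ` B) = span (R ` B)"
  proof (rule injective_endomorphism_surj[OF T])
    show "finite (R ` B)" using F(2) by simp
    show "?T ` span (R ` B) \<subseteq> span (R ` B)"
      using RF by (auto intro: span_diff)
    fix x assume "x - R (F x) = 0"
    then have "x = R (F x)" by simp
    then have "x - E x = F x" using R(3)[of "F x"] by simp
    then show "x = 0" by (intro inj) (simp add: algebra_simps)
  qed
  then have "R (F (R y)) \<in> ?T ` span (R ` B)"
    using RF[of "R y"] by (simp only:)
  then obtain w where w: "?T w = R (F (R y))"
    by (elim imageE) (rule that, simp)
  define x where "x = R y + w"
  have "x = R (y + F x)"
    using w by (simp add: x_def R.add F.add algebra_simps)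
  then have "x - E x = y + F x"
    using R(3)[of "y + F x"] by simp
  then show ?thesis
    by (intro exI[of _ x]) (simp add: algebra_simps)
qed


section \<open>Primitives of integrable functions\<close>

definition prim :: "(real \<Rightarrow> complex) \<Rightarrow> real \<Rightarrow> complex" where
  "prim A x = (LINT y|lborel. (if y < x then A y else 0))"

lemma prim_integrable:
  fixes A :: "real \<Rightarrow> complex"
  assumes "integrable lborel A"
  shows "integrable lborel (\<lambda>y. if y < x then A y else 0)"
  by (rule Bochner_Integration.integrable_bound[OF assms]) (use borel_measurable_integrable[OF assms] in auto)

lemma prim_measurable [measurable]:
  assumes [measurable]: "A \<in> borel_measurable borel"
  shows "prim A \<in> borel_measurable borel"
  unfolding prim_def[abs_def] by measurable

lemma norm_prim_le: "integrable lborel A \<Longrightarrow> norm (prim A x) \<le> (LINT y|lborel. norm (A y))"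
  unfolding prim_def
  by (rule order_trans[OF integral_norm_bound integral_mono]) (auto intro: integrable_norm prim_integrable)

lemma prim_at_top:
  assumes "integrable lborel A"
  shows "(prim A \<longlongrightarrow> (LINT y|lborel. A y)) at_top"
  unfolding prim_def[abs_def]
proof (rule integral_dominated_convergence_at_top[where w = "\<lambda>y. norm (A y)"])
  show "AE y in lborel. ((\<lambda>x. if y < x then A y else 0) \<longlongrightarrow> A y) at_top"
  proof (rule AE_I2)
    fix y :: real
    have "\<forall>\<^sub>F x in at_top. A y = (if y < x then A y else 0)"
      using eventually_gt_at_top[of y] by eventually_elim simp
    then show "((\<lambda>x. if y < x then A y else 0) \<longlongrightarrow> A y) at_top"
      by (rule Lim_transform_eventually[OF tendsto_const])
  qed
qed (use assms borel_measurable_integrable[OF assms] in auto)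

lemma prim_at_bot:
  assumes "integrable lborel A"
  shows "(prim A \<longlongrightarrow> 0) at_bot"
proof -
  have "((\<lambda>x. prim A (- x)) \<longlongrightarrow> (LINT y|(lborel :: real measure). (0 :: complex))) at_top"
    unfolding prim_def[abs_def]
  proof (rule integral_dominated_convergence_at_top[where w = "\<lambda>y. norm (A y)"])
    show "AE y in lborel. ((\<lambda>x. if y < - x then A y else 0) \<longlongrightarrow> 0) at_top"
    proof (rule AE_I2)
      fix y :: real
      have "\<forall>\<^sub>F x in at_top. 0 = (if y < - x then A y else 0)"
        using eventually_gt_at_top[of "- y"] by eventually_elim simp
      then show "((\<lambda>x. if y < - x then A y else 0) \<longlongrightarrow> 0) at_top"
        by (rule Lim_transform_eventually[OF tendsto_const])
    qed
  qed (use assms borel_measurable_integrable[OF assms] in auto)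
  then show ?thesis
    by (simp add: filterlim_at_bot_mirror)
qed

lemma integrable_mult_prim:
  assumes "integrable lborel A" "integrable lborel B"
  shows "integrable lborel (\<lambda>y. A y * prim B y)"
proof (rule Bochner_Integration.integrable_bound)
  show "integrable lborel (\<lambda>y. norm (A y) * (LINT z|lborel. norm (B z)))"
    by (intro integrable_mult_left integrable_norm assms)
  show "AE y in lborel. norm (A y * prim B y) \<le> norm (norm (A y) * (LINT z|lborel. norm (B z)))"
    using norm_prim_le[OF assms(2)] by (auto simp: norm_mult abs_mult intro!: mult_left_mono order_trans[OF _ abs_ge_self])
qed (use borel_measurable_integrable[OF assms(1)] borel_measurable_integrable[OF assms(2)] in measurable)

text \<open>Fubini on the two triangles.\<close>

lemma prim_product:
  assumes A: "integrable lborel A" and B: "integrable lborel B"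
  shows "(LINT y|lborel. A y) * (LINT z|lborel. B z) = (LINT y|lborel. A y * prim B y) + (LINT z|lborel. B z * prim A z)"
proof -
  have [measurable]: "A \<in> borel_measurable borel" "B \<in> borel_measurable borel"
    using assms by auto
  let ?f = "\<lambda>y z. if y < z then A y * B z else 0"
  have int: "integrable (lborel \<Otimes>\<^sub>M lborel) (case_prod ?f)"
  proof (rule lborel_pair.Fubini_integrable)
    have 1: "integrable lborel (\<lambda>z. ?f y z)" for y
      by (rule Bochner_Integration.integrable_bound[where f = "\<lambda>z. A y * B z"]) (use B in auto)
    show "AE y in lborel. integrable lborel (\<lambda>z. case_prod ?f (y, z))"
      using 1 by simp
    show "integrable lborel (\<lambda>y. LINT z|lborel. norm (case_prod ?f (y, z)))"
    proof (rule Bochner_Integration.integrable_bound)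
      show "integrable lborel (\<lambda>y. norm (A y) * (LINT z|lborel. norm (B z)))"
        by (intro integrable_mult_left integrable_norm assms)
      show "AE y in lborel. norm (LINT z|lborel. norm (case_prod ?f (y, z))) \<le> norm (norm (A y) * (LINT z|lborel. norm (B z)))"
      proof (rule AE_I2)
        fix y
        have "norm (LINT z|lborel. norm (case_prod ?f (y, z))) = (LINT z|lborel. norm (?f y z))"
          by (simp add: integral_nonneg_AE)
        also have "\<dots> \<le> (LINT z|lborel. norm (A y) * norm (B z))"
          by (rule integral_mono) (use 1[of y] B in \<open>auto intro: integrable_norm simp: norm_mult\<close>)
        also have "\<dots> \<le> norm (norm (A y) * (LINT z|lborel. norm (B z)))"
          by simp
        finally show "norm (LINT z|lborel. norm (case_prod ?f (y, z))) \<le> norm (norm (A y) * (LINT z|lborel. norm (B z)))" .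
      qed
    qed measurable
  qed measurable
  have "B z * prim A z = (LINT y|lborel. ?f y z)" for z
  proof -
    have "B z * prim A z = (LINT y|lborel. B z * (if y < z then A y else 0))"
      by (simp add: prim_def)
    also have "\<dots> = (LINT y|lborel. ?f y z)"
      by (rule Bochner_Integration.integral_cong) auto
    finally show ?thesis .
  qed
  then have "(LINT z|lborel. B z * prim A z) = (LINT z|lborel. LINT y|lborel. ?f y z)"
    by (simp only:)
  also have "\<dots> = (LINT y|lborel. LINT z|lborel. ?f y z)"
    by (rule lborel_pair.Fubini_integral[OF int])
  also have "\<dots> = (LINT y|lborel. A y * ((LINT z|lborel. B z) - prim B y))"
  proof (rule Bochner_Integration.integral_cong)
    fix y
    have "(LINT z|lborel. ?f y z) = (LINT z|lborel. A y * (B z - (if z < y then B z else 0)))"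
    proof (rule integral_cong_AE)
      show "AE z in lborel. ?f y z = A y * (B z - (if z < y then B z else 0))"
        using AE_lborel_singleton[of y] by eventually_elim auto
    qed measurable
    also have "\<dots> = A y * ((LINT z|lborel. B z) - prim B y)"
      unfolding prim_def by (simp add: Bochner_Integration.integral_diff[OF B prim_integrable[OF B]])
    finally show "(LINT z|lborel. ?f y z) = A y * ((LINT z|lborel. B z) - prim B y)" .
  qed simp
  also have "\<dots> = (LINT y|lborel. A y * (LINT z|lborel. B z)) - (LINT y|lborel. A y * prim B y)"
    unfolding right_diff_distrib
    by (intro Bochner_Integration.integral_diff integrable_mult_left A integrable_mult_prim B)
  finally show ?thesis by simp
qed

section \<open>Test functions\<close>

abbreviation vd :: "(real \<Rightarrow> complex) \<Rightarrow> real \<Rightarrow> complex" where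
  "vd f \<equiv> (\<lambda>y. vector_derivative f (at y))"

definition smooth :: "(real \<Rightarrow> complex) \<Rightarrow> bool" where
  "smooth f \<longleftrightarrow> (\<forall>n x. (vd ^^ n) f differentiable (at x))"

text \<open>Spares formulas for higher derivatives: it suffices to exhibit a class of differentiable
  functions that is closed under \<open>vd\<close>.\<close>

lemma smooth_coinduct:
  assumes "f \<in> S" "\<And>f x. f \<in> S \<Longrightarrow> f differentiable (at x)" "\<And>f. f \<in> S \<Longrightarrow> vd f \<in> S"
  shows "smooth f"
proof -
  have "(vd ^^ n) f \<in> S" for n
    by (induction n) (use assms in auto)
  then show ?thesis
    using assms(2) by (simp add: smooth_def)
qed

lemma smooth_vd:
  assumes "smooth f"
  shows "smooth (vd f)"
  unfolding smooth_def
proof (intro allI)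
  fix n x
  show "(vd ^^ n) (vd f) differentiable (at x)"
    using assms[unfolded smooth_def, THEN spec, THEN spec, of "Suc n" x] by (simp only: funpow_Suc_right o_apply)
qed

lemma smooth_differentiable:
  assumes "smooth f"
  shows "f differentiable (at x)"
  using assms[unfolded smooth_def, THEN spec, THEN spec, of 0 x] by (simp only: funpow_0)

lemma smooth_has_vd: "smooth f \<Longrightarrow> (f has_vector_derivative vd f x) (at x)"
  using smooth_differentiable[of f x] by (simp add: vector_derivative_works)

lemma smooth_continuous: "smooth f \<Longrightarrow> continuous_on S f"
  by (intro continuous_at_imp_continuous_on ballI differentiable_imp_continuous_within smooth_differentiable)

lemma smooth_measurable: "smooth f \<Longrightarrow> f \<in> borel_measurable borel"
  by (intro borel_measurable_continuous_onI smooth_continuous)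

lemma smooth_lincomb:
  assumes "smooth f" "smooth g"
  shows "smooth (\<lambda>x. a * f x + b * g x)"
proof (rule smooth_coinduct[where S = "{\<lambda>x. a * f x + b * g x | f g. smooth f \<and> smooth g}"])
  fix h x assume "h \<in> {\<lambda>x. a * f x + b * g x | f g. smooth f \<and> smooth g}"
  then obtain f g where h: "h = (\<lambda>x. a * f x + b * g x)" and s: "smooth f" "smooth g" by blast
  have D: "(h has_vector_derivative (a * vd f x + b * vd g x)) (at x)" for x
    unfolding h by (intro has_vector_derivative_add has_vector_derivative_mult_right smooth_has_vd s)
  show "h differentiable (at x)"
    using D by (rule differentiableI_vector)
  have "vd h = (\<lambda>x. a * vd f x + b * vd g x)"
    by (rule ext) (rule vector_derivative_at[OF D])
  then show "vd h \<in> {\<lambda>x. a * f x + b * g x | f g. smooth f \<and> smooth g}"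
    by (intro CollectI exI[of _ "vd f"] exI[of _ "vd g"] conjI smooth_vd s)
next
  show "(\<lambda>x. a * f x + b * g x) \<in> {\<lambda>x. a * f x + b * g x | f g. smooth f \<and> smooth g}"
    by (intro CollectI exI[of _ f] exI[of _ g] conjI refl assms)
qed

lemma has_vector_derivative_cis: "((\<lambda>x. cis (m * x)) has_vector_derivative \<i> * of_real m * cis (m * x)) (at x)"
  unfolding has_vector_derivative_complex_iff
  by (auto intro!: derivative_eq_intros)

text \<open>The factor 1 gives the bracket the form required by \<open>smooth_lincomb\<close>, so
  that the class in \<open>smooth_cis_mult\<close> is visibly closed under differentiation.\<close>

lemma has_vd_cis_mult:
  assumes "smooth f"
  shows "((\<lambda>x. cis (m * x) * f x) has_vector_derivative cis (m * x) * (\<i> * of_real m * f x + 1 * vd f x)) (at x)"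
  using has_vector_derivative_mult[OF has_vector_derivative_cis smooth_has_vd[OF assms]]
  by (rule has_vector_derivative_eq_rhs) (simp add: algebra_simps)

lemma vd_cis_mult:
  "smooth f \<Longrightarrow> vd (\<lambda>x. cis (m * x) * f x) x = cis (m * x) * (\<i> * of_real m * f x + vd f x)"
  using vector_derivative_at[OF has_vd_cis_mult, of f m x] by simp

lemma smooth_cis_mult:
  assumes "smooth f"
  shows "smooth (\<lambda>x. cis (m * x) * f x)"
proof (rule smooth_coinduct[where S = "{\<lambda>x. cis (m * x) * f x | f. smooth f}"])
  fix h x assume "h \<in> {\<lambda>x. cis (m * x) * f x | f. smooth f}"
  then obtain f where h: "h = (\<lambda>x. cis (m * x) * f x)" and s: "smooth f" by blast
  show "h differentiable (at x)"
    unfolding h by (rule differentiableI_vector[OF has_vd_cis_mult[OF s]])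
  have "vd h = (\<lambda>x. cis (m * x) * (\<i> * of_real m * f x + 1 * vd f x))"
    unfolding h by (rule ext) (rule vector_derivative_at[OF has_vd_cis_mult[OF s]])
  then show "vd h \<in> {\<lambda>x. cis (m * x) * f x | f. smooth f}"
    by (intro CollectI exI[of _ "\<lambda>x. \<i> * of_real m * f x + 1 * vd f x"] conjI smooth_lincomb smooth_vd s)
next
  show "(\<lambda>x. cis (m * x) * f x) \<in> {\<lambda>x. cis (m * x) * f x | f. smooth f}"
    by (intro CollectI exI[of _ f] conjI refl assms)
qed

lemma test_function_iff: "\<phi> \<in> test_functions \<longleftrightarrow> smooth \<phi> \<and> (\<exists>R. \<forall>x. R < \<bar>x\<bar> \<longrightarrow> \<phi> x = 0)"
proof -
  have "compact (closure {x. \<phi> x \<noteq> 0}) \<longleftrightarrow> (\<exists>R. \<forall>x. R < \<bar>x\<bar> \<longrightarrow> \<phi> x = 0)"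
  proof
    assume "compact (closure {x. \<phi> x \<noteq> 0})"
    then have "bounded {x. \<phi> x \<noteq> 0}"
      using bounded_subset[OF compact_imp_bounded closure_subset] by blast
    then obtain R where R: "\<And>x. \<phi> x \<noteq> 0 \<Longrightarrow> \<bar>x\<bar> \<le> R"
      by (auto simp: bounded_iff)
    show "\<exists>R. \<forall>x. R < \<bar>x\<bar> \<longrightarrow> \<phi> x = 0"
      by (rule exI[of _ R]) (use R in \<open>auto simp: not_le[symmetric]\<close>)
  next
    assume "\<exists>R. \<forall>x. R < \<bar>x\<bar> \<longrightarrow> \<phi> x = 0"
    then obtain R where R: "\<And>x. R < \<bar>x\<bar> \<Longrightarrow> \<phi> x = 0" by blast
    have "{x. \<phi> x \<noteq> 0} \<subseteq> {-R..R}"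
    proof
      fix x assume "x \<in> {x. \<phi> x \<noteq> 0}"
      then have "\<not> R < \<bar>x\<bar>" using R[of x] by auto
      then show "x \<in> {-R..R}" by auto
    qed
    then have "bounded {x. \<phi> x \<noteq> 0}"
      by (rule bounded_subset[OF bounded_closed_interval])
    then show "compact (closure {x. \<phi> x \<noteq> 0})"
      by (simp add: compact_closure)
  qed
  then show ?thesis
    unfolding test_functions_def smooth_def by auto
qed

lemma test_smooth: "\<phi> \<in> test_functions \<Longrightarrow> smooth \<phi>"
  by (simp add: test_function_iff)

lemma test_lincomb:
  assumes "\<phi> \<in> test_functions" "\<theta> \<in> test_functions"
  shows "(\<lambda>x. a * \<phi> x + b * \<theta> x) \<in> test_functions"
proof -
  obtain R Q where RQ: "\<And>x. R < \<bar>x\<bar> \<Longrightarrow> \<phi> x = 0" "\<And>x. Q < \<bar>x\<bar> \<Longrightarrow> \<theta> x = 0"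
    using assms unfolding test_function_iff by blast
  show ?thesis
    unfolding test_function_iff using assms
    by (intro conjI smooth_lincomb test_smooth exI[of _ "max R Q"]) (auto simp: RQ)
qed

lemma test_cis_mult:
  assumes "\<phi> \<in> test_functions"
  shows "(\<lambda>x. cis (m * x) * \<phi> x) \<in> test_functions"
  using assms unfolding test_function_iff by (auto intro: smooth_cis_mult)

lemma test_vd:
  assumes "\<phi> \<in> test_functions"
  shows "vd \<phi> \<in> test_functions"
proof -
  obtain R where R: "\<And>x. R < \<bar>x\<bar> \<Longrightarrow> \<phi> x = 0"
    using assms unfolding test_function_iff by blast
  have "vd \<phi> x = 0" if "R < \<bar>x\<bar>" for x
  proof (rule vector_derivative_at)
    have "open {x. R < \<bar>x\<bar>}"
      by (intro open_Collect_less continuous_intros)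
    then show "(\<phi> has_vector_derivative 0) (at x)"
      by (rule has_vector_derivative_transform_within_open[OF has_vector_derivative_const])
        (use that R in auto)
  qed
  then show ?thesis
    unfolding test_function_iff using smooth_vd[OF test_smooth[OF assms]] by blast
qed

lemma test_bounded:
  assumes "\<phi> \<in> test_functions"
  shows "\<exists>R C. \<forall>x. norm (\<phi> x) \<le> C * indicator {-R..R} x"
proof -
  obtain R where R: "\<And>x. R < \<bar>x\<bar> \<Longrightarrow> \<phi> x = 0"
    using assms unfolding test_function_iff by blast
  have "bounded (\<phi> ` {-R..R})"
    by (intro compact_imp_bounded compact_continuous_image smooth_continuous test_smooth assms compact_Icc)
  then obtain C where "\<forall>y\<in>\<phi> ` {-R..R}. norm y \<le> C"
    unfolding bounded_iff ..
  then have C: "norm (\<phi> x) \<le> C" if "x \<in> {-R..R}" for x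
    using that by (rule bspec[OF _ imageI])
  have "norm (\<phi> x) \<le> C * indicator {-R..R} x" for x
  proof (cases "x \<in> {-R..R}")
    case False
    then have "R < \<bar>x\<bar>" by auto
    then show ?thesis using R[of x] False by simp
  qed (use C in simp)
  then show ?thesis by blast
qed

lemma test_L2: "\<phi> \<in> test_functions \<Longrightarrow> \<phi> \<in> L2"
  and test_integrable: "\<phi> \<in> test_functions \<Longrightarrow> integrable lborel \<phi>"
proof -
  assume t: "\<phi> \<in> test_functions"
  obtain R C where RC: "\<And>x. norm (\<phi> x) \<le> C * indicator {-R..R} x"
    using test_bounded[OF t] by blast
  have [measurable]: "\<phi> \<in> borel_measurable borel"
    by (intro smooth_measurable test_smooth t)
  have I: "integrable lborel (\<lambda>x. D * indicat_real {-R..R} x)" for D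
    by (intro integrable_mult_right integrable_real_indicator) (auto simp: emeasure_lborel_Icc_eq)
  show "integrable lborel \<phi>"
    by (rule Bochner_Integration.integrable_bound[OF I[of C]]) (use RC in \<open>auto intro: order_trans[OF _ abs_ge_self]\<close>)
  show "\<phi> \<in> L2"
  proof (rule L2_bound[OF _ I[of "C\<^sup>2"]])
    show "AE x in lborel. (norm (\<phi> x))\<^sup>2 \<le> C\<^sup>2 * indicat_real {-R..R} x"
    proof (rule AE_I2)
      fix x
      show "(norm (\<phi> x))\<^sup>2 \<le> C\<^sup>2 * indicat_real {-R..R} x"
        using power_mono[OF RC[of x] norm_ge_zero, of 2] by (auto simp: indicator_def split: if_splits)
    qed
  qed measurable
qed

section \<open>Integration by parts against test functions\<close>

lemma prim_vd:
  assumes "\<eta> \<in> test_functions"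
  shows "prim (vd \<eta>) x = \<eta> x"
proof -
  obtain R where R: "\<And>x. R < \<bar>x\<bar> \<Longrightarrow> \<eta> x = 0"
    using assms unfolding test_function_iff by blast
  obtain R' where R': "\<And>x. R' < \<bar>x\<bar> \<Longrightarrow> vd \<eta> x = 0"
    using test_vd[OF assms] unfolding test_function_iff by blast
  \<comment> \<open>A point not to the right of \<open>x\<close> and to the left of the supports of
    \<open>\<eta>\<close> and of its derivative; the integral can start there.\<close>
  define a where "a = min x (- max \<bar>R\<bar> \<bar>R'\<bar> - 1)"
  have a: "a \<le> x" "\<eta> a = 0" "\<And>y. y < a \<Longrightarrow> vd \<eta> y = 0"
    by (auto simp: a_def intro!: R R')
  have [measurable]: "vd \<eta> \<in> borel_measurable borel"
    by (intro smooth_measurable test_smooth test_vd assms)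
  have "prim (vd \<eta>) x = (LINT y|lborel. indicator {a..x} y *\<^sub>R vd \<eta> y)"
    unfolding prim_def
  proof (rule integral_cong_AE)
    show "AE y in lborel. (if y < x then vd \<eta> y else 0) = indicator {a..x} y *\<^sub>R vd \<eta> y"
      using AE_lborel_singleton[of x]
    proof eventually_elim
      case (elim y)
      show ?case
        using elim a(3)[of y] by (cases "y < a") (auto simp: indicator_def)
    qed
  qed measurable
  also have "\<dots> = \<eta> x - \<eta> a"
  proof (rule integral_FTC_Icc[OF a(1)])
    show "(\<eta> has_vector_derivative vd \<eta> y) (at y within {a..x})" for y
      by (rule has_vector_derivative_at_within[OF smooth_has_vd[OF test_smooth[OF assms]]])
    show "continuous_on {a..x} (vd \<eta>)"
      by (intro smooth_continuous test_smooth test_vd assms)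
  qed
  finally show ?thesis using a(2) by simp
qed

lemma integral_vd:
  assumes "\<eta> \<in> test_functions"
  shows "(LINT x|lborel. vd \<eta> x) = 0"
proof -
  obtain R where R: "\<And>x. R < \<bar>x\<bar> \<Longrightarrow> \<eta> x = 0"
    using assms unfolding test_function_iff by blast
  have "\<forall>\<^sub>F x in at_top. 0 = prim (vd \<eta>) x"
    using eventually_gt_at_top[of "\<bar>R\<bar>"] by eventually_elim (simp add: prim_vd[OF assms] R)
  then have "(prim (vd \<eta>) \<longlongrightarrow> 0) at_top"
    by (rule Lim_transform_eventually[OF tendsto_const])
  with prim_at_top[OF test_integrable[OF test_vd[OF assms]]] show ?thesis
    by (intro tendsto_unique[OF trivial_limit_at_top_linorder])
qed

text \<open>Integration by parts without differentiating \<open>prim A\<close>: it is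
  \<open>prim_product\<close> for \<open>A\<close> and \<open>vd \<eta>\<close>, whose left side is
  0 because the derivative of a test function has integral 0.\<close>

lemma integral_prim_vd:
  assumes "integrable lborel A" "\<eta> \<in> test_functions"
  shows "(LINT x|lborel. prim A x * vd \<eta> x) = - (LINT x|lborel. A x * \<eta> x)"
  using prim_product[OF assms(1) test_integrable[OF test_vd[OF assms(2)]]]
  by (simp add: integral_vd[OF assms(2)] prim_vd[OF assms(2)] mult.commute add_eq_0_iff2)

text \<open>The primitive from the left vanishes to the left of the support of
  \<open>\<theta>\<close>; the zero integral makes it vanish to the right as well.\<close>

lemma test_antiderivative:
  assumes \<theta>: "\<theta> \<in> test_functions" and zero: "(LINT x|lborel. \<theta> x) = 0"
  shows "\<exists>\<eta>\<in>test_functions. vd \<eta> = \<theta>"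
proof -
  obtain R where R: "\<And>x. R < \<bar>x\<bar> \<Longrightarrow> \<theta> x = 0"
    using \<theta> unfolding test_function_iff by blast
  have cont: "continuous_on S \<theta>" for S
    by (intro smooth_continuous test_smooth \<theta>)
  \<comment> \<open>The extra unit makes the two cases for the derivative overlap:
    \<open>\<eta>\<close> vanishes left of \<open>- \<bar>R\<bar>\<close>, and the fundamental
    theorem applies right of \<open>a\<close>.\<close>
  define a where "a = - \<bar>R\<bar> - 1"
  define \<eta> where "\<eta> x = integral {a..x} \<theta>" for x
  have low: "\<eta> y = 0" if "y < - \<bar>R\<bar>" for y
  proof -
    have "integral {a..y} \<theta> = integral {a..y} (\<lambda>x. 0)"
      by (rule integral_cong) (use that R in auto)
    then show ?thesis by (simp add: \<eta>_def)
  qed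
  have D: "(\<eta> has_vector_derivative \<theta> x) (at x)" for x
  proof (cases "a < x")
    case True
    have "(\<eta> has_vector_derivative \<theta> x) (at x within {a..x + 1})"
      unfolding \<eta>_def by (rule integral_has_vector_derivative[OF cont]) (use True in auto)
    then show ?thesis
      using True by (simp add: at_within_Icc_at)
  next
    case False
    then have x: "x < - \<bar>R\<bar>" by (simp add: a_def)
    then have "\<theta> x = 0" using R by simp
    moreover have "(\<eta> has_vector_derivative 0) (at x)"
      by (rule has_vector_derivative_transform_within_open[OF has_vector_derivative_const, where S = "{..< - \<bar>R\<bar>}"])
        (use x low in auto)
    ultimately show ?thesis by simp
  qed
  have vd: "vd \<eta> = \<theta>"
    by (rule ext) (rule vector_derivative_at[OF D])
  have "smooth \<eta>"
  proof (rule smooth_coinduct[where S = "insert \<eta> {f. smooth f}"])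
    fix f x assume "f \<in> insert \<eta> {f. smooth f}"
    then show "f differentiable (at x)"
      using differentiableI_vector[OF D] smooth_differentiable by auto
  next
    fix f assume "f \<in> insert \<eta> {f. smooth f}"
    then show "vd f \<in> insert \<eta> {f. smooth f}"
      using vd test_smooth[OF \<theta>] smooth_vd by auto
  qed simp
  moreover have "\<eta> x = 0" if "\<bar>R\<bar> < \<bar>x\<bar>" for x
  proof (cases "x < 0")
    case True
    then show ?thesis using low that by auto
  next
    case False
    have I: "set_integrable lborel {a..x} \<theta>"
      unfolding set_integrable_def
      by (rule Bochner_Integration.integrable_bound[OF test_integrable[OF \<theta>]])
        (use smooth_measurable[OF test_smooth[OF \<theta>]] in \<open>auto simp: indicator_def\<close>)
    have "\<eta> x = (LINT y:{a..x}|lborel. \<theta> y)"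
      unfolding \<eta>_def by (rule set_borel_integral_eq_integral(2)[OF I, symmetric])
    also have "\<dots> = (LINT y|lborel. \<theta> y)"
      unfolding set_lebesgue_integral_def
    proof (rule Bochner_Integration.integral_cong)
      fix y
      show "indicat_real {a..x} y *\<^sub>R \<theta> y = \<theta> y"
        using R[of y] that False by (cases "y \<in> {a..x}") (auto simp: a_def)
    qed simp
    finally show ?thesis using zero by simp
  qed
  ultimately have "\<eta> \<in> test_functions"
    unfolding test_function_iff by blast
  then show ?thesis using vd by blast
qed

subsection \<open>Bump functions\<close>

text \<open>The powers in the denominator close the family under differentiation, up to polynomial
  factors. The parameter \<open>c\<close> lets bumps approach indicators: the exponential tends to 1
  as \<open>c\<close> grows.\<close>

definition flat :: "real \<Rightarrow> nat \<Rightarrow> real \<Rightarrow> real" where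
  "flat c k t = (if t > 0 then exp (- (1 / (c * t))) / t ^ k else 0)"

lemma flat_at_0:
  assumes "c > 0"
  shows "(flat c k \<longlongrightarrow> 0) (at 0)"
proof -
  have "((\<lambda>t. (inverse (c * t)) ^ k / exp (inverse (c * t))) \<longlongrightarrow> 0) (at_right 0)"
  proof (rule filterlim_compose[OF tendsto_power_div_exp_0])
    show "filterlim (\<lambda>t. inverse (c * t)) at_top (at_right 0)"
      using assms by real_asymp
  qed
  then have "((\<lambda>t. c ^ k * ((inverse (c * t)) ^ k / exp (inverse (c * t)))) \<longlongrightarrow> c ^ k * 0) (at_right 0)"
    by (rule tendsto_mult[OF tendsto_const])
  then have "(flat c k \<longlongrightarrow> c ^ k * 0) (at_right 0)"
  proof (rule Lim_transform_eventually)
    show "\<forall>\<^sub>F t in at_right 0. c ^ k * ((inverse (c * t)) ^ k / exp (inverse (c * t))) = flat c k t"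
      using eventually_at_right_less[of 0]
    proof eventually_elim
      case (elim t)
      then show ?case
        using assms by (simp add: flat_def exp_minus power_mult_distrib power_inverse field_simps)
    qed
  qed
  moreover have "(flat c k \<longlongrightarrow> 0) (at_left 0)"
  proof (rule Lim_transform_eventually[OF tendsto_const])
    show "\<forall>\<^sub>F t in at_left 0. 0 = flat c k t"
      by (simp add: eventually_at_filter flat_def)
  qed
  ultimately show ?thesis
    by (simp add: filterlim_split_at)
qed

text \<open>Coinduction over all polynomials \<open>P\<close> and all \<open>k\<close>, with
  \<open>c\<close> and \<open>q\<close> fixed: each differentiation raises \<open>k\<close> by 2 and
  replaces \<open>P\<close> by another polynomial.\<close>

lemma flat_product_smooth:
  assumes c: "c > 0" and P: "real_polynomial_function P" and q: "real_polynomial_function q"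
  shows "smooth (\<lambda>x. of_real (P x * flat c k (q x)))"
proof -
  obtain q' where q': "real_polynomial_function q'" "\<And>x. (q has_real_derivative q' x) (at x)"
    using has_real_derivative_polynomial_function[OF q] by blast
  let ?S = "{\<lambda>x. complex_of_real (P x * flat c k (q x)) | P k. real_polynomial_function P}"
  show ?thesis
  proof (rule smooth_coinduct[where S = ?S])
    fix f :: "real \<Rightarrow> complex"
    assume "f \<in> ?S"
    then obtain P k where f: "f = (\<lambda>x. of_real (P x * flat c k (q x)))" and P: "real_polynomial_function P"
      by blast
    obtain P' where P': "real_polynomial_function P'" "\<And>x. (P has_real_derivative P' x) (at x)"
      using has_real_derivative_polynomial_function[OF P] by blast
    \<comment> \<open>The numerator of the derivative over the common denominator
      \<open>q x ^ (k + 2)\<close>.\<close>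
    let ?N = "\<lambda>x. P' x * (q x * q x) + (P x * q' x * (1 / c) + - (real k * (P x * q' x * q x)))"
    have N: "real_polynomial_function ?N"
      by (intro real_polynomial_function.intros real_polynomial_function_minus P P' q q')
    have qc: "isCont q x" for x
      using q'(2) by (rule DERIV_isCont)
    have D: "((\<lambda>x. P x * flat c k (q x)) has_real_derivative ?N x * flat c (k + 2) (q x)) (at x)" for x
    proof -
      consider "q x > 0" | "q x < 0" | "q x = 0" by linarith
      then show ?thesis
      proof cases
        case 1
        have E: "((\<lambda>x. P x * (exp (- (1 / (c * q x))) / q x ^ k)) has_real_derivative ?N x * flat c (k + 2) (q x)) (at x)"
          using 1 c
          by (auto intro!: derivative_eq_intros P'(2) q'(2) simp: flat_def)
            (cases k; simp add: field_simps power2_eq_square)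
        have op: "open {x. 0 < q x}"
          using qc by (intro open_Collect_less continuous_on_const continuous_at_imp_continuous_on) auto
        show ?thesis
          by (rule has_field_derivative_transform_within_open[OF E op]) (use 1 in \<open>auto simp: flat_def\<close>)
      next
        case 2
        have op: "open {x. q x < 0}"
          using qc by (intro open_Collect_less continuous_on_const continuous_at_imp_continuous_on) auto
        have "((\<lambda>x. P x * flat c k (q x)) has_real_derivative 0) (at x)"
          by (rule has_field_derivative_transform_within_open[OF DERIV_const[of 0] op])
            (use 2 in \<open>auto simp: flat_def\<close>)
        with 2 show ?thesis by (simp add: flat_def)
      next
        case 3
        \<comment> \<open>At a zero of \<open>q\<close> one factor \<open>q y\<close> is split off
          to form the difference quotient of \<open>q\<close>; the remaining factor
          \<open>flat c (k + 1) (q y)\<close> still tends to 0.\<close>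
        have fq: "flat c k t = t * flat c (k + 1) t" for t
          by (simp add: flat_def)
        have "((\<lambda>y. flat c (k + 1) (q y)) \<longlongrightarrow> 0) (at x)"
        proof -
          have "isCont (flat c (k + 1)) 0"
            using flat_at_0[OF c, of "k + 1"] by (simp add: isCont_def flat_def)
          then have "isCont (flat c (k + 1)) (q x)" by (simp add: 3)
          with qc have "isCont (\<lambda>y. flat c (k + 1) (q y)) x"
            by (rule isCont_o2)
          then show ?thesis by (simp add: isCont_def 3 flat_def)
        qed
        moreover have "((\<lambda>y. (q y - q x) / (y - x)) \<longlongrightarrow> q' x) (at x)"
          using q'(2)[of x] by (simp add: has_field_derivative_iff)
        moreover have "(P \<longlongrightarrow> P x) (at x)"
          using DERIV_isCont[OF P'(2)] by (simp add: isCont_def)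
        ultimately have lim: "((\<lambda>y. P y * ((q y - q x) / (y - x)) * flat c (k + 1) (q y)) \<longlongrightarrow> P x * q' x * 0) (at x)"
          by (intro tendsto_mult)
        have eq: "(P y * flat c k (q y) - P x * flat c k (q x)) / (y - x)
            = P y * ((q y - q x) / (y - x)) * flat c (k + 1) (q y)" for y
          using 3 by (simp add: fq[of "q y"] flat_def)
        have z: "?N x * flat c (k + 2) (q x) = P x * q' x * 0"
          using 3 by (simp add: flat_def)
        show ?thesis
          unfolding has_field_derivative_iff eq z by (rule lim)
      qed
    qed
    have Dc: "(f has_vector_derivative of_real (?N x * flat c (k + 2) (q x))) (at x)" for x
      unfolding f
      by (rule bounded_linear.has_vector_derivative[OF bounded_linear_of_real])
        (use D[of x] in \<open>simp only: has_real_derivative_iff_has_vector_derivative\<close>)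
    show "f differentiable (at x)" for x
      using Dc by (rule differentiableI_vector)
    have "vd f = (\<lambda>x. of_real (?N x * flat c (k + 2) (q x)))"
      by (rule ext) (rule vector_derivative_at[OF Dc])
    then show "vd f \<in> ?S"
      by (intro CollectI exI[of _ ?N] exI[of _ "k + 2"] conjI N)
  next
    show "(\<lambda>x. complex_of_real (P x * flat c k (q x))) \<in> ?S"
      by (intro CollectI exI[of _ P] exI[of _ k] conjI refl P)
  qed
qed

definition bump :: "real \<Rightarrow> real \<Rightarrow> real \<Rightarrow> real \<Rightarrow> complex" where
  "bump a b c x = of_real (flat c 0 ((x - a) * (b - x)))"

lemma bump_test:
  assumes "c > 0"
  shows "bump a b c \<in> test_functions"
proof -
  have q: "real_polynomial_function (\<lambda>x. (x - a) * (b - x))"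
    by (intro real_polynomial_function_diff real_polynomial_function.intros bounded_linear_ident)
  have "smooth (\<lambda>x. of_real (1 * flat c 0 ((x - a) * (b - x))))"
    by (rule flat_product_smooth[OF assms real_polynomial_function.intros(2) q])
  then have "smooth (bump a b c)"
    by (simp add: bump_def[abs_def])
  moreover have "bump a b c x = 0" if "\<bar>a\<bar> + \<bar>b\<bar> < \<bar>x\<bar>" for x
  proof -
    have "(x - a) * (b - x) \<le> 0"
    proof (cases "0 \<le> x")
      case True
      then show ?thesis using that by (intro mult_nonneg_nonpos) auto
    next
      case False
      then show ?thesis using that by (intro mult_nonpos_nonneg) auto
    qed
    then show ?thesis by (simp add: bump_def flat_def)
  qed
  ultimately show ?thesis
    unfolding test_function_iff by blast
qed

lemma integral_bump_nonzero: "(LINT x|lborel. bump 0 1 1 x) \<noteq> 0"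
proof
  let ?g = "\<lambda>x. flat 1 0 (x * (1 - x))"
  assume "(LINT x|lborel. bump 0 1 1 x) = 0"
  then have "complex_of_real (LINT x|lborel. ?g x) = 0"
    by (simp add: bump_def)
  moreover have "integrable lborel (\<lambda>x. complex_of_real (?g x))"
    using test_integrable[OF bump_test[of 1 0 1]] by (simp add: bump_def[abs_def])
  then have "integrable lborel ?g"
    by (simp add: complex_of_real_integrable_eq)
  moreover have "AE x in lborel. 0 \<le> ?g x"
    by (simp add: flat_def)
  ultimately have "AE x in lborel. ?g x = 0"
    by (simp add: integral_nonneg_eq_0_iff_AE)
  then have "AE x in lborel. x \<notin> {0<..<1::real}"
    by eventually_elim (auto simp: flat_def split: if_splits)
  then have "emeasure lborel {0<..<1::real} = 0"
    by (subst (asm) AE_iff_measurable[where N = "{0<..<1}"]) auto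
  then show False by simp
qed

lemma tendsto_bump:
  assumes "a < b"
  shows "(\<lambda>n. bump a b (real (Suc n)) x) \<longlonglongrightarrow> indicator {a<..<b} x"
proof (cases "a < x \<and> x < b")
  case True
  then have q: "(x - a) * (b - x) > 0" by simp
  have "(\<lambda>n. exp (- (inverse (real (Suc n)) * (1 / ((x - a) * (b - x)))))) \<longlonglongrightarrow> exp (- (0 * (1 / ((x - a) * (b - x)))))"
    by (intro tendsto_exp tendsto_minus tendsto_mult LIMSEQ_inverse_real_of_nat tendsto_const)
  then have "(\<lambda>n. complex_of_real (exp (- (inverse (real (Suc n)) * (1 / ((x - a) * (b - x))))))) \<longlonglongrightarrow> of_real (exp (- (0 * (1 / ((x - a) * (b - x))))))"
    by (rule tendsto_of_real)
  moreover have "bump a b (real (Suc n)) x = of_real (exp (- (inverse (real (Suc n)) * (1 / ((x - a) * (b - x))))))" for n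
    using q by (simp add: bump_def flat_def divide_inverse mult.commute)
  ultimately show ?thesis
    using True by simp
next
  case False
  then have "(x - a) * (b - x) \<le> 0"
  proof (cases "x \<le> a")
    case True
    then show ?thesis using assms by (intro mult_nonpos_nonneg) auto
  next
    case F: False
    then show ?thesis using False by (intro mult_nonneg_nonpos) auto
  qed
  then have "bump a b c x = 0" for c
    by (simp add: bump_def flat_def)
  then show ?thesis
    using False by auto
qed

section \<open>Locally square-integrable functions with vanishing distributional derivative\<close>

lemma integrable_local_test:
  assumes "\<And>R. (\<lambda>x. indicator {-R..R} x * w x) \<in> L2" "\<phi> \<in> test_functions"
  shows "integrable lborel (\<lambda>x. w x * \<phi> x)"
proof -
  obtain R C where RC: "\<And>x. norm (\<phi> x) \<le> C * indicator {-R..R} x"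
    using test_bounded[OF assms(2)] by blast
  have "w x * \<phi> x = (indicator {-R..R} x * w x) * \<phi> x" for x
    using RC[of x] by (cases "x \<in> {-R..R}") auto
  then have eq: "(\<lambda>x. w x * \<phi> x) = (\<lambda>x. (indicator {-R..R} x * w x) * \<phi> x)"
    by (rule ext)
  show ?thesis
    unfolding eq by (rule L2_mult_integrable[OF assms(1) test_L2[OF assms(2)]])
qed

text \<open>The lemma of du Bois-Reymond. Subtracting a multiple of one fixed bump turns any test
  function into the derivative of a test function, so \<open>w - c\<close> annihilates all test
  functions; it then annihilates intervals, as limits of bumps, and locally vanishes by
  density.\<close>

lemma distrib_const:
  fixes w :: "real \<Rightarrow> complex"
  assumes w [measurable]: "w \<in> borel_measurable borel"
    and loc: "\<And>R. (\<lambda>x. indicator {-R..R} x * w x) \<in> L2"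
    and zero: "\<And>h. h \<in> test_functions \<Longrightarrow> (LINT x|lborel. w x * vd h x) = 0"
  shows "\<exists>c. AE x in lborel. w x = c"
proof -
  note int = integrable_local_test[OF loc]
  let ?\<phi>0 = "bump 0 1 1"
  define I0 where "I0 = (LINT x|lborel. ?\<phi>0 x)"
  have I0: "I0 \<noteq> 0"
    unfolding I0_def by (rule integral_bump_nonzero)
  have \<phi>0: "?\<phi>0 \<in> test_functions"
    by (rule bump_test) simp
  \<comment> \<open>The only candidate: with it \<open>w - c\<close> annihilates the fixed bump
    \<open>?\<phi>0\<close>.\<close>
  define c where "c = (LINT x|lborel. w x * ?\<phi>0 x) / I0"
  define v where "v x = w x - c" for x
  have v_meas [measurable]: "v \<in> borel_measurable borel"
    unfolding v_def[abs_def] by measurable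
  have indL2: "(indicator {-R..R} :: real \<Rightarrow> complex) \<in> L2" for R
    by (rule L2_indicator_subset[of _ "-R" R]) auto
  have vloc: "(\<lambda>x. indicator {-R..R} x * v x) \<in> L2" for R
    using L2_diff[OF loc[of R] L2_cmult[OF indL2[of R], of c]] by (simp add: v_def algebra_simps)
  have vtest: "(LINT x|lborel. v x * \<phi> x) = 0" if \<phi>: "\<phi> \<in> test_functions" for \<phi>
  proof -
    \<comment> \<open>Chosen to give the test function \<open>\<phi> + d * ?\<phi>0\<close> integral
      0, so that it has an antiderivative among the test functions.\<close>
    define d where "d = - ((LINT x|lborel. \<phi> x) / I0)"
    have T: "(\<lambda>x. 1 * \<phi> x + d * ?\<phi>0 x) \<in> test_functions"
      by (rule test_lincomb[OF \<phi> \<phi>0])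
    have "(LINT x|lborel. 1 * \<phi> x + d * ?\<phi>0 x) = (LINT x|lborel. \<phi> x) + d * I0"
      using test_integrable[OF \<phi>] test_integrable[OF \<phi>0] by (simp add: I0_def)
    also have "\<dots> = 0" using I0 by (simp add: d_def)
    finally obtain h where h: "h \<in> test_functions" "vd h = (\<lambda>x. 1 * \<phi> x + d * ?\<phi>0 x)"
      using test_antiderivative[OF T] by blast
    have "0 = (LINT x|lborel. w x * vd h x)"
      using zero[OF h(1)] by simp
    also have "\<dots> = (LINT x|lborel. w x * \<phi> x + d * (w x * ?\<phi>0 x))"
      by (simp only: fun_cong[OF h(2)]) (simp add: algebra_simps)
    also have "\<dots> = (LINT x|lborel. w x * \<phi> x) + d * (LINT x|lborel. w x * ?\<phi>0 x)"
      using int[OF \<phi>] int[OF \<phi>0] by simp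
    also have "d * (LINT x|lborel. w x * ?\<phi>0 x) = - c * (LINT x|lborel. \<phi> x)"
      by (simp add: d_def c_def)
    finally have "(LINT x|lborel. w x * \<phi> x) - c * (LINT x|lborel. \<phi> x) = 0" by simp
    moreover have "(LINT x|lborel. v x * \<phi> x) = (LINT x|lborel. w x * \<phi> x) - c * (LINT x|lborel. \<phi> x)"
      using int[OF \<phi>] test_integrable[OF \<phi>] by (simp add: v_def left_diff_distrib)
    ultimately show ?thesis by simp
  qed
  have vIoo: "(LINT x|lborel. v x * indicator {a<..<b} x) = 0" if ab: "a < b" for a b
  proof -
    define R where "R = \<bar>a\<bar> + \<bar>b\<bar>"
    have "(\<lambda>n. LINT x|lborel. v x * bump a b (real (Suc n)) x) \<longlonglongrightarrow> (LINT x|lborel. v x * indicator {a<..<b} x)"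
    proof (rule integral_dominated_convergence[where w = "\<lambda>x. norm (indicator {-R..R} x * v x * indicator {-R..R} x)"])
      show "integrable lborel (\<lambda>x. norm (indicator {-R..R} x * v x * indicator {-R..R} x))"
        by (intro integrable_norm L2_mult_integrable vloc indL2)
      show "AE x in lborel. (\<lambda>n. v x * bump a b (real (Suc n)) x) \<longlonglongrightarrow> v x * indicator {a<..<b} x"
        by (intro AE_I2 tendsto_mult tendsto_const tendsto_bump ab)
      show "AE x in lborel. norm (v x * bump a b (real (Suc n)) x) \<le> norm (indicator {-R..R} x * v x * indicator {-R..R} x)" for n
      proof (rule AE_I2)
        fix x
        show "norm (v x * bump a b (real (Suc n)) x) \<le> norm (indicator {-R..R} x * v x * indicator {-R..R} x)"
        proof (cases "(x - a) * (b - x) > 0")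
          case True
          then have "x \<in> {-R..R}"
            using ab unfolding zero_less_mult_iff R_def by auto
          moreover have "norm (bump a b (real (Suc n)) x) \<le> 1"
            using True by (simp add: bump_def flat_def)
          ultimately show ?thesis
            by (simp add: norm_mult mult_left_le)
        next
          case False
          then show ?thesis by (simp add: bump_def flat_def)
        qed
      qed
      show "(\<lambda>x. v x * bump a b (real (Suc n)) x) \<in> borel_measurable lborel" for n
        using smooth_measurable[OF test_smooth[OF bump_test[of "real (Suc n)" a b]]] by simp
    qed measurable
    moreover have "(LINT x|lborel. v x * bump a b (real (Suc n)) x) = 0" for n
      by (rule vtest[OF bump_test]) simp
    ultimately show ?thesis
      by (simp add: LIMSEQ_const_iff)
  qed
  have "AE x in lborel. indicator {-R..R} x * v x = 0" for R
  proof -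
    \<comment> \<open>The cut-off of \<open>v\<close> is in \<open>L2\<close> and orthogonal to
      every interval, hence to everything, including itself.\<close>
    define y where "y = abs_l2 (\<lambda>x. indicator {-R..R} x * v x)"
    have zero_l2: "x \<in> {x. cint x y = 0}" for x
    proof (rule l2_induct)
      show "closed {x. cint x y = 0}"
        unfolding closed_sequential_limits
      proof (intro allI impI, elim conjE)
        fix f l assume f: "\<forall>n. f n \<in> {x. cint x y = 0}" "f \<longlonglongrightarrow> l"
        from tendsto_cint[OF f(2) tendsto_const[of y]] f(1) show "l \<in> {x. cint x y = 0}"
          by (simp add: LIMSEQ_const_iff)
      qed
      show "subspace {x. cint x y = 0}"
        by (auto simp: subspace_def cint_add_left cint_scaleR_left)
      show "bmul (\<lambda>t. \<i>) x \<in> {x. cint x y = 0}" if "x \<in> {x. cint x y = 0}" for x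
        using that by (simp add: cint_bmul_const_left)
      fix a b
      define a' b' where "a' = max a (-R)" and "b' = min b R"
      have "cint (ivl a b) y = (LINT x|lborel. cnj (indicator {a<..b} x) * (indicator {-R..R} x * v x))"
        unfolding ivl_def y_def by (rule cint_abs[OF L2_Ioc vloc])
      also have "\<dots> = (LINT x|lborel. v x * indicator {a'<..<b'} x)"
      proof (rule integral_cong_AE)
        show "AE x in lborel. cnj (indicator {a<..b} x) * (indicator {-R..R} x * v x) = v x * indicator {a'<..<b'} x"
          using AE_lborel_singleton[of a'] AE_lborel_singleton[of b']
          by eventually_elim (auto simp: indicator_def a'_def b'_def)
      qed measurable
      also have "\<dots> = 0"
      proof (cases "a' < b'")
        case False
        then show ?thesis by simp
      qed (rule vIoo)
      finally show "ivl a b \<in> {x. cint x y = 0}" by simp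
    qed
    then have "cint y y = 0" by blast
    then have y0: "y = 0" by (simp add: cint_self')
    show ?thesis
      using rep_abs[OF vloc[of R], folded y_def, unfolded y0] rep_zero by eventually_elim simp
  qed
  then have "AE x in lborel. \<forall>n. indicator {-real n..real n} x * v x = 0"
    unfolding AE_all_countable by (rule allI)
  then have "AE x in lborel. w x = c"
  proof eventually_elim
    case (elim x)
    obtain n where "\<bar>x\<bar> < real n" using reals_Archimedean2 by blast
    then have "x \<in> {-real n..real n}" by auto
    with elim[rule_format, of n] show ?case
      by (simp add: v_def)
  qed
  then show ?thesis ..
qed


section \<open>The Volterra operator\<close>

definition vker :: "l2 \<Rightarrow> (real \<Rightarrow> real set) \<Rightarrow> l2 \<Rightarrow> real \<Rightarrow> complex" where
  "vker \<alpha> Q g x = cint (bmul (indicator (Q x)) \<alpha>) g"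

definition vop :: "l2 \<Rightarrow> (real \<Rightarrow> real set) \<Rightarrow> l2 \<Rightarrow> l2" where
  "vop \<alpha> Q g = abs_l2 (\<lambda>x. \<i> * vker \<alpha> Q g x * rep_l2 \<alpha> x)"

text \<open>\<open>Q x\<close> is the set over which the kernel is integrated at \<open>x\<close>; the Volterra operator is the case
  \<open>Q = lessThan\<close>.\<close>

definition msets :: "(real \<Rightarrow> real set) \<Rightarrow> bool" where
  "msets Q \<longleftrightarrow> {p. snd p \<in> Q (fst p)} \<in> sets (borel \<Otimes>\<^sub>M borel)"

lemma msetsI:
  "{p \<in> space (borel \<Otimes>\<^sub>M borel). snd p \<in> Q (fst p)} \<in> sets (borel \<Otimes>\<^sub>M borel) \<Longrightarrow> msets Q"
  by (simp add: msets_def space_pair_measure)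

lemma msets_lessThan: "msets lessThan"
  by (rule msetsI) (simp only: lessThan_iff, measurable)

lemma msets_section: "msets Q \<Longrightarrow> Q x \<in> sets borel"
proof -
  assume "msets Q"
  then have "Pair x -` {p. snd p \<in> Q (fst p)} \<in> sets borel"
    unfolding msets_def by (rule sets_Pair1)
  then show ?thesis by (simp add: vimage_def)
qed

lemma cint_indicator:
  assumes "A \<in> sets borel"
  shows "cint (bmul (indicator A) \<alpha>) g = (LINT y|lborel. indicator A y * (cnj (rep_l2 \<alpha> y) * rep_l2 g y))"
proof -
  have "cint (bmul (indicator A) \<alpha>) g = (LINT y|lborel. cnj (indicator A y * rep_l2 \<alpha> y) * rep_l2 g y)"
    by (rule cint_AE_cong[OF rep_bmul]) (use assms in auto)
  then show ?thesis by (simp add: mult_ac)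
qed

text \<open>Joint measurability of the sections makes the parameter integral measurable in
  \<open>x\<close>, and Cauchy-Schwarz bounds it uniformly; so \<open>vop\<close> multiplies
  \<open>\<alpha>\<close> by a bounded function.\<close>

lemma vker_bmeas:
  assumes "msets Q"
  shows "bmeas (vker \<alpha> Q g)"
proof (rule bmeasI)
  have [measurable]: "{p. snd p \<in> Q (fst p)} \<in> sets (borel \<Otimes>\<^sub>M borel)"
    using assms by (simp add: msets_def)
  have "vker \<alpha> Q g = (\<lambda>x. LINT y|lborel. indicator {p. snd p \<in> Q (fst p)} (x, y) * (cnj (rep_l2 \<alpha> y) * rep_l2 g y))"
    unfolding vker_def cint_indicator[OF msets_section[OF assms]] by (simp add: indicator_def)
  also have "\<dots> \<in> borel_measurable borel"
    by measurable
  finally show "vker \<alpha> Q g \<in> borel_measurable borel" .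
  show "norm (vker \<alpha> Q g x) \<le> norm \<alpha> * norm g" for x
  proof -
    have "norm (vker \<alpha> Q g x) \<le> norm (bmul (indicator (Q x)) \<alpha>) * norm g"
      unfolding vker_def by (rule norm_cint_le)
    also have "\<dots> \<le> (1 * norm \<alpha>) * norm g"
      by (intro mult_right_mono norm_bmul_le bmeas_indicator msets_section assms)
        (auto simp: indicator_def)
    finally show ?thesis by simp
  qed
qed

lemma vop_L2: "msets Q \<Longrightarrow> (\<lambda>x. \<i> * vker \<alpha> Q g x * rep_l2 \<alpha> x) \<in> L2"
  by (intro L2_bmul bmeas_mult bmeas_const vker_bmeas rep_L2)

lemma rep_vop: "msets Q \<Longrightarrow> AE x in lborel. rep_l2 (vop \<alpha> Q g) x = \<i> * vker \<alpha> Q g x * rep_l2 \<alpha> x"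
  unfolding vop_def by (intro rep_abs vop_L2)

lemma linear_vop:
  assumes "msets Q"
  shows "linear (vop \<alpha> Q)"
proof (rule linearI)
  fix g h r
  show "vop \<alpha> Q (g + h) = vop \<alpha> Q g + vop \<alpha> Q h"
    unfolding vop_def abs_add[OF vop_L2[OF assms] vop_L2[OF assms], symmetric]
    by (simp add: vker_def cint_add_right algebra_simps)
  have "(\<lambda>x. \<i> * vker \<alpha> Q (r *\<^sub>R g) x * rep_l2 \<alpha> x) = (\<lambda>x. r *\<^sub>R (\<i> * vker \<alpha> Q g x * rep_l2 \<alpha> x))"
    by (simp add: vker_def cint_scaleR_right scaleR_conv_of_real mult_ac)
  then show "vop \<alpha> Q (r *\<^sub>R g) = r *\<^sub>R vop \<alpha> Q g"
    unfolding vop_def by (simp only: abs_scaleR[OF vop_L2[OF assms]])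
qed

text \<open>The factor \<open>d\<close> sees only the portions of \<open>\<alpha>\<close> over the
  sections \<open>Q x\<close>; this is what makes the part of the kernel near the diagonal
  small.\<close>

lemma norm_vop_le:
  assumes "msets Q" and d: "\<And>x. norm (bmul (indicator (Q x)) \<alpha>) \<le> d"
  shows "norm (vop \<alpha> Q g) \<le> d * norm \<alpha> * norm g"
proof -
  have "vop \<alpha> Q g = bmul (\<lambda>x. \<i> * vker \<alpha> Q g x) \<alpha>"
    unfolding vop_def bmul_def ..
  also have "norm \<dots> \<le> (d * norm g) * norm \<alpha>"
  proof (rule norm_bmul_le)
    show "bmeas (\<lambda>x. \<i> * vker \<alpha> Q g x)"
      by (intro bmeas_mult bmeas_const vker_bmeas assms(1))
    show "norm (\<i> * vker \<alpha> Q g x) \<le> d * norm g" for x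
    proof -
      have "norm (vker \<alpha> Q g x) \<le> norm (bmul (indicator (Q x)) \<alpha>) * norm g"
        unfolding vker_def by (rule norm_cint_le)
      also have "\<dots> \<le> d * norm g"
        by (intro mult_right_mono d norm_ge_zero)
      finally show ?thesis by (simp add: norm_mult)
    qed
  qed
  finally show ?thesis by (simp add: mult_ac)
qed

lemma bmul_indicator_Un:
  assumes "A \<in> sets borel" "B \<in> sets borel" "A \<inter> B = {}"
  shows "bmul (indicator (A \<union> B)) \<alpha> = bmul (indicator A) \<alpha> + bmul (indicator B) \<alpha>"
proof (rule l2_eqI)
  have AB: "A \<union> B \<in> sets borel" using assms by simp
  show "AE t in lborel. rep_l2 (bmul (indicator (A \<union> B)) \<alpha>) t = rep_l2 (bmul (indicator A) \<alpha> + bmul (indicator B) \<alpha>) t"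
    using rep_bmul[OF bmeas_indicator[OF assms(1)], of \<alpha>] rep_bmul[OF bmeas_indicator[OF assms(2)], of \<alpha>]
      rep_bmul[OF bmeas_indicator[OF AB], of \<alpha>] rep_plus[of "bmul (indicator A) \<alpha>" "bmul (indicator B) \<alpha>"]
    by eventually_elim (use assms(3) in \<open>auto simp: indicator_def\<close>)
qed

lemma norm_bmul_indicator_Un:
  assumes "A \<in> sets borel" "B \<in> sets borel" "A \<inter> B = {}"
  shows "(norm (bmul (indicator (A \<union> B)) \<alpha>))\<^sup>2 = (norm (bmul (indicator A) \<alpha>))\<^sup>2 + (norm (bmul (indicator B) \<alpha>))\<^sup>2"
proof -
  have "cint (bmul (indicator A) \<alpha>) (bmul (indicator B) \<alpha>)
      = (LINT y|lborel. indicator A y * (cnj (rep_l2 \<alpha> y) * rep_l2 (bmul (indicator B) \<alpha>) y))"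
    by (rule cint_indicator[OF assms(1)])
  also have "\<dots> = (LINT y|(lborel :: real measure). (0::complex))"
  proof (rule integral_cong_AE)
    show "AE y in lborel. indicator A y * (cnj (rep_l2 \<alpha> y) * rep_l2 (bmul (indicator B) \<alpha>) y) = 0"
      using rep_bmul[OF bmeas_indicator[OF assms(2)], of \<alpha>]
      by eventually_elim (use assms(3) in \<open>auto simp: indicator_def\<close>)
  qed (use assms in measurable)
  finally have "inner (bmul (indicator A) \<alpha>) (bmul (indicator B) \<alpha>) = 0"
    by (simp add: inner_l2_def)
  then show ?thesis
    unfolding bmul_indicator_Un[OF assms] by (simp add: norm_add_Pythagorean orthogonal_def)
qed

lemma norm_bmul_indicator_mono:
  assumes "A \<in> sets borel" "B \<in> sets borel" "A \<subseteq> B"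
  shows "(norm (bmul (indicator A) \<alpha>))\<^sup>2 \<le> (norm (bmul (indicator B) \<alpha>))\<^sup>2"
proof -
  have "B = A \<union> (B - A)" using assms(3) by auto
  then show ?thesis
    using norm_bmul_indicator_Un[of A "B - A" \<alpha>] assms by auto
qed

text \<open>The squared norm of \<open>\<alpha>\<close> to the left of \<open>x\<close>. Its values
  cut the line into cells carrying equally bounded portions of \<open>\<alpha>\<close>.\<close>

definition mass :: "l2 \<Rightarrow> real \<Rightarrow> real" where
  "mass \<alpha> x = (norm (bmul (indicator {..<x}) \<alpha>))\<^sup>2"

lemma mass_mono: "x \<le> y \<Longrightarrow> mass \<alpha> x \<le> mass \<alpha> y"
  unfolding mass_def by (rule norm_bmul_indicator_mono) auto

lemma mass_nonneg: "0 \<le> mass \<alpha> x"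
  by (simp add: mass_def)

lemma mass_le: "mass \<alpha> x \<le> (norm \<alpha>)\<^sup>2"
proof -
  have "norm (bmul (indicator {..<x}) \<alpha>) \<le> 1 * norm \<alpha>"
    by (rule norm_bmul_le) (auto simp: indicator_def)
  then show ?thesis
    unfolding mass_def by (intro power_mono) auto
qed

lemma mass_tendsto:
  assumes "AE t in lborel. (\<lambda>n. indicator {..<z n} t :: complex) \<longlonglongrightarrow> indicator A t" "A \<in> sets borel"
  shows "(\<lambda>n. mass \<alpha> (z n)) \<longlonglongrightarrow> (norm (bmul (indicator A) \<alpha>))\<^sup>2"
proof -
  have "(\<lambda>n. abs_l2 (\<lambda>t. indicator {..<z n} t * rep_l2 \<alpha> t)) \<longlonglongrightarrow> abs_l2 (\<lambda>t. indicator A t * rep_l2 \<alpha> t)"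
  proof (rule l2_dominated_convergence(3)[where g = "rep_l2 \<alpha>"])
    show "AE t in lborel. (\<lambda>n. indicator {..<z n} t * rep_l2 \<alpha> t) \<longlonglongrightarrow> indicator A t * rep_l2 \<alpha> t"
      using assms(1) by eventually_elim (rule tendsto_mult[OF _ tendsto_const])
    show "AE t in lborel. norm (indicator {..<z n} t * rep_l2 \<alpha> t) \<le> norm (rep_l2 \<alpha> t)" for n
      by (auto simp: indicator_def)
  qed (use assms(2) in auto)
  then show ?thesis
    unfolding mass_def bmul_def by (intro tendsto_power tendsto_norm)
qed

lemma mass_continuous: "isCont (mass \<alpha>) x"
  unfolding continuous_at_sequentially
proof (intro allI impI)
  fix z assume z: "z \<longlonglongrightarrow> x"
  have "AE t in lborel. (\<lambda>n. indicator {..<z n} t :: complex) \<longlonglongrightarrow> indicator {..<x} t"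
    using AE_lborel_singleton[of x]
  proof eventually_elim
    case (elim t)
    have "\<forall>\<^sub>F n in sequentially. indicator {..<x} t = (indicator {..<z n} t :: complex)"
    proof (cases "t < x")
      case True
      from order_tendstoD(1)[OF z this] show ?thesis
        by eventually_elim (use True in \<open>simp add: indicator_def\<close>)
    next
      case False
      then have "x < t" using elim by simp
      from order_tendstoD(2)[OF z this] show ?thesis
        by eventually_elim (use \<open>x < t\<close> in \<open>simp add: indicator_def\<close>)
    qed
    then show ?case by (rule Lim_transform_eventually[OF tendsto_const])
  qed
  from mass_tendsto[OF this] show "(mass \<alpha> \<circ> z) \<longlonglongrightarrow> mass \<alpha> x"
    by (simp add: o_def mass_def[of _ x])
qed

lemma mass_small:
  assumes "0 < c"
  shows "\<exists>z. mass \<alpha> z < c"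
proof -
  have "AE t in lborel. (\<lambda>n. indicator {..< - real n} t :: complex) \<longlonglongrightarrow> indicator {} t"
  proof (rule AE_I2)
    fix t
    obtain N where N: "- t < real N" using reals_Archimedean2 by blast
    have "\<forall>\<^sub>F n in sequentially. indicator {} t = (indicator {..< - real n} t :: complex)"
      using eventually_ge_at_top[of N] by eventually_elim (use N in \<open>auto simp: indicator_def\<close>)
    then show "(\<lambda>n. indicator {..< - real n} t :: complex) \<longlonglongrightarrow> indicator {} t"
      by (rule Lim_transform_eventually[OF tendsto_const])
  qed
  from mass_tendsto[OF this, of \<alpha>] have "(\<lambda>n. mass \<alpha> (- real n)) \<longlonglongrightarrow> (norm (bmul (indicator {}) \<alpha>))\<^sup>2" by simp
  moreover have "bmul (indicator {}) \<alpha> = 0"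
    by (simp add: bmul_def zero_l2_def)
  ultimately have "(\<lambda>n. mass \<alpha> (- real n)) \<longlonglongrightarrow> 0" by simp
  from order_tendstoD(2)[OF this assms] show ?thesis
    unfolding eventually_sequentially by blast
qed

lemma mass_measurable [measurable]: "mass \<alpha> \<in> borel_measurable borel"
  by (intro borel_measurable_continuous_onI continuous_at_imp_continuous_on ballI mass_continuous)

text \<open>By continuity \<open>mass \<alpha>\<close> takes each value \<open>d\<close> with
  \<open>0 < d < c\<close> at some \<open>t\<close>, and the half-line left of \<open>t\<close> lies
  in the sublevel set. Approaching \<open>c\<close> through such \<open>d\<close> avoids locating
  the end of the sublevel set.\<close>

lemma sublevel_mass:
  assumes "c \<le> mass \<alpha> x"
  shows "c \<le> (norm (bmul (indicator {y. mass \<alpha> y < c}) \<alpha>))\<^sup>2"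
proof (rule dense_le)
  fix d assume d: "d < c"
  have S: "{y. mass \<alpha> y < c} \<in> sets borel" by measurable
  show "d \<le> (norm (bmul (indicator {y. mass \<alpha> y < c}) \<alpha>))\<^sup>2"
  proof (cases "d \<le> 0")
    case True
    then show ?thesis by (rule order_trans) simp
  next
    case False
    then obtain z where z: "mass \<alpha> z < d"
      using mass_small[of d \<alpha>] by auto
    have "z \<le> x"
    proof (rule ccontr)
      assume "\<not> z \<le> x"
      then have "mass \<alpha> x \<le> mass \<alpha> z" by (intro mass_mono) simp
      then show False using z d assms by linarith
    qed
    have "\<exists>t\<ge>z. t \<le> x \<and> mass \<alpha> t = d"
    proof (rule IVT)
      show "\<forall>t. z \<le> t \<and> t \<le> x \<longrightarrow> isCont (mass \<alpha>) t"
        by (intro allI impI mass_continuous)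
    qed (use z d assms \<open>z \<le> x\<close> in simp_all)
    then obtain t where t: "mass \<alpha> t = d" by (elim exE conjE)
    have "{..<t} \<subseteq> {y. mass \<alpha> y < c}"
    proof
      fix y assume "y \<in> {..<t}"
      then have "mass \<alpha> y \<le> d"
        using mass_mono[of y t \<alpha>] t by simp
      then show "y \<in> {y. mass \<alpha> y < c}" using d by simp
    qed
    from norm_bmul_indicator_mono[OF _ S this, of \<alpha>]
    show ?thesis
      unfolding mass_def[of \<alpha> t, symmetric] t by simp
  qed
qed

lemma bmul_const_span: "bmul (\<lambda>t. c) v \<in> span {v, bmul (\<lambda>t. \<i>) v}"
  unfolding bmul_const_eq[of c] by (simp add: span_add span_scale span_base)

text \<open>The kernel restricted to pairs of points in one cell of a partition into cells of small
  mass has small norm; the rest of the kernel has finite rank.\<close>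

lemma volterra_solvable:
  assumes inj: "\<And>f. f = vop \<alpha> lessThan (proj f) \<Longrightarrow> f = 0"
  shows "\<exists>f. f = y + vop \<alpha> lessThan (proj f)"
proof -
  \<comment> \<open>Makes \<open>sqrt \<delta> * norm \<alpha>\<close> at most 1/2, the contraction
    constant used at the end; the summand 1 covers \<open>\<alpha> = 0\<close>.\<close>
  define \<delta> where "\<delta> = 1 / (4 * ((norm \<alpha>)\<^sup>2 + 1))"
  have pos: "(norm \<alpha>)\<^sup>2 + 1 > 0"
    by (rule add_nonneg_pos) auto
  have \<delta>: "\<delta> > 0" "\<delta> * (norm \<alpha>)\<^sup>2 \<le> (1 / 2)\<^sup>2"
    using pos by (auto simp: \<delta>_def divide_simps power2_eq_square)
  \<comment> \<open>The number of the cell containing \<open>x\<close>. It is nondecreasing and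
    takes finitely many values, at most \<open>N\<close>.\<close>
  define n where "n x = nat \<lfloor>mass \<alpha> x / \<delta>\<rfloor>" for x
  define N where "N = nat \<lfloor>(norm \<alpha>)\<^sup>2 / \<delta>\<rfloor>"
  have n_meas [measurable]: "n \<in> measurable borel (count_space UNIV)"
    unfolding n_def[abs_def] by measurable
  define r where "r x = real (n x)" for x
  have r_meas [measurable]: "r \<in> borel_measurable borel"
    unfolding r_def[abs_def] by measurable
  have n_r: "n y = n x \<longleftrightarrow> r y = r x" "n y < n x \<longleftrightarrow> r y < r x" for x y
    by (simp_all add: r_def)
  have n_mono: "x \<le> x' \<Longrightarrow> n x \<le> n x'" for x x'
    unfolding n_def using \<delta>(1) by (intro nat_mono floor_mono divide_right_mono mass_mono) auto
  have n_le: "n x \<le> N" for x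
    unfolding n_def N_def using \<delta>(1) by (intro nat_mono floor_mono divide_right_mono mass_le) auto
  have n_less: "n y < i \<longleftrightarrow> mass \<alpha> y < real i * \<delta>" for y i
  proof -
    have "n y < i \<longleftrightarrow> \<lfloor>mass \<alpha> y / \<delta>\<rfloor> < int i"
      unfolding n_def using \<delta>(1) mass_nonneg[of \<alpha> y] by (simp add: nat_less_iff)
    also have "\<dots> \<longleftrightarrow> mass \<alpha> y / \<delta> < real i"
      by (simp add: floor_less_iff)
    also have "\<dots> \<longleftrightarrow> mass \<alpha> y < real i * \<delta>"
      using \<delta>(1) by (simp add: pos_divide_less_eq)
    finally show ?thesis .
  qed
  \<comment> \<open>\<open>Q1 x\<close> is the part of the half-line left of \<open>x\<close> in the
    cell of \<open>x\<close>, and \<open>Q2 x\<close> the union of the earlier cells; as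
    \<open>n\<close> is monotone, these together make up the half-line.\<close>
  define Q1 where "Q1 x = {y. y < x \<and> n y = n x}" for x
  define Q2 where "Q2 x = {y. n y < n x}" for x
  have m1: "msets Q1"
    by (rule msetsI) (simp only: Q1_def mem_Collect_eq n_r, measurable)
  have m2: "msets Q2"
    by (rule msetsI) (simp only: Q2_def mem_Collect_eq n_r, measurable)
  have disj: "Q1 x \<inter> Q2 x = {}" for x
    by (auto simp: Q1_def Q2_def)
  have un: "{..<x} = Q1 x \<union> Q2 x" for x
  proof (intro set_eqI iffI)
    fix y assume "y \<in> {..<x}"
    then show "y \<in> Q1 x \<union> Q2 x"
      using n_mono[of y x] by (auto simp: Q1_def Q2_def)
  next
    fix y assume "y \<in> Q1 x \<union> Q2 x"
    then show "y \<in> {..<x}"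
      using n_mono[of x y] by (cases "x \<le> y") (auto simp: Q1_def Q2_def)
  qed
  have vop_split: "vop \<alpha> lessThan g = vop \<alpha> Q1 g + vop \<alpha> Q2 g" for g
  proof -
    have "vker \<alpha> lessThan g x = vker \<alpha> Q1 g x + vker \<alpha> Q2 g x" for x
      unfolding vker_def un bmul_indicator_Un[OF msets_section[OF m1] msets_section[OF m2] disj]
      by (rule cint_add_left)
    then show ?thesis
      unfolding vop_def abs_add[OF vop_L2[OF m1] vop_L2[OF m2], symmetric] by (simp add: algebra_simps)
  qed
  \<comment> \<open>The mass up to \<open>x\<close> is less than
    \<open>(n x + 1) * \<delta>\<close>, and the earlier cells already carry at least
    \<open>n x * \<delta>\<close>; at most \<open>\<delta>\<close> remains for
    \<open>Q1 x\<close>.\<close>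
  have cell: "norm (bmul (indicator (Q1 x)) \<alpha>) \<le> sqrt \<delta>" for x
  proof -
    have "mass \<alpha> x = (norm (bmul (indicator (Q1 x)) \<alpha>))\<^sup>2 + (norm (bmul (indicator (Q2 x)) \<alpha>))\<^sup>2"
      unfolding mass_def un by (rule norm_bmul_indicator_Un[OF msets_section[OF m1] msets_section[OF m2] disj])
    moreover have "real (n x) * \<delta> \<le> (norm (bmul (indicator (Q2 x)) \<alpha>))\<^sup>2"
    proof -
      have "\<not> n x < n x" by simp
      then have "real (n x) * \<delta> \<le> mass \<alpha> x"
        unfolding n_less by simp
      from sublevel_mass[OF this] show ?thesis
        unfolding Q2_def n_less .
    qed
    moreover have "mass \<alpha> x < real (Suc (n x)) * \<delta>"
      using n_less[of x "Suc (n x)"] by simp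
    ultimately have "(norm (bmul (indicator (Q1 x)) \<alpha>))\<^sup>2 \<le> \<delta>"
      by (simp add: algebra_simps)
    then show ?thesis
      by (rule real_le_rsqrt)
  qed
  define v where "v j = bmul (indicator {x. n x = j}) \<alpha>" for j
  \<comment> \<open>The coefficients are complex and \<open>span\<close> is real, so each generator
    comes with its multiple by \<open>\<i>\<close>.\<close>
  define B where "B = (\<Union>j\<in>{..N}. {v j, bmul (\<lambda>t. \<i>) (v j)})"
  have fr: "vop \<alpha> Q2 g \<in> span B" for g
  proof -
    \<comment> \<open>\<open>Q2 x\<close> depends on \<open>x\<close> only through its cell, so on
      cell \<open>j\<close> the operator multiplies \<open>\<alpha>\<close> by the constant
      \<open>c j\<close>.\<close>
    define c where "c j = \<i> * cint (bmul (indicator {y. n y < j}) \<alpha>) g" for j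
    have nj: "bmeas (indicator {x. n x = j})" for j
      by (rule bmeas_indicator) measurable
    have "vop \<alpha> Q2 g = (\<Sum>j\<in>{..N}. bmul (\<lambda>t. c j) (v j))"
    proof (rule l2_eqI)
      have "AE t in lborel. \<forall>j. rep_l2 (bmul (\<lambda>t. c j) (v j)) t = c j * rep_l2 (v j) t"
        unfolding AE_all_countable by (intro allI rep_bmul bmeas_const)
      moreover have "AE t in lborel. \<forall>j. rep_l2 (v j) t = indicator {x. n x = j} t * rep_l2 \<alpha> t"
        unfolding AE_all_countable v_def by (intro allI rep_bmul nj)
      ultimately show "AE t in lborel. rep_l2 (vop \<alpha> Q2 g) t = rep_l2 (\<Sum>j\<in>{..N}. bmul (\<lambda>t. c j) (v j)) t"
        using rep_vop[OF m2, of \<alpha> g] rep_sum[of "\<lambda>j. bmul (\<lambda>t. c j) (v j)" "{..N}"]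
      proof eventually_elim
        case (elim t)
        have "(\<Sum>j\<in>{..N}. rep_l2 (bmul (\<lambda>t. c j) (v j)) t) = (\<Sum>j\<in>{..N}. if j = n t then c j * rep_l2 \<alpha> t else 0)"
          using elim(1,2) by (intro sum.cong) (auto simp: indicator_def)
        also have "\<dots> = c (n t) * rep_l2 \<alpha> t"
          using n_le[of t] by (simp add: sum.delta)
        finally show ?case
          using elim(3,4) by (simp add: c_def vker_def Q2_def)
      qed
    qed
    also have "\<dots> \<in> span B"
    proof (rule span_sum)
      fix j assume "j \<in> {..N}"
      then have "{v j, bmul (\<lambda>t. \<i>) (v j)} \<subseteq> B"
        unfolding B_def by blast
      then show "bmul (\<lambda>t. c j) (v j) \<in> span B"
        using bmul_const_span span_mono by blast
    qed
    finally show ?thesis .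
  qed
  have lin_proj: "linear proj"
    using bounded_linear_proj by (rule bounded_linear.linear)
  have "\<exists>f. f = y + vop \<alpha> Q1 (proj f) + vop \<alpha> Q2 (proj f)"
  proof (rule finite_rank_perturbation_surj[where q = "1 / 2" and B = B])
    show "linear (\<lambda>f. vop \<alpha> Q1 (proj f))" "linear (\<lambda>f. vop \<alpha> Q2 (proj f))"
      using linear_compose[OF lin_proj linear_vop[OF m1]] linear_compose[OF lin_proj linear_vop[OF m2]]
      by (simp_all add: o_def)
    show "norm (vop \<alpha> Q1 (proj f)) \<le> 1 / 2 * norm f" for f
    proof -
      have "norm (vop \<alpha> Q1 (proj f)) \<le> sqrt \<delta> * norm \<alpha> * norm (proj f)"
        by (rule norm_vop_le[OF m1 cell])
      also have "\<dots> \<le> (1 / 2) * norm f"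
      proof (intro mult_mono norm_proj_le)
        have "(sqrt \<delta> * norm \<alpha>)\<^sup>2 \<le> (1 / 2)\<^sup>2"
          using \<delta> by (simp add: power_mult_distrib)
        then show "sqrt \<delta> * norm \<alpha> \<le> 1 / 2"
          by (rule power2_le_imp_le) simp
      qed auto
      finally show ?thesis .
    qed
    show "finite B" by (simp add: B_def)
    show "vop \<alpha> Q2 (proj f) \<in> span B" for f by (rule fr)
    show "f = 0" if "f = vop \<alpha> Q1 (proj f) + vop \<alpha> Q2 (proj f)" for f
      using that by (intro inj) (simp add: vop_split)
  qed auto
  then show ?thesis
    by (simp add: vop_split add.assoc)
qed

lemma vker_lessThan: "vker \<alpha> lessThan g x = prim (\<lambda>y. cnj (rep_l2 \<alpha> y) * rep_l2 g y) x"
  unfolding vker_def prim_def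
  by (subst cint_indicator) (auto intro!: Bochner_Integration.integral_cong simp: indicator_def)


section \<open>Weights\<close>

text \<open>This is where the bound 1/2 for \<open>s\<close> enters. The weight is compared with a
  power of \<open>1 + \<bar>x\<bar>\<close>, which has an explicit primitive; the factor
  \<open>2 powr s\<close> comes from
  \<open>(1 + \<bar>x\<bar>)\<^sup>2 / 2 \<le> 1 + x\<^sup>2\<close>.\<close>

lemma integrable_japanese_powr:
  assumes "s > 1 / 2"
  shows "integrable lborel (\<lambda>x::real. (1 + x\<^sup>2) powr (- s))"
proof -
  let ?f = "\<lambda>x::real. (1 + x) powr (- (2 * s))" and ?F = "\<lambda>x::real. (1 + x) powr (1 - 2 * s) / (1 - 2 * s)"
  have D: "DERIV ?F x :> ?f x" if "0 < ereal x" "ereal x < \<infinity>" for x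
  proof -
    have "((\<lambda>z. z powr (1 - 2 * s)) has_real_derivative (1 - 2 * s) * (1 + x) powr (1 - 2 * s - 1)) (at (1 + x))"
      by (rule has_real_derivative_powr) (use that in \<open>simp add: zero_ereal_def\<close>)
    moreover have "((\<lambda>x. 1 + x) has_real_derivative 1) (at x)"
      by (auto intro!: derivative_eq_intros)
    ultimately have "((\<lambda>x. (1 + x) powr (1 - 2 * s)) has_real_derivative (1 - 2 * s) * (1 + x) powr (1 - 2 * s - 1) * 1) (at x)"
      by (rule DERIV_chain2)
    from DERIV_cdivide[OF this, of "1 - 2 * s"] show ?thesis
      using assms by simp
  qed
  have C: "isCont ?f x" if "0 < ereal x" "ereal x < \<infinity>" for x
    using that by (intro continuous_intros) (auto simp: zero_ereal_def)
  have N: "AE x in lborel. 0 < ereal x \<longrightarrow> ereal x < \<infinity> \<longrightarrow> 0 \<le> ?f x"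
    by simp
  have "(?F \<longlongrightarrow> (1 + 0) powr (1 - 2 * s) / (1 - 2 * s)) (at_right 0)"
    by (intro tendsto_intros) (use assms in auto)
  then have A: "((?F \<circ> real_of_ereal) \<longlongrightarrow> (1 + 0) powr (1 - 2 * s) / (1 - 2 * s)) (at_right 0)"
    unfolding zero_ereal_def ereal_tendsto_simps .
  have "filterlim (\<lambda>x::real. 1 + x) at_top at_top"
    by real_asymp
  then have "((\<lambda>x::real. (1 + x) powr (1 - 2 * s)) \<longlongrightarrow> 0) at_top"
    using assms by (intro tendsto_neg_powr) auto
  then have "(?F \<longlongrightarrow> 0 / (1 - 2 * s)) at_top"
    using assms by (intro tendsto_divide tendsto_const) auto
  then have B: "((?F \<circ> real_of_ereal) \<longlongrightarrow> 0 / (1 - 2 * s)) (at_left \<infinity>)"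
    unfolding ereal_tendsto_simps .
  have "set_integrable lborel (einterval 0 \<infinity>) ?f"
    by (rule interval_integral_FTC_nonneg(1)[OF _ D C N A B]) auto
  moreover have "einterval 0 \<infinity> = {0<..}"
    by (auto simp: einterval_def zero_ereal_def)
  ultimately have "integrable lborel (\<lambda>x. indicator {0<..} x * ?f x)"
    by (simp add: set_integrable_def)
  moreover have "(\<lambda>x. indicator {0<..} x * ?f x) = (\<lambda>x. indicator {0<..} x * (1 + \<bar>x\<bar>) powr (- (2 * s)))"
    by (auto simp: indicator_def)
  ultimately have "has_bochner_integral lborel (\<lambda>x. indicator {0<..} x * (1 + \<bar>x\<bar>) powr (- (2 * s)))
      (LINT x|lborel. indicator {0<..} x * (1 + \<bar>x\<bar>) powr (- (2 * s)))"
    by (simp add: has_bochner_integral_iff)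
  from has_bochner_integral_even[OF this]
  have "integrable lborel (\<lambda>x::real. (1 + \<bar>x\<bar>) powr (- (2 * s)))"
    by (simp add: has_bochner_integral_iff)
  then have I: "integrable lborel (\<lambda>x::real. 2 powr s * (1 + \<bar>x\<bar>) powr (- (2 * s)))"
    by (rule integrable_mult_right)
  have "(1 + x\<^sup>2) powr (- s) \<le> 2 powr s * (1 + \<bar>x\<bar>) powr (- (2 * s))" for x :: real
  proof -
    have "(1 + \<bar>x\<bar>)\<^sup>2 / 2 \<le> 1 + x\<^sup>2"
      using zero_le_power2[of "\<bar>x\<bar> - 1"] by (simp add: power2_eq_square algebra_simps)
    then have "(1 + x\<^sup>2) powr (- s) \<le> ((1 + \<bar>x\<bar>)\<^sup>2 / 2) powr (- s)"
      using assms by (intro powr_mono2') (auto simp: zero_less_power)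
    also have "\<dots> = ((1 + \<bar>x\<bar>)\<^sup>2) powr (- s) / 2 powr (- s)"
      by (simp add: powr_divide)
    also have "((1 + \<bar>x\<bar>)\<^sup>2) powr (- s) = (1 + \<bar>x\<bar>) powr (- (2 * s))"
      by (simp add: powr_powr flip: powr_numeral)
    finally show ?thesis
      by (simp add: powr_minus field_simps)
  qed
  then show ?thesis
    by (intro Bochner_Integration.integrable_bound[OF I]) auto
qed

lemma japanese_powr: "japanese x powr (- s) = (1 + x\<^sup>2) powr (- (s / 2))"
  by (simp add: japanese_def powr_half_sqrt[symmetric] powr_powr add_nonneg_nonneg)

lemma japanese_powr_mult: "(1 + x\<^sup>2) powr (- r) * (1 + x\<^sup>2) powr r = (1 :: real)"
proof -
  have "(0::real) < 1 + x\<^sup>2" by (rule add_pos_nonneg) auto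
  then show ?thesis by (simp add: powr_add[symmetric])
qed

lemma Linf_negD:
  assumes "\<psi> \<in> Linf_neg s"
  shows "\<psi> \<in> borel_measurable borel" "\<exists>C. AE x in lborel. norm (\<psi> x) \<le> C * (1 + x\<^sup>2) powr (s / 2)"
proof -
  let ?h = "\<lambda>x. ereal (norm (of_real (japanese x powr (- s)) * \<psi> x))"
  show m: "\<psi> \<in> borel_measurable borel"
    using assms by (simp add: Linf_neg_def)
  have "esssup lborel ?h < \<infinity>"
    using assms by (simp add: Linf_neg_def)
  then obtain C where C: "esssup lborel ?h \<le> ereal C"
    by (cases "esssup lborel ?h") auto
  have "AE x in lborel. ?h x \<le> esssup lborel ?h"
    by (rule esssup_AE)
  then have "AE x in lborel. norm (\<psi> x) \<le> C * (1 + x\<^sup>2) powr (s / 2)"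
  proof eventually_elim
    case (elim x)
    then have "?h x \<le> ereal C" using C by (rule order_trans)
    then have le: "(1 + x\<^sup>2) powr (- (s / 2)) * norm (\<psi> x) \<le> C"
      by (simp add: norm_mult japanese_powr)
    have "norm (\<psi> x) = ((1 + x\<^sup>2) powr (- (s / 2)) * (1 + x\<^sup>2) powr (s / 2)) * norm (\<psi> x)"
      by (simp only: japanese_powr_mult mult_1_left)
    also have "\<dots> = ((1 + x\<^sup>2) powr (- (s / 2)) * norm (\<psi> x)) * (1 + x\<^sup>2) powr (s / 2)"
      by (simp only: mult_ac)
    also have "\<dots> \<le> C * (1 + x\<^sup>2) powr (s / 2)"
      by (rule mult_right_mono[OF le]) simp
    finally show ?case .
  qed
  then show "\<exists>C. AE x in lborel. norm (\<psi> x) \<le> C * (1 + x\<^sup>2) powr (s / 2)" ..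
qed

lemma bounded_Linf_neg:
  assumes [measurable]: "\<psi> \<in> borel_measurable borel" and C: "\<And>x. norm (\<psi> x) \<le> C" and s: "0 \<le> s"
  shows "\<psi> \<in> Linf_neg s"
proof -
  have [measurable]: "(\<lambda>x. japanese x powr (- s)) \<in> borel_measurable borel"
    unfolding japanese_powr by measurable
  have "ereal (norm (of_real (japanese x powr (- s)) * \<psi> x)) \<le> ereal C" for x
  proof -
    have "(1 + x\<^sup>2) powr (- (s / 2)) \<le> (1 + x\<^sup>2) powr 0"
      using s by (intro powr_mono) auto
    also have "(1 + x\<^sup>2) powr 0 = (1 :: real)"
      using add_pos_nonneg[of 1 "x\<^sup>2"] by simp
    finally have "(1 + x\<^sup>2) powr (- (s / 2)) * norm (\<psi> x) \<le> 1 * C"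
      by (intro mult_mono C) auto
    then show ?thesis by (simp add: norm_mult japanese_powr)
  qed
  then have "esssup lborel (\<lambda>x. ereal (norm (of_real (japanese x powr (- s)) * \<psi> x))) \<le> ereal C"
    by (intro esssup_I AE_I2) auto
  then have "esssup lborel (\<lambda>x. ereal (norm (of_real (japanese x powr (- s)) * \<psi> x))) < \<infinity>"
    by (rule le_less_trans) simp
  then show ?thesis
    by (simp add: Linf_neg_def)
qed

lemma weighted_mult_L2:
  assumes u: "u \<in> L2_weighted s" and \<psi>: "\<psi> \<in> Linf_neg s"
  shows "(\<lambda>x. cnj (u x) * \<psi> x) \<in> L2"
proof -
  have [measurable]: "u \<in> borel_measurable borel" "\<psi> \<in> borel_measurable borel"
    using u Linf_negD(1)[OF \<psi>] by (auto simp: L2_weighted_def)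
  obtain C where "AE x in lborel. norm (\<psi> x) \<le> C * (1 + x\<^sup>2) powr (s / 2)"
    using Linf_negD(2)[OF \<psi>] by blast
  then have "AE x in lborel. (norm (cnj (u x) * \<psi> x))\<^sup>2 \<le> C\<^sup>2 * ((norm (u x))\<^sup>2 * (1 + x\<^sup>2) powr s)"
  proof eventually_elim
    case (elim x)
    have "(norm (\<psi> x))\<^sup>2 \<le> (C * (1 + x\<^sup>2) powr (s / 2))\<^sup>2"
      by (rule power_mono[OF elim norm_ge_zero])
    also have "\<dots> = C\<^sup>2 * (1 + x\<^sup>2) powr s"
      by (simp add: power_mult_distrib power2_eq_square powr_add[symmetric])
    finally have "(norm (u x))\<^sup>2 * (norm (\<psi> x))\<^sup>2 \<le> (norm (u x))\<^sup>2 * (C\<^sup>2 * (1 + x\<^sup>2) powr s)"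
      by (rule mult_left_mono) simp
    then show ?case
      by (simp add: norm_mult power_mult_distrib mult_ac)
  qed
  then show ?thesis
    by (rule L2_bound[rotated 2]) (use u in \<open>auto simp: L2_weighted_def\<close>)
qed

lemma Linf_neg_local:
  assumes \<psi>: "\<psi> \<in> Linf_neg s" and s: "0 \<le> s"
  shows "(\<lambda>x. indicator {-R..R} x * \<psi> x) \<in> L2"
proof -
  have [measurable]: "\<psi> \<in> borel_measurable borel"
    by (rule Linf_negD(1)[OF \<psi>])
  obtain C where "AE x in lborel. norm (\<psi> x) \<le> C * (1 + x\<^sup>2) powr (s / 2)"
    using Linf_negD(2)[OF \<psi>] by blast
  then have "AE x in lborel. (norm (indicator {-R..R} x * \<psi> x))\<^sup>2 \<le> (\<bar>C\<bar> * (1 + R\<^sup>2) powr (s / 2))\<^sup>2 * indicat_real {-R..R} x"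
  proof eventually_elim
    case (elim x)
    show ?case
    proof (cases "x \<in> {-R..R}")
      case True
      then have "x\<^sup>2 \<le> R\<^sup>2" by (intro abs_le_square_iff[THEN iffD1]) auto
      then have "(1 + x\<^sup>2) powr (s / 2) \<le> (1 + R\<^sup>2) powr (s / 2)"
        using s by (intro powr_mono2) auto
      then have "C * (1 + x\<^sup>2) powr (s / 2) \<le> \<bar>C\<bar> * (1 + R\<^sup>2) powr (s / 2)"
        by (intro mult_mono) auto
      then have "norm (\<psi> x) \<le> \<bar>C\<bar> * (1 + R\<^sup>2) powr (s / 2)"
        using elim by simp
      from power_mono[OF this norm_ge_zero, of 2] True show ?thesis by simp
    qed simp
  qed
  moreover have "integrable lborel (\<lambda>x. (\<bar>C\<bar> * (1 + R\<^sup>2) powr (s / 2))\<^sup>2 * indicat_real {-R..R} x)"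
    by (intro integrable_mult_right integrable_real_indicator) (auto simp: emeasure_lborel_Icc_eq)
  ultimately show ?thesis
    by (intro L2_bound) auto
qed

section \<open>Conservation of the flux\<close>

lemma prim_cnj: "prim (\<lambda>y. cnj (A y)) x = cnj (prim A x)"
  unfolding prim_def
  by (subst Bochner_Integration.integral_cnj[symmetric]) (intro Bochner_Integration.integral_cong, auto)

text \<open>With \<open>w = c + \<i> * prim G\<close> one has \<open>f = w * \<alpha>\<close>, so
  the inner product of \<open>f\<close> and \<open>proj f\<close> is the integral of
  \<open>cnj w * G\<close>. Its reality gives \<open>Re K = Im (cnj c * J)\<close>. Fubini gives
  \<open>(norm J)\<^sup>2 = 2 * Re K\<close>, which replaces differentiating \<open>|w|^2\<close>.
  The two cancel in the expansion of the squared modulus of \<open>c + \<i> * J\<close>.\<close>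

lemma flux:
  assumes f: "f = bmul (\<lambda>t. c) \<alpha> + vop \<alpha> lessThan (proj f)"
  shows "norm (c + \<i> * cint \<alpha> (proj f)) = norm c"
proof -
  define G where "G y = cnj (rep_l2 \<alpha> y) * rep_l2 (proj f) y" for y
  define J where "J = cint \<alpha> (proj f)"
  define K where "K = (LINT y|lborel. G y * cnj (prim G y))"
  have G: "integrable lborel G"
    unfolding G_def[abs_def] by (rule cint_integrable)
  have Gc: "integrable lborel (\<lambda>y. cnj (G y))"
    using G by simp
  have J: "J = (LINT y|lborel. G y)"
    by (simp add: J_def cint_def G_def)
  have IK: "integrable lborel (\<lambda>y. G y * cnj (prim G y))"
    using integrable_mult_prim[OF G Gc] by (simp add: prim_cnj)
  have fx: "AE x in lborel. rep_l2 f x = (c + \<i> * prim G x) * rep_l2 \<alpha> x"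
  proof -
    have "AE x in lborel. rep_l2 (bmul (\<lambda>t. c) \<alpha> + vop \<alpha> lessThan (proj f)) x = (c + \<i> * prim G x) * rep_l2 \<alpha> x"
      using rep_plus[of "bmul (\<lambda>t. c) \<alpha>" "vop \<alpha> lessThan (proj f)"] rep_bmul[OF bmeas_const, of c \<alpha>]
        rep_vop[OF msets_lessThan, of \<alpha> "proj f"]
      by eventually_elim (simp add: vker_lessThan G_def[abs_def] algebra_simps)
    then show ?thesis by (simp only: f[symmetric])
  qed
  have "cint f (proj f) = (LINT y|lborel. cnj c * G y - \<i> * (G y * cnj (prim G y)))"
    unfolding cint_def
  proof (rule integral_cong_AE)
    show "AE y in lborel. cnj (rep_l2 f y) * rep_l2 (proj f) y = cnj c * G y - \<i> * (G y * cnj (prim G y))"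
      using fx by eventually_elim (simp add: G_def algebra_simps)
  qed (use borel_measurable_integrable[OF G] in measurable)
  also have "\<dots> = cnj c * J - \<i> * K"
    using G IK by (simp add: J K_def)
  finally have "Im (cnj c * J - \<i> * K) = 0"
    unfolding cint_proj by (metis Im_complex_of_real)
  then have ReK: "Re K = Im (cnj c * J)"
    by simp
  have "J * cnj J = K + (LINT y|lborel. cnj (G y) * prim G y)"
    using prim_product[OF G Gc] by (simp add: J K_def prim_cnj)
  also have "(LINT y|lborel. cnj (G y) * prim G y) = cnj K"
    unfolding K_def by (subst Bochner_Integration.integral_cnj[symmetric]) simp
  finally have "complex_of_real ((norm J)\<^sup>2) = of_real (2 * Re K)"
    by (simp only: complex_norm_square complex_add_cnj)
  then have nJ: "(norm J)\<^sup>2 = 2 * Re K"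
    by (simp only: of_real_eq_iff)
  have "(norm (c + \<i> * J))\<^sup>2 = (norm c)\<^sup>2 + (norm J)\<^sup>2 - 2 * Im (cnj c * J)"
    unfolding cmod_power2 by (simp add: power2_eq_square algebra_simps)
  also have "\<dots> = (norm c)\<^sup>2"
    using ReK nJ by simp
  finally show ?thesis
    unfolding J_def by (rule power2_eq_imp_eq) auto
qed

section \<open>The equation in integrated form\<close>

text \<open>By \<open>integral_prim_vd\<close> the distributional derivative of
  \<open>prim A\<close> is \<open>A\<close>, so the claim reduces to \<open>distrib_const\<close>
  for \<open>w - prim A\<close>.\<close>

lemma distrib_primitive:
  fixes w :: "real \<Rightarrow> complex"
  assumes [measurable]: "w \<in> borel_measurable borel"
    and loc: "\<And>R. (\<lambda>x. indicator {-R..R} x * w x) \<in> L2" and A: "integrable lborel A"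
  shows "(\<forall>h\<in>test_functions. (LINT x|lborel. w x * vd h x) = - (LINT x|lborel. A x * h x))
    \<longleftrightarrow> (\<exists>c. AE x in lborel. w x = c + prim A x)"
proof
  have [measurable]: "A \<in> borel_measurable borel" using A by simp
  have bp: "bmeas (prim A)"
    using norm_prim_le[OF A] by (intro bmeasI) auto
  have ploc: "(\<lambda>x. indicator {-R..R} x * prim A x) \<in> L2" for R
    using L2_bmul[OF bp L2_indicator_subset[of "{-R..R}" "-R" R]] by (simp add: mult.commute)
  {
    assume eq: "\<forall>h\<in>test_functions. (LINT x|lborel. w x * vd h x) = - (LINT x|lborel. A x * h x)"
    have "\<exists>c. AE x in lborel. w x - prim A x = c"
    proof (rule distrib_const)
      show "(\<lambda>x. indicator {-R..R} x * (w x - prim A x)) \<in> L2" for R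
        using L2_diff[OF loc[of R] ploc[of R]] by (simp add: right_diff_distrib)
      fix h assume h: "h \<in> test_functions"
      have "(LINT x|lborel. (w x - prim A x) * vd h x) = (LINT x|lborel. w x * vd h x) - (LINT x|lborel. prim A x * vd h x)"
        unfolding left_diff_distrib
        by (intro Bochner_Integration.integral_diff integrable_local_test[OF loc] integrable_local_test[OF ploc] test_vd h)
      then show "(LINT x|lborel. (w x - prim A x) * vd h x) = 0"
        using eq h by (simp add: integral_prim_vd[OF A h])
    qed measurable
    then obtain c where "AE x in lborel. w x - prim A x = c" ..
    then have "AE x in lborel. w x = c + prim A x"
      by eventually_elim (simp add: algebra_simps)
    then show "\<exists>c. AE x in lborel. w x = c + prim A x" ..
  next
    assume "\<exists>c. AE x in lborel. w x = c + prim A x"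
    then obtain c where c: "AE x in lborel. w x = c + prim A x" ..
    show "\<forall>h\<in>test_functions. (LINT x|lborel. w x * vd h x) = - (LINT x|lborel. A x * h x)"
    proof
      fix h assume h: "h \<in> test_functions"
      have [measurable]: "vd h \<in> borel_measurable borel"
        by (intro smooth_measurable test_smooth test_vd h)
      have "(LINT x|lborel. w x * vd h x) = (LINT x|lborel. c * vd h x + prim A x * vd h x)"
      proof (rule integral_cong_AE)
        show "AE x in lborel. w x * vd h x = c * vd h x + prim A x * vd h x"
          using c by eventually_elim (simp add: distrib_right)
      qed measurable
      also have "\<dots> = c * (LINT x|lborel. vd h x) + (LINT x|lborel. prim A x * vd h x)"
        using test_integrable[OF test_vd[OF h]] integrable_local_test[OF ploc test_vd[OF h]] by simp
      finally show "(LINT x|lborel. w x * vd h x) = - (LINT x|lborel. A x * h x)"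
        by (simp add: integral_vd[OF h] integral_prim_vd[OF A h])
    qed
  }
qed

text \<open>Multiplication by the conjugate plane wave removes the zero-order term.\<close>

lemma first_order_iff:
  fixes \<psi> F :: "real \<Rightarrow> complex"
  assumes [measurable]: "\<psi> \<in> borel_measurable borel"
    and loc: "\<And>R. (\<lambda>x. indicator {-R..R} x * \<psi> x) \<in> L2" and F: "integrable lborel F"
  shows "(\<forall>\<phi>\<in>test_functions. - \<i> * - (LINT x|lborel. \<psi> x * vd \<phi> x) - (LINT x|lborel. F x * \<phi> x)
      = (LINT x|lborel. of_real lam * \<psi> x * \<phi> x))
    \<longleftrightarrow> (\<exists>c. AE x in lborel. cis (- (lam * x)) * \<psi> x = c + prim (\<lambda>y. \<i> * (cis (- (lam * y)) * F y)) x)"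
proof -
  have [measurable]: "F \<in> borel_measurable borel" using F by simp
  let ?w = "\<lambda>x. cis (- (lam * x)) * \<psi> x" and ?A = "\<lambda>y. \<i> * (cis (- (lam * y)) * F y)"
  have A: "integrable lborel ?A"
    by (rule Bochner_Integration.integrable_bound[OF F]) (auto simp: norm_mult)
  have wloc: "(\<lambda>x. indicator {-R..R} x * ?w x) \<in> L2" for R
    using L2_bmul[OF bmeasI[of "\<lambda>x. cis (- (lam * x))" 1] loc[of R]] by (simp add: mult.left_commute)
  have equiv: "(- \<i> * - (LINT x|lborel. \<psi> x * vd (\<lambda>x. cis ((- lam) * x) * h x) x) - (LINT x|lborel. F x * (cis ((- lam) * x) * h x))
      = (LINT x|lborel. of_real lam * \<psi> x * (cis ((- lam) * x) * h x)))
      \<longleftrightarrow> (LINT x|lborel. ?w x * vd h x) = - (LINT x|lborel. ?A x * h x)" if h: "h \<in> test_functions" for h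
  proof -
    have "(LINT x|lborel. \<psi> x * vd (\<lambda>x. cis ((- lam) * x) * h x) x)
        = (LINT x|lborel. (- \<i> * of_real lam) * (?w x * h x) + ?w x * vd h x)"
      unfolding vd_cis_mult[OF test_smooth[OF h]] by (simp add: algebra_simps)
    also have "\<dots> = (- \<i> * of_real lam) * (LINT x|lborel. ?w x * h x) + (LINT x|lborel. ?w x * vd h x)"
      using integrable_local_test[OF wloc h] integrable_local_test[OF wloc test_vd[OF h]] by simp
    finally have 1: "(LINT x|lborel. \<psi> x * vd (\<lambda>x. cis ((- lam) * x) * h x) x)
        = (- \<i> * of_real lam) * (LINT x|lborel. ?w x * h x) + (LINT x|lborel. ?w x * vd h x)" .
    have "(LINT x|lborel. ?A x * h x) = (LINT x|lborel. \<i> * (F x * (cis ((- lam) * x) * h x)))"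
      by (simp add: mult_ac)
    then have 2: "(LINT x|lborel. ?A x * h x) = \<i> * (LINT x|lborel. F x * (cis ((- lam) * x) * h x))"
      by simp
    have "(LINT x|lborel. of_real lam * \<psi> x * (cis ((- lam) * x) * h x)) = (LINT x|lborel. of_real lam * (?w x * h x))"
      by (simp add: mult_ac)
    then have 3: "(LINT x|lborel. of_real lam * \<psi> x * (cis ((- lam) * x) * h x)) = of_real lam * (LINT x|lborel. ?w x * h x)"
      by simp
    show ?thesis
      unfolding 1 2 3 by (auto simp: algebra_simps) (auto simp: complex_eq_iff algebra_simps)
  qed
  \<comment> \<open>Multiplication by a plane wave maps the test functions onto themselves, so
    testing with modulated functions only is equivalent.\<close>
  have "(\<forall>\<phi>\<in>test_functions. - \<i> * - (LINT x|lborel. \<psi> x * vd \<phi> x) - (LINT x|lborel. F x * \<phi> x)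
      = (LINT x|lborel. of_real lam * \<psi> x * \<phi> x))
    \<longleftrightarrow> (\<forall>h\<in>test_functions. - \<i> * - (LINT x|lborel. \<psi> x * vd (\<lambda>x. cis ((- lam) * x) * h x) x)
        - (LINT x|lborel. F x * (cis ((- lam) * x) * h x))
      = (LINT x|lborel. of_real lam * \<psi> x * (cis ((- lam) * x) * h x)))" (is "?L \<longleftrightarrow> ?R")
  proof
    assume L: ?L
    show ?R
    proof
      fix h assume "h \<in> test_functions"
      from L[rule_format, OF test_cis_mult[OF this, of "- lam"]]
      show "- \<i> * - (LINT x|lborel. \<psi> x * vd (\<lambda>x. cis ((- lam) * x) * h x) x)
        - (LINT x|lborel. F x * (cis ((- lam) * x) * h x))
      = (LINT x|lborel. of_real lam * \<psi> x * (cis ((- lam) * x) * h x))" .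
    qed
  next
    assume R: ?R
    show ?L
    proof
      fix \<phi> assume "\<phi> \<in> test_functions"
      from R[rule_format, OF test_cis_mult[OF this, of lam]]
      have "- \<i> * - (LINT x|lborel. \<psi> x * vd (\<lambda>x. cis ((- lam) * x) * (cis (lam * x) * \<phi> x)) x)
        - (LINT x|lborel. F x * (cis ((- lam) * x) * (cis (lam * x) * \<phi> x)))
      = (LINT x|lborel. of_real lam * \<psi> x * (cis ((- lam) * x) * (cis (lam * x) * \<phi> x)))" .
      moreover have "cis ((- lam) * x) * (cis (lam * x) * \<phi> x) = \<phi> x" for x
        by (simp add: mult.assoc[symmetric] cis_mult)
      ultimately show "- \<i> * - (LINT x|lborel. \<psi> x * vd \<phi> x) - (LINT x|lborel. F x * \<phi> x)
          = (LINT x|lborel. of_real lam * \<psi> x * \<phi> x)"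
        by (simp only:)
    qed
  qed
  also have "\<dots> \<longleftrightarrow> (\<forall>h\<in>test_functions. (LINT x|lborel. ?w x * vd h x) = - (LINT x|lborel. ?A x * h x))"
    using equiv by (rule ball_cong[OF refl])
  also have "\<dots> \<longleftrightarrow> (\<exists>c. AE x in lborel. ?w x = c + prim ?A x)"
    by (rule distrib_primitive[OF _ wloc A]) measurable
  finally show ?thesis .
qed


section \<open>Jost solutions\<close>

lemma prim_cong_AE:
  assumes "AE y in lborel. A y = B y" "A \<in> borel_measurable borel" "B \<in> borel_measurable borel"
  shows "prim A x = prim B x"
  unfolding prim_def
proof (rule integral_cong_AE)
  show "AE y in lborel. (if y < x then A y else 0) = (if y < x then B y else 0)"
    using assms(1) by eventually_elim simp
qed (use assms in measurable)

lemma prim_cmult: "prim (\<lambda>y. c * A y) x = c * prim A x"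
proof -
  have "prim (\<lambda>y. c * A y) x = (LINT y|lborel. c * (if y < x then A y else 0))"
    unfolding prim_def by (rule Bochner_Integration.integral_cong) auto
  then show ?thesis by (simp add: prim_def)
qed

text \<open>An essential limit is a limit along this filter, so the filter must be proper for limits
  to be unique. It is, because an interval of length 1 is no null set.\<close>

lemma inf_ae_neq_bot:
  assumes "\<And>P. eventually P F \<Longrightarrow> \<exists>a. \<forall>x\<in>{a..a + 1}. P x"
  shows "inf F (ae_filter lborel) \<noteq> (bot :: real filter)"
proof
  assume "inf F (ae_filter lborel) = (bot :: real filter)"
  then have "eventually (\<lambda>x::real. False) (inf F (ae_filter lborel))" by simp
  then obtain P Q where PQ: "eventually P F" "AE x in lborel. Q x" "\<And>x. P x \<Longrightarrow> Q x \<Longrightarrow> False"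
    unfolding eventually_inf by auto
  obtain a where a: "\<forall>x\<in>{a..a + 1}. P x"
    using assms[OF PQ(1)] ..
  have "AE x in lborel. x \<notin> {a..a + 1}"
    using PQ(2) by eventually_elim (use a PQ(3) in blast)
  then have "emeasure lborel {a..a + 1} = 0"
    by (subst (asm) AE_iff_measurable[where N = "{a..a + 1}"]) auto
  then show False by simp
qed

lemma inf_at_bot_ae: "inf at_bot (ae_filter lborel) \<noteq> (bot :: real filter)"
proof (rule inf_ae_neq_bot)
  fix P :: "real \<Rightarrow> bool"
  assume "eventually P at_bot"
  then obtain N where "\<And>x. x \<le> N \<Longrightarrow> P x"
    by (auto simp: eventually_at_bot_linorder)
  then show "\<exists>a. \<forall>x\<in>{a..a + 1}. P x"
    by (intro exI[of _ "N - 1"]) auto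
qed

lemma inf_at_top_ae: "inf at_top (ae_filter lborel) \<noteq> (bot :: real filter)"
proof (rule inf_ae_neq_bot)
  fix P :: "real \<Rightarrow> bool"
  assume "eventually P at_top"
  then obtain N where "\<And>x. x \<ge> N \<Longrightarrow> P x"
    by (auto simp: eventually_at_top_linorder)
  then show "\<exists>a. \<forall>x\<in>{a..a + 1}. P x"
    by (intro exI[of _ N]) auto
qed

text \<open>Dividing by the plane wave, of modulus 1, the difference has modulus
  \<open>norm (V x - 1)\<close>, which tends to \<open>norm (v - 1)\<close>.\<close>

lemma ess_tendsto_plane_wave:
  assumes ne: "inf F (ae_filter lborel) \<noteq> bot" and lim: "(V \<longlongrightarrow> v) F"
    and eq: "AE x in lborel. \<psi> x = cis (lam * x) * V x"
  shows "ess_tendsto (\<lambda>x. \<psi> x - exp (\<i> * of_real x * of_real lam)) 0 F \<longleftrightarrow> v = 1"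
proof -
  let ?F = "inf F (ae_filter lborel)"
  have "\<forall>\<^sub>F x in ?F. \<psi> x = cis (lam * x) * V x"
    using eq by (rule filter_leD[OF inf_le2])
  then have ev: "\<forall>\<^sub>F x in ?F. norm (V x - 1) = norm (\<psi> x - exp (\<i> * of_real x * of_real lam))"
  proof eventually_elim
    case (elim x)
    have "exp (\<i> * of_real x * of_real lam) = cis (lam * x)"
      by (simp add: cis_conv_exp mult_ac)
    then have "\<psi> x - exp (\<i> * of_real x * of_real lam) = cis (lam * x) * (V x - 1)"
      by (simp only: elim) (simp add: algebra_simps)
    then show ?case by (simp add: norm_mult)
  qed
  have lim': "((\<lambda>x. norm (V x - 1)) \<longlongrightarrow> norm (v - 1)) ?F"
    by (intro tendsto_norm tendsto_diff tendsto_const tendsto_mono[OF inf_le1 lim])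
  have lim'': "((\<lambda>x. norm (\<psi> x - exp (\<i> * of_real x * of_real lam))) \<longlongrightarrow> norm (v - 1)) ?F"
    by (rule Lim_transform_eventually[OF lim' ev])
  show ?thesis
    unfolding ess_tendsto_def
      tendsto_norm_zero_iff[of "\<lambda>x. \<psi> x - exp (\<i> * of_real x * of_real lam)", symmetric]
  proof
    assume "((\<lambda>x. norm (\<psi> x - exp (\<i> * of_real x * of_real lam))) \<longlongrightarrow> 0) ?F"
    from tendsto_unique[OF ne lim'' this] show "v = 1" by simp
  next
    assume "v = 1"
    with lim'' show "((\<lambda>x. norm (\<psi> x - exp (\<i> * of_real x * of_real lam))) \<longlongrightarrow> 0) ?F" by simp
  qed
qed

lemma vop_bmul_const: "msets Q \<Longrightarrow> vop \<alpha> Q (bmul (\<lambda>t. c) g) = bmul (\<lambda>t. c) (vop \<alpha> Q g)"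
  unfolding vop_def
  by (subst bmul_abs[OF bmeas_const vop_L2]) (simp_all add: vker_def cint_bmul_const_right mult_ac)

section \<open>Reduction to an integral equation in \<open>l2\<close>\<close>

locale lax_setup =
  fixes u :: "real \<Rightarrow> complex" and s lam :: real
  assumes s: "s > 1 / 2" and u: "u \<in> Sobolev_plus 1" and uw: "u \<in> L2_weighted s"
begin

lemma uL2: "u \<in> L2"
  using u by (simp add: Sobolev_plus_iff)

lemma u_measurable [measurable]: "u \<in> borel_measurable borel"
  using uL2 by (rule L2_measurable)

definition alpha :: l2 where
  "alpha = abs_l2 (\<lambda>x. cis (lam * x) * cnj (u x))"

lemma alpha_L2: "(\<lambda>x. cis (lam * x) * cnj (u x)) \<in> L2"
  by (intro L2_bmul L2_cnj uL2 bmeasI[of _ 1]) auto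

lemma rep_alpha: "AE x in lborel. rep_l2 alpha x = cis (lam * x) * cnj (u x)"
  unfolding alpha_def by (rule rep_abs[OF alpha_L2])

definition src :: "(real \<Rightarrow> complex) \<Rightarrow> l2" where
  "src \<psi> = abs_l2 (\<lambda>x. cnj (u x) * \<psi> x)"

definition W :: "l2 \<Rightarrow> real \<Rightarrow> complex" where
  "W f = vker alpha lessThan (proj f)"

definition G :: "l2 \<Rightarrow> real \<Rightarrow> complex" where
  "G f y = cnj (rep_l2 alpha y) * rep_l2 (proj f) y"

lemma G_integrable: "integrable lborel (G f)"
  unfolding G_def[abs_def] by (rule cint_integrable)

lemma G_measurable [measurable]: "G f \<in> borel_measurable borel"
  using G_integrable[of f] by simp

lemma W_prim: "W f = prim (G f)"
  unfolding W_def G_def[abs_def] by (rule ext) (rule vker_lessThan)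

lemma W_measurable [measurable]: "W f \<in> borel_measurable borel"
  unfolding W_prim by measurable

lemma W_at_bot: "(W f \<longlongrightarrow> 0) at_bot"
  unfolding W_prim by (rule prim_at_bot[OF G_integrable])

lemma W_at_top: "(W f \<longlongrightarrow> cint alpha (proj f)) at_top"
  using prim_at_top[OF G_integrable[of f]] unfolding W_prim by (simp add: cint_def G_def)

abbreviation solves :: "(real \<Rightarrow> complex) \<Rightarrow> bool" where
  "solves \<psi> \<equiv> dist_eq (Lax u \<psi>) (dist_of (\<lambda>x. of_real lam * \<psi> x))"

text \<open>\<open>?F\<close> is a product of two functions in \<open>L2\<close>, hence integrable,
  and \<open>first_order_iff\<close> applies. Multiplied by the conjugate plane wave it becomes
  \<open>G (src \<psi>)\<close>, whose primitive is \<open>W (src \<psi>)\<close>.\<close>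

lemma solves_iff:
  assumes \<psi>: "\<psi> \<in> Linf_neg s"
  shows "solves \<psi> \<longleftrightarrow> (\<exists>c. AE x in lborel. \<psi> x = cis (lam * x) * (c + \<i> * W (src \<psi>) x))"
proof -
  let ?f = "\<lambda>y. cnj (u y) * \<psi> y"
  let ?F = "\<lambda>x. u x * szego ?f x"
  have f: "?f \<in> L2"
    by (rule weighted_mult_L2[OF uw \<psi>])
  have [measurable]: "\<psi> \<in> borel_measurable borel" "szego ?f \<in> borel_measurable borel"
    using Linf_negD(1)[OF \<psi>] szego_L2[OF f] by (auto dest: L2_measurable)
  have F: "integrable lborel ?F"
    by (rule L2_mult_integrable[OF uL2 szego_L2[OF f]])
  have FG: "AE y in lborel. \<i> * (cis (- (lam * y)) * ?F y) = \<i> * G (src \<psi>) y"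
    using rep_alpha rep_abs[OF szego_L2[OF f], unfolded abs_szego[OF f], folded src_def]
    by eventually_elim (simp add: G_def cis_cnj mult_ac)
  have P: "prim (\<lambda>y. \<i> * (cis (- (lam * y)) * ?F y)) x = \<i> * W (src \<psi>) x" for x
  proof -
    have "prim (\<lambda>y. \<i> * (cis (- (lam * y)) * ?F y)) x = prim (\<lambda>y. \<i> * G (src \<psi>) y) x"
      by (rule prim_cong_AE[OF FG]) measurable
    then show ?thesis by (simp only: prim_cmult W_prim)
  qed
  have "solves \<psi> \<longleftrightarrow> (\<exists>c. AE x in lborel. cis (- (lam * x)) * \<psi> x = c + prim (\<lambda>y. \<i> * (cis (- (lam * y)) * ?F y)) x)"
    unfolding dist_eq_def Lax_def dist_of_def dist_deriv_def
    by (rule first_order_iff[OF _ Linf_neg_local[OF \<psi>] F]) (use s in auto)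
  also have "\<dots> \<longleftrightarrow> (\<exists>c. AE x in lborel. \<psi> x = cis (lam * x) * (c + \<i> * W (src \<psi>) x))"
  proof -
    have "cis (- (lam * x)) * a = z \<longleftrightarrow> a = cis (lam * x) * z" for x a z
    proof
      assume "cis (- (lam * x)) * a = z"
      then have "cis (lam * x) * z = (cis (lam * x) * cis (- (lam * x))) * a" by (simp only: mult.assoc)
      then show "a = cis (lam * x) * z" by (simp add: cis_mult)
    next
      assume "a = cis (lam * x) * z"
      then have "cis (- (lam * x)) * a = (cis (- (lam * x)) * cis (lam * x)) * z" by (simp only: mult.assoc)
      then show "cis (- (lam * x)) * a = z" by (simp add: cis_mult)
    qed
    then show ?thesis
      by (simp only: P)
  qed
  finally show ?thesis .
qed

text \<open>Multiplying the integrated equation by \<open>cnj u\<close> eliminates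
  \<open>\<psi>\<close> in favour of its source. With \<open>f = src \<psi>\<close> the equation
  closes up in \<open>l2\<close>.\<close>

lemma src_eq:
  assumes "(\<lambda>x. cnj (u x) * \<psi> x) \<in> L2" "AE x in lborel. \<psi> x = cis (lam * x) * (c + \<i> * W f x)"
  shows "src \<psi> = bmul (\<lambda>t. c) alpha + vop alpha lessThan (proj f)"
proof -
  have "AE x in lborel. rep_l2 (bmul (\<lambda>t. c) alpha + vop alpha lessThan (proj f)) x = cnj (u x) * \<psi> x"
    using rep_plus[of "bmul (\<lambda>t. c) alpha" "vop alpha lessThan (proj f)"] rep_bmul[OF bmeas_const, of c alpha]
      rep_vop[OF msets_lessThan, of alpha "proj f"] rep_alpha assms(2)
    by eventually_elim (simp add: W_def algebra_simps)
  from l2_eq_absI[OF assms(1) this] show ?thesis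
    by (simp only: src_def)
qed

text \<open>The way back from a solution \<open>f\<close> of the integral equation to
  \<open>\<psi>\<close>; \<open>src_wave\<close> shows that \<open>src\<close> then recovers
  \<open>f\<close>.\<close>

definition wave :: "complex \<Rightarrow> l2 \<Rightarrow> real \<Rightarrow> complex" where
  "wave c f x = cis (lam * x) * (c + \<i> * W f x)"

lemma wave_measurable [measurable]: "wave c f \<in> borel_measurable borel"
  unfolding wave_def[abs_def] by measurable

lemma wave_Linf: "wave c f \<in> Linf_neg s"
proof (rule bounded_Linf_neg)
  show "norm (wave c f x) \<le> norm c + (LINT y|lborel. norm (G f y))" for x
  proof -
    have "norm (wave c f x) = norm (c + \<i> * W f x)"
      by (simp add: wave_def norm_mult)
    also have "\<dots> \<le> norm c + norm (W f x)"
      using norm_triangle_ineq[of c "\<i> * W f x"] by (simp add: norm_mult)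
    also have "norm (W f x) \<le> (LINT y|lborel. norm (G f y))"
      unfolding W_prim by (rule norm_prim_le[OF G_integrable])
    finally show ?thesis by simp
  qed
qed (use s in auto)

lemma src_wave:
  assumes "f = bmul (\<lambda>t. c) alpha + vop alpha lessThan (proj f)"
  shows "src (wave c f) = f"
proof -
  have "src (wave c f) = bmul (\<lambda>t. c) alpha + vop alpha lessThan (proj f)"
    by (rule src_eq[OF weighted_mult_L2[OF uw wave_Linf]]) (simp add: wave_def)
  then show ?thesis by (simp only: assms[symmetric])
qed

lemma solves_wave:
  assumes "f = bmul (\<lambda>t. c) alpha + vop alpha lessThan (proj f)"
  shows "solves (wave c f)"
  unfolding solves_iff[OF wave_Linf] src_wave[OF assms]
  by (intro exI[of _ c] AE_I2) (simp only: wave_def)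

subsection \<open>Solutions vanishing at both ends are eigenfunctions\<close>

lemma G_AE: "AE y in lborel. G f y = cis (- (lam * y)) * (u y * rep_l2 (proj f) y)"
  using rep_alpha by eventually_elim (simp add: G_def cis_cnj mult_ac)

lemma G_cis: "AE y in lborel. G f y * cis (- ((\<xi> - lam) * y)) = u y * rep_l2 (proj f) y * cis (- (y * \<xi>))"
  using G_AE[of f]
proof eventually_elim
  case (elim y)
  have "cis (- (lam * y)) * cis (- ((\<xi> - lam) * y)) = cis (- (y * \<xi>))"
    by (simp add: cis_mult algebra_simps)
  then have "cis (- (lam * y)) * (cis (- ((\<xi> - lam) * y)) * z) = cis (- (y * \<xi>)) * z" for z
    by (simp add: mult.assoc[symmetric])
  then show ?case by (simp only: elim) (simp add: mult_ac)
qed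

text \<open>The weight is absorbed by \<open>u\<close>, leaving a product of two functions in
  \<open>L2\<close>.\<close>

lemma G_weighted_integrable: "integrable lborel (\<lambda>y. (1 + y\<^sup>2) powr (s / 2) * norm (G f y))"
proof -
  have "(\<lambda>y. of_real ((1 + y\<^sup>2) powr (s / 2)) * u y) \<in> L2"
  proof (rule L2_bound)
    show "integrable lborel (\<lambda>y. (norm (u y))\<^sup>2 * (1 + y\<^sup>2) powr s)"
      using uw by (simp add: L2_weighted_def)
    show "AE y in lborel. (norm (of_real ((1 + y\<^sup>2) powr (s / 2)) * u y))\<^sup>2 \<le> (norm (u y))\<^sup>2 * (1 + y\<^sup>2) powr s"
    proof (rule AE_I2)
      fix y :: real
      have "((1 + y\<^sup>2) powr (s / 2))\<^sup>2 = (1 + y\<^sup>2) powr s"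
        by (simp add: power2_eq_square powr_add[symmetric])
      then show "(norm (of_real ((1 + y\<^sup>2) powr (s / 2)) * u y))\<^sup>2 \<le> (norm (u y))\<^sup>2 * (1 + y\<^sup>2) powr s"
        by (simp add: norm_mult power_mult_distrib)
    qed
  qed measurable
  from integrable_norm[OF L2_mult_integrable[OF this rep_L2]]
  have int: "integrable lborel (\<lambda>y. norm (of_real ((1 + y\<^sup>2) powr (s / 2)) * u y * rep_l2 (proj f) y))" .
  have eq: "AE y in lborel. norm (of_real ((1 + y\<^sup>2) powr (s / 2)) * u y * rep_l2 (proj f) y) = (1 + y\<^sup>2) powr (s / 2) * norm (G f y)"
    using G_AE[of f] by eventually_elim (simp add: norm_mult)
  show ?thesis
    by (rule integrable_cong_AE[THEN iffD1, OF _ _ eq int]) measurable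
qed

text \<open>For \<open>x \<le> 0\<close> the value is an integral over the left tail. For
  \<open>x > 0\<close> it is minus the integral over the right tail, because the total integral
  vanishes by \<open>J\<close>. On either tail the weight at \<open>y\<close> is at least the weight
  at \<open>x\<close>.\<close>

lemma W_decay:
  assumes J: "cint alpha (proj f) = 0"
  shows "norm (W f x) \<le> (LINT y|lborel. (1 + y\<^sup>2) powr (s / 2) * norm (G f y)) * (1 + x\<^sup>2) powr (- (s / 2))"
proof -
  let ?w = "\<lambda>y::real. (1 + y\<^sup>2) powr (s / 2)"
  have tail: "norm (LINT y|lborel. (if P y then G f y else 0)) \<le> (LINT y|lborel. ?w y * norm (G f y)) * (1 + x\<^sup>2) powr (- (s / 2))"
    if P: "\<And>y. P y \<Longrightarrow> \<bar>x\<bar> \<le> \<bar>y\<bar>" and [measurable]: "Measurable.pred borel P" for P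
  proof -
    have "norm (LINT y|lborel. (if P y then G f y else 0)) \<le> (LINT y|lborel. norm (if P y then G f y else 0))"
      by (rule integral_norm_bound)
    also have "\<dots> \<le> (LINT y|lborel. (?w y * norm (G f y)) * (1 + x\<^sup>2) powr (- (s / 2)))"
    proof (rule integral_mono)
      show "integrable lborel (\<lambda>y. norm (if P y then G f y else 0))"
        by (rule Bochner_Integration.integrable_bound[OF G_integrable[of f]]) auto
      show "integrable lborel (\<lambda>y. (?w y * norm (G f y)) * (1 + x\<^sup>2) powr (- (s / 2)))"
        by (intro integrable_mult_left G_weighted_integrable)
      fix y
      show "norm (if P y then G f y else 0) \<le> (?w y * norm (G f y)) * (1 + x\<^sup>2) powr (- (s / 2))"
      proof (cases "P y")
        case True
        have "x\<^sup>2 \<le> y\<^sup>2"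
          using P[OF True] by (simp add: abs_le_square_iff)
        then have "(1 + x\<^sup>2) powr (s / 2) \<le> ?w y"
          using s by (intro powr_mono2) auto
        then have "(1 + x\<^sup>2) powr (- (s / 2)) * (1 + x\<^sup>2) powr (s / 2) \<le> (1 + x\<^sup>2) powr (- (s / 2)) * ?w y"
          by (rule mult_left_mono) simp
        then have "1 \<le> (1 + x\<^sup>2) powr (- (s / 2)) * ?w y"
          by (simp only: japanese_powr_mult)
        then have "1 * norm (G f y) \<le> ((1 + x\<^sup>2) powr (- (s / 2)) * ?w y) * norm (G f y)"
          by (rule mult_right_mono) simp
        then show ?thesis using True by (simp add: mult_ac)
      qed simp
    qed
    also have "\<dots> = (LINT y|lborel. ?w y * norm (G f y)) * (1 + x\<^sup>2) powr (- (s / 2))"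
      by simp
    finally show ?thesis .
  qed
  show ?thesis
  proof (cases "x \<le> 0")
    case True
    have "norm (LINT y|lborel. (if y < x then G f y else 0)) \<le> (LINT y|lborel. ?w y * norm (G f y)) * (1 + x\<^sup>2) powr (- (s / 2))"
      by (rule tail) (use True in auto)
    then show ?thesis by (simp add: W_prim prim_def)
  next
    case False
    have I: "integrable lborel (\<lambda>y. if x \<le> y then G f y else 0)"
      by (rule Bochner_Integration.integrable_bound[OF G_integrable[of f]]) auto
    have "(LINT y|lborel. G f y) = (LINT y|lborel. (if y < x then G f y else 0) + (if x \<le> y then G f y else 0))"
      by (rule Bochner_Integration.integral_cong) auto
    also have "\<dots> = W f x + (LINT y|lborel. (if x \<le> y then G f y else 0))"
      unfolding W_prim prim_def
      by (rule Bochner_Integration.integral_add[OF prim_integrable[OF G_integrable] I])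
    finally have "W f x = - (LINT y|lborel. (if x \<le> y then G f y else 0))"
      using J by (simp add: cint_def G_def eq_neg_iff_add_eq_0)
    moreover have "norm (LINT y|lborel. (if x \<le> y then G f y else 0)) \<le> (LINT y|lborel. ?w y * norm (G f y)) * (1 + x\<^sup>2) powr (- (s / 2))"
      by (rule tail) (use False in auto)
    ultimately show ?thesis by simp
  qed
qed

lemma wave_L2:
  assumes J: "cint alpha (proj f) = 0"
  shows "wave 0 f \<in> L2"
proof -
  define B where "B = (LINT y|lborel. (1 + y\<^sup>2) powr (s / 2) * norm (G f y))"
  show ?thesis
  proof (rule L2_bound)
    show "integrable lborel (\<lambda>x::real. B\<^sup>2 * (1 + x\<^sup>2) powr (- s))"
      by (intro integrable_mult_right integrable_japanese_powr s)
    show "AE x in lborel. (norm (wave 0 f x))\<^sup>2 \<le> B\<^sup>2 * (1 + x\<^sup>2) powr (- s)"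
    proof (rule AE_I2)
      fix x :: real
      have "norm (wave 0 f x) \<le> B * (1 + x\<^sup>2) powr (- (s / 2))"
        using W_decay[OF J, of x] by (simp add: wave_def norm_mult B_def)
      then have "(norm (wave 0 f x))\<^sup>2 \<le> (B * (1 + x\<^sup>2) powr (- (s / 2)))\<^sup>2"
        by (rule power_mono) simp
      also have "\<dots> = B\<^sup>2 * (1 + x\<^sup>2) powr (- s)"
        by (simp add: power_mult_distrib power2_eq_square powr_add[symmetric])
      finally show "(norm (wave 0 f x))\<^sup>2 \<le> B\<^sup>2 * (1 + x\<^sup>2) powr (- s)" .
    qed
  qed measurable
qed

text \<open>The Fourier integral of \<open>u * \<Pi> f\<close> at \<open>\<xi>\<close>: the shift by
  \<open>lam\<close> undoes the plane wave contained in \<open>G\<close>.\<close>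

definition Fhat :: "l2 \<Rightarrow> real \<Rightarrow> complex" where
  "Fhat f \<xi> = (LINT y|lborel. G f y * cis (- ((\<xi> - lam) * y)))"

text \<open>Multiplying by \<open>\<mu>\<close> instead of dividing includes the case
  \<open>\<mu> = 0\<close>, and clamping \<open>y\<close> to the interval treats all positions of
  \<open>y\<close> at once.\<close>

lemma prim_cutoff_cis:
  assumes "0 \<le> R"
  shows "of_real \<mu> * prim (\<lambda>x. indicator {-R..R} x * cis (- (\<mu> * x))) y
    = \<i> * (cis (- (\<mu> * max (- R) (min y R))) - cis (\<mu> * R))"
proof -
  define t where "t = max (- R) (min y R)"
  have t: "- R \<le> t" using assms by (simp add: t_def)
  have "prim (\<lambda>x. indicator {-R..R} x * cis (- (\<mu> * x))) y = (LINT x|lborel. indicator {-R..t} x *\<^sub>R cis (- (\<mu> * x)))"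
    unfolding prim_def
  proof (rule integral_cong_AE)
    show "AE x in lborel. (if x < y then indicator {-R..R} x * cis (- (\<mu> * x)) else 0) = indicator {-R..t} x *\<^sub>R cis (- (\<mu> * x))"
      using AE_lborel_singleton[of y] AE_lborel_singleton[of "-R"]
      by eventually_elim (auto simp: indicator_def t_def)
  qed measurable
  then have "of_real \<mu> * prim (\<lambda>x. indicator {-R..R} x * cis (- (\<mu> * x))) y
      = (LINT x|lborel. of_real \<mu> * (indicator {-R..t} x *\<^sub>R cis (- (\<mu> * x))))"
    by (simp only: integral_mult_right_zero)
  also have "\<dots> = (LINT x|lborel. indicator {-R..t} x *\<^sub>R (of_real \<mu> * cis (- (\<mu> * x))))"
    by simp
  also have "\<dots> = \<i> * cis (- (\<mu> * t)) - \<i> * cis (- (\<mu> * (- R)))"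
  proof (rule integral_FTC_Icc[OF t])
    show "((\<lambda>x. \<i> * cis (- (\<mu> * x))) has_vector_derivative of_real \<mu> * cis (- (\<mu> * x))) (at x within {-R..t})" for x
      unfolding has_vector_derivative_complex_iff by (auto intro!: derivative_eq_intros)
  qed (intro continuous_intros)
  finally show ?thesis by (simp add: t_def algebra_simps)
qed

text \<open>Integration by parts by means of \<open>prim_product\<close>: the primitive moves from
  \<open>G f\<close> to the cut-off character. Both the product of the total integrals and the
  boundary term containing \<open>cis (\<mu> * R)\<close> vanish because \<open>G f\<close> has
  integral 0.\<close>

lemma tft_wave:
  assumes J: "cint alpha (proj f) = 0" and R: "0 \<le> R"
  shows "of_real (\<xi> - lam) * tft R (abs_l2 (wave 0 f)) \<xi>
    = (LINT y|lborel. G f y * cis (- ((\<xi> - lam) * max (- R) (min y R))))"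
proof -
  define \<mu> where "\<mu> = \<xi> - lam"
  let ?B = "\<lambda>x. indicator {-R..R} x * cis (- (\<mu> * x)) :: complex"
  have "integrable lborel (\<lambda>x. indicator {-R..R} x :: complex)"
    using L2_mult_integrable[OF L2_indicator_subset[of "{-R..R}" "-R" R] L2_indicator_subset[of "{-R..R}" "-R" R]]
    by (simp add: indicator_inter_arith[symmetric])
  then have B: "integrable lborel ?B"
    by (rule integrable_mult_cis) measurable
  have G0: "(LINT y|lborel. G f y) = 0"
    using J by (simp add: cint_def G_def)
  have "tft R (abs_l2 (wave 0 f)) \<xi> = (LINT x|lborel. indicator {-R..R} x * wave 0 f x * cis (- (x * \<xi>)))"
    by (rule tft_AE[OF rep_abs[OF wave_L2[OF J]]]) measurable
  also have "\<dots> = (LINT x|lborel. \<i> * (?B x * W f x))"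
  proof (rule Bochner_Integration.integral_cong)
    fix x
    have "cis (lam * x) * cis (- (x * \<xi>)) = cis (- (\<mu> * x))"
      by (simp add: cis_mult \<mu>_def algebra_simps)
    then have "cis (lam * x) * (cis (- (x * \<xi>)) * z) = cis (- (\<mu> * x)) * z" for z
      by (simp add: mult.assoc[symmetric])
    then show "indicator {-R..R} x * wave 0 f x * cis (- (x * \<xi>)) = \<i> * (?B x * W f x)"
      by (simp add: wave_def mult_ac)
  qed simp
  also have "\<dots> = \<i> * (LINT x|lborel. ?B x * W f x)"
    by simp
  also have "(LINT x|lborel. ?B x * W f x) = - (LINT y|lborel. G f y * prim ?B y)"
    using prim_product[OF G_integrable[of f] B] by (simp add: G0 W_prim eq_neg_iff_add_eq_0 add.commute)
  finally have "of_real \<mu> * tft R (abs_l2 (wave 0 f)) \<xi> = (LINT y|lborel. - \<i> * (G f y * (of_real \<mu> * prim ?B y)))"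
    by (simp add: mult_ac)
  also have "\<dots> = (LINT y|lborel. G f y * cis (- (\<mu> * max (- R) (min y R))) - G f y * cis (\<mu> * R))"
    unfolding prim_cutoff_cis[OF R]
    by (rule Bochner_Integration.integral_cong) (simp_all add: algebra_simps)
  also have "\<dots> = (LINT y|lborel. G f y * cis (- (\<mu> * max (- R) (min y R)))) - (LINT y|lborel. G f y * cis (\<mu> * R))"
    by (intro Bochner_Integration.integral_diff integrable_mult_cis G_integrable) measurable
  also have "(LINT y|lborel. G f y * cis (\<mu> * R)) = 0"
    by (simp add: G0)
  finally show ?thesis by (simp add: \<mu>_def)
qed

lemma tft_wave_limit:
  assumes J: "cint alpha (proj f) = 0"
  shows "(\<lambda>n. of_real (\<xi> - lam) * tft (real n) (abs_l2 (wave 0 f)) \<xi>) \<longlonglongrightarrow> Fhat f \<xi>"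
proof -
  have "(\<lambda>n. LINT y|lborel. G f y * cis (- ((\<xi> - lam) * max (- real n) (min y (real n))))) \<longlonglongrightarrow> Fhat f \<xi>"
    unfolding Fhat_def
  proof (rule integral_dominated_convergence[where w = "\<lambda>y. norm (G f y)"])
    show "AE y in lborel. (\<lambda>n. G f y * cis (- ((\<xi> - lam) * max (- real n) (min y (real n))))) \<longlonglongrightarrow> G f y * cis (- ((\<xi> - lam) * y))"
    proof (rule AE_I2)
      fix y
      obtain N where N: "\<bar>y\<bar> < real N" using reals_Archimedean2 by blast
      have "\<forall>\<^sub>F n in sequentially. G f y * cis (- ((\<xi> - lam) * y)) = G f y * cis (- ((\<xi> - lam) * max (- real n) (min y (real n))))"
        using eventually_ge_at_top[of N]
      proof eventually_elim
        case (elim n)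
        then have "real N \<le> real n" by simp
        then have "- real n \<le> y" "y \<le> real n" using N by linarith+
        then have "max (- real n) (min y (real n)) = y" by (simp add: max_def min_def)
        then show ?case by simp
      qed
      then show "(\<lambda>n. G f y * cis (- ((\<xi> - lam) * max (- real n) (min y (real n))))) \<longlonglongrightarrow> G f y * cis (- ((\<xi> - lam) * y))"
        by (rule Lim_transform_eventually[OF tendsto_const])
    qed
  qed (auto simp: norm_mult G_integrable)
  then show ?thesis
    by (simp only: tft_wave[OF J of_nat_0_le_iff])
qed

text \<open>The differential equation on the Fourier side. It is derived from truncated transforms;
  dividing by \<open>\<xi> - lam\<close> excludes a single point.\<close>

lemma FT_wave:
  assumes J: "cint alpha (proj f) = 0"
  shows "AE \<xi> in lborel. of_real (\<xi> - lam) * rep_l2 (FT (abs_l2 (wave 0 f))) \<xi> = Fhat f \<xi>"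
proof -
  interpret F: bounded_linear FT by (rule bounded_linear_FT)
  let ?x = "abs_l2 (wave 0 f)"
  have lim: "(\<lambda>n. FT (cut (real n) ?x)) \<longlonglongrightarrow> FT ?x"
    by (intro F.tendsto tendsto_cut filterlim_real_sequentially)
  have "AE \<xi> in lborel. \<forall>n. rep_l2 (FT (cut (real n) ?x)) \<xi> = tft (real n) ?x \<xi>"
    unfolding AE_all_countable by (intro allI FT_cut)
  then have "AE \<xi> in lborel. (\<lambda>n. rep_l2 (FT (cut (real n) ?x)) \<xi>) \<longlonglongrightarrow> Fhat f \<xi> / of_real (\<xi> - lam)"
    using AE_lborel_singleton[of lam]
  proof eventually_elim
    case (elim \<xi>)
    have "(\<lambda>n. of_real (\<xi> - lam) * tft (real n) ?x \<xi> / of_real (\<xi> - lam)) \<longlonglongrightarrow> Fhat f \<xi> / of_real (\<xi> - lam)"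
      by (rule tendsto_divide[OF tft_wave_limit[OF J] tendsto_const]) (use elim in simp)
    moreover have "of_real (\<xi> - lam) * z / of_real (\<xi> - lam) = z" for z :: complex
      using elim(2) by simp
    ultimately show ?case using elim(1) by (simp only:)
  qed
  from l2_limit_AE[OF lim this] AE_lborel_singleton[of lam] show ?thesis
    by eventually_elim simp
qed

text \<open>\<open>u\<close> is bounded by the Sobolev embedding, so \<open>?F\<close> is square
  integrable besides being integrable. Its Fourier integral therefore agrees almost everywhere with
  its transform in \<open>l2\<close>.\<close>

lemma Fhat_L2: "Fhat f \<in> L2"
proof -
  obtain C where C: "AE x in lborel. norm (u x) \<le> C"
    using Sobolev_bounded[OF uL2] u unfolding Sobolev_plus_iff by blast
  let ?F = "\<lambda>y. u y * rep_l2 (proj f) y"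
  have F: "?F \<in> L2"
  proof (rule L2_bound)
    show "integrable lborel (\<lambda>y. C\<^sup>2 * (norm (rep_l2 (proj f) y))\<^sup>2)"
      by (intro integrable_mult_right L2_integrable rep_L2)
    show "AE y in lborel. (norm (?F y))\<^sup>2 \<le> C\<^sup>2 * (norm (rep_l2 (proj f) y))\<^sup>2"
      using C by eventually_elim (auto simp: norm_mult power_mult_distrib intro!: mult_right_mono power_mono)
  qed measurable
  have FI: "integrable lborel ?F"
    by (rule L2_mult_integrable[OF uL2 rep_L2])
  interpret FT: bounded_linear FT by (rule bounded_linear_FT)
  have lim: "(\<lambda>n. FT (cut (real n) (abs_l2 ?F))) \<longlonglongrightarrow> FT (abs_l2 ?F)"
    by (intro FT.tendsto tendsto_cut filterlim_real_sequentially)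
  have T: "(\<lambda>n. tft (real n) (abs_l2 ?F) \<xi>) \<longlonglongrightarrow> Fhat f \<xi>" for \<xi>
  proof -
    have "Fhat f \<xi> = (LINT y|lborel. ?F y * cis (- (y * \<xi>)))"
      unfolding Fhat_def by (rule integral_cong_AE[OF _ _ G_cis]) measurable
    moreover have "(\<lambda>n. LINT y|lborel. indicator {- real n..real n} y * ?F y * cis (- (y * \<xi>))) \<longlonglongrightarrow> (LINT y|lborel. ?F y * cis (- (y * \<xi>)))"
    proof (rule integral_dominated_convergence[where w = "\<lambda>y. norm (?F y)"])
      show "AE y in lborel. (\<lambda>n. indicator {- real n..real n} y * ?F y * cis (- (y * \<xi>))) \<longlonglongrightarrow> ?F y * cis (- (y * \<xi>))"
      proof (rule AE_I2)
        fix y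
        obtain N where N: "\<bar>y\<bar> < real N" using reals_Archimedean2 by blast
        have "\<forall>\<^sub>F n in sequentially. ?F y * cis (- (y * \<xi>)) = indicator {- real n..real n} y * ?F y * cis (- (y * \<xi>))"
          using eventually_ge_at_top[of N] by eventually_elim (use N in \<open>auto simp: indicator_def\<close>)
        then show "(\<lambda>n. indicator {- real n..real n} y * ?F y * cis (- (y * \<xi>))) \<longlonglongrightarrow> ?F y * cis (- (y * \<xi>))"
          by (rule Lim_transform_eventually[OF tendsto_const])
      qed
      show "integrable lborel (\<lambda>y. norm (?F y))" by (rule integrable_norm[OF FI])
    qed (auto simp: norm_mult indicator_def)
    moreover have "tft R (abs_l2 ?F) \<xi> = (LINT y|lborel. indicator {-R..R} y * ?F y * cis (- (y * \<xi>)))" for R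
      by (rule tft_AE[OF rep_abs[OF F]]) measurable
    ultimately show ?thesis by (simp only:)
  qed
  have "AE \<xi> in lborel. \<forall>n. rep_l2 (FT (cut (real n) (abs_l2 ?F))) \<xi> = tft (real n) (abs_l2 ?F) \<xi>"
    unfolding AE_all_countable by (intro allI FT_cut)
  then have "AE \<xi> in lborel. (\<lambda>n. rep_l2 (FT (cut (real n) (abs_l2 ?F))) \<xi>) \<longlonglongrightarrow> Fhat f \<xi>"
    by eventually_elim (simp only: T)
  from l2_limit_AE[OF lim this]
  have "AE \<xi> in lborel. rep_l2 (FT (abs_l2 ?F)) \<xi> = Fhat f \<xi>" .
  then show ?thesis
    by (rule L2_AE_cong[OF rep_L2, rotated]) (unfold Fhat_def[abs_def], measurable)
qed

lemma Fhat_negative: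
  assumes "\<xi> < 0"
  shows "Fhat f \<xi> = 0"
proof -
  have "Fhat f \<xi> = (LINT y|lborel. rep_l2 (abs_l2 u) y * rep_l2 (proj f) y * cis (- (y * \<xi>)))"
    unfolding Fhat_def
  proof (rule integral_cong_AE)
    show "AE y in lborel. G f y * cis (- ((\<xi> - lam) * y)) = rep_l2 (abs_l2 u) y * rep_l2 (proj f) y * cis (- (y * \<xi>))"
      using G_cis[of f \<xi>] rep_abs[OF uL2] by eventually_elim simp
  qed measurable
  also have "\<dots> = 0"
    using u by (intro hardy_product proj_hardy assms) (simp add: Sobolev_plus_iff)
  finally show ?thesis .
qed

text \<open>For \<open>\<xi> < 0\<close> the transform of the wave times \<open>\<xi> - lam\<close>
  vanishes by \<open>Fhat_negative\<close>, and the factor is nonzero as \<open>lam > 0\<close>.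
  Square integrability of the transform and of its product with \<open>\<xi> - lam\<close> gives one
  derivative in \<open>L2\<close>.\<close>

lemma wave_Sobolev_plus:
  assumes J: "cint alpha (proj f) = 0" and lam: "lam > 0"
  shows "wave 0 f \<in> Sobolev_plus 1"
  unfolding Sobolev_plus_iff
proof (intro conjI)
  let ?p = "rep_l2 (FT (abs_l2 (wave 0 f)))"
  show "wave 0 f \<in> L2" by (rule wave_L2[OF J])
  show "abs_l2 (wave 0 f) \<in> hardy"
    unfolding hardy_def mem_Collect_eq
    using FT_wave[OF J]
  proof eventually_elim
    case (elim \<xi>)
    show ?case
    proof
      assume "\<xi> < 0"
      with elim Fhat_negative[OF this, of f] have "of_real (\<xi> - lam) * ?p \<xi> = 0" by simp
      then show "?p \<xi> = 0" using \<open>\<xi> < 0\<close> lam by simp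
    qed
  qed
  have I: "integrable lborel (\<lambda>\<xi>. (1 + 2 * lam\<^sup>2) * (norm (?p \<xi>))\<^sup>2 + 2 * (norm (Fhat f \<xi>))\<^sup>2)"
    by (intro Bochner_Integration.integrable_add integrable_mult_right L2_integrable rep_L2 Fhat_L2)
  show "integrable lborel (\<lambda>\<xi>. (1 + \<xi>\<^sup>2) * (norm (?p \<xi>))\<^sup>2)"
  proof (rule Bochner_Integration.integrable_bound[OF I])
    show "AE \<xi> in lborel. norm ((1 + \<xi>\<^sup>2) * (norm (?p \<xi>))\<^sup>2) \<le> norm ((1 + 2 * lam\<^sup>2) * (norm (?p \<xi>))\<^sup>2 + 2 * (norm (Fhat f \<xi>))\<^sup>2)"
      using FT_wave[OF J]
    proof eventually_elim
      case (elim \<xi>)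
      have "norm (Fhat f \<xi>) = \<bar>\<xi> - lam\<bar> * norm (?p \<xi>)"
        unfolding elim[symmetric] by (simp add: norm_mult del: of_real_diff)
      then have e: "(norm (Fhat f \<xi>))\<^sup>2 = (\<xi> - lam)\<^sup>2 * (norm (?p \<xi>))\<^sup>2"
        by (simp add: power_mult_distrib)
      \<comment> \<open>From \<open>\<xi>\<^sup>2 \<le> 2 * lam\<^sup>2 + 2 * (\<xi> -
        lam)\<^sup>2\<close>, whose two sides differ by the square of
        \<open>\<xi> - 2 * lam\<close>.\<close>
      have "1 + \<xi>\<^sup>2 \<le> 1 + 2 * lam\<^sup>2 + 2 * (\<xi> - lam)\<^sup>2"
        using zero_le_power2[of "\<xi> - 2 * lam"] by (simp add: power2_eq_square algebra_simps)
      then have "(1 + \<xi>\<^sup>2) * (norm (?p \<xi>))\<^sup>2 \<le> (1 + 2 * lam\<^sup>2 + 2 * (\<xi> - lam)\<^sup>2) * (norm (?p \<xi>))\<^sup>2"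
        by (rule mult_right_mono) simp
      also have "\<dots> = (1 + 2 * lam\<^sup>2) * (norm (?p \<xi>))\<^sup>2 + 2 * (norm (Fhat f \<xi>))\<^sup>2"
        by (simp add: e algebra_simps)
      finally have le: "(1 + \<xi>\<^sup>2) * (norm (?p \<xi>))\<^sup>2 \<le> (1 + 2 * lam\<^sup>2) * (norm (?p \<xi>))\<^sup>2 + 2 * (norm (Fhat f \<xi>))\<^sup>2" .
      have "0 \<le> (1 + \<xi>\<^sup>2) * (norm (?p \<xi>))\<^sup>2" by (intro mult_nonneg_nonneg add_nonneg_nonneg) auto
      with le show ?case unfolding real_norm_def by linarith
    qed
  qed measurable
qed

lemma homogeneous_trivial:
  assumes lam: "lam > 0" and ev: "complex_of_real lam \<notin> sigma_pp u"
    and f: "f = vop alpha lessThan (proj f)"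
  shows "f = 0"
proof -
  have z: "bmul (\<lambda>t. 0) alpha = 0"
    using bmul_of_real[of 0 alpha] by simp
  have f': "f = bmul (\<lambda>t. 0) alpha + vop alpha lessThan (proj f)"
    using f by (simp add: z)
  \<comment> \<open>For \<open>c = 0\<close> conservation of the flux says that the limit at the
    other end is 0 as well.\<close>
  have J: "cint alpha (proj f) = 0"
    using flux[OF f'] by (simp add: norm_mult)
  have "wave 0 f \<in> Sobolev_plus 1"
    by (rule wave_Sobolev_plus[OF J lam])
  moreover have "solves (wave 0 f)"
    by (rule solves_wave[OF f'])
  ultimately have "AE x in lborel. wave 0 f x = 0"
    using ev unfolding sigma_pp_def by blast
  \<comment> \<open>A vanishing wave has vanishing source, and the source is
    \<open>f\<close>.\<close>
  then have "AE x in lborel. cnj (u x) * wave 0 f x = 0"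
    by eventually_elim simp
  then have "src (wave 0 f) = 0"
    unfolding src_def zero_l2_def
    by (intro abs_l2_cong weighted_mult_L2[OF uw wave_Linf] L2_zero)
  then show ?thesis
    by (simp only: src_wave[OF f'])
qed

section \<open>Uniqueness, and existence with a normalisation at either end\<close>

lemma solution_src:
  assumes \<psi>: "\<psi> \<in> Linf_neg s" and c: "AE x in lborel. \<psi> x = cis (lam * x) * (c + \<i> * W (src \<psi>) x)"
  shows "src \<psi> = bmul (\<lambda>t. c) alpha + vop alpha lessThan (proj (src \<psi>))"
  by (rule src_eq[OF weighted_mult_L2[OF uw \<psi>] c])

lemma linear_proj: "linear proj"
  using bounded_linear_proj by (rule bounded_linear.linear)

lemma solution_unique:
  assumes lam: "lam > 0" and ev: "complex_of_real lam \<notin> sigma_pp u"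
    and f: "f = bmul (\<lambda>t. c) alpha + vop alpha lessThan (proj f)"
    and g: "g = bmul (\<lambda>t. c) alpha + vop alpha lessThan (proj g)"
  shows "f = g"
proof -
  interpret V: linear "vop alpha lessThan" by (rule linear_vop[OF msets_lessThan])
  interpret P: linear proj by (rule linear_proj)
  have "f - g = (bmul (\<lambda>t. c) alpha + vop alpha lessThan (proj f)) - (bmul (\<lambda>t. c) alpha + vop alpha lessThan (proj g))"
    using f g by (rule arg_cong2[where f = minus])
  also have "\<dots> = vop alpha lessThan (proj (f - g))"
    by (simp add: V.diff P.diff)
  finally have "f - g = 0"
    by (rule homogeneous_trivial[OF lam ev])
  then show ?thesis by simp
qed

text \<open>Treats both ends at once: \<open>v c f\<close> stands for the limit of
  \<open>c + \<i> * W f x\<close> along \<open>F\<close>. The constant is fixed by the normalisation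
  through \<open>uniq\<close>, and \<open>f\<close> is then fixed by the constant through
  \<open>solution_unique\<close>.\<close>

lemma ex1_solution:
  assumes lam: "lam > 0" and ev: "complex_of_real lam \<notin> sigma_pp u"
    and ne: "inf F (ae_filter lborel) \<noteq> bot"
    and lim: "\<And>c f. ((\<lambda>x. c + \<i> * W f x) \<longlongrightarrow> v c f) F"
    and ex: "f0 = bmul (\<lambda>t. c0) alpha + vop alpha lessThan (proj f0)" "v c0 f0 = 1"
    and uniq: "\<And>c f. f = bmul (\<lambda>t. c) alpha + vop alpha lessThan (proj f) \<Longrightarrow> v c f = 1 \<Longrightarrow> c = c0"
  shows "ex1_ae (Linf_neg s) (\<lambda>\<psi>. solves \<psi> \<and> ess_tendsto (\<lambda>x. \<psi> x - exp (\<i> * of_real x * of_real lam)) 0 F)"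
  unfolding ex1_ae_def
proof (intro bexI[of _ "wave c0 f0"] conjI ballI impI)
  show "wave c0 f0 \<in> Linf_neg s" by (rule wave_Linf)
  show "solves (wave c0 f0)" by (rule solves_wave[OF ex(1)])
  have "AE x in lborel. wave c0 f0 x = cis (lam * x) * (c0 + \<i> * W f0 x)"
    by (simp add: wave_def)
  from ess_tendsto_plane_wave[OF ne lim this] ex(2)
  show "ess_tendsto (\<lambda>x. wave c0 f0 x - exp (\<i> * of_real x * of_real lam)) 0 F" by simp
  fix \<psi>
  assume \<psi>: "\<psi> \<in> Linf_neg s"
    and h: "solves \<psi> \<and> ess_tendsto (\<lambda>x. \<psi> x - exp (\<i> * of_real x * of_real lam)) 0 F"
  obtain c where c: "AE x in lborel. \<psi> x = cis (lam * x) * (c + \<i> * W (src \<psi>) x)"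
    using h unfolding solves_iff[OF \<psi>] by blast
  have "v c (src \<psi>) = 1"
    using ess_tendsto_plane_wave[OF ne lim c] h by simp
  then have c0: "c = c0"
    by (rule uniq[OF solution_src[OF \<psi> c]])
  have "src \<psi> = f0"
    by (rule solution_unique[OF lam ev solution_src[OF \<psi> c, unfolded c0] ex(1)])
  then show "AE x in lborel. \<psi> x = wave c0 f0 x"
    using c by (simp only: c0 wave_def)
qed

end

theorem theorem1p2:
  fixes u :: "real \<Rightarrow> complex" and s lam :: real
  assumes "s > 1 / 2"
    and "u \<in> Sobolev_plus 1 \<inter> L2_weighted s"
    and "lam > 0"
    and "complex_of_real lam \<notin> sigma_pp u"
  shows "ex1_ae (Linf_neg s) (\<lambda>\<psi>.
           dist_eq (Lax u \<psi>) (dist_of (\<lambda>x. of_real lam * \<psi> x)) \<and>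
           ess_tendsto (\<lambda>x. \<psi> x - exp (\<i> * of_real x * of_real lam)) 0 at_bot) \<and>
         ex1_ae (Linf_neg s) (\<lambda>\<psi>.
           dist_eq (Lax u \<psi>) (dist_of (\<lambda>x. of_real lam * \<psi> x)) \<and>
           ess_tendsto (\<lambda>x. \<psi> x - exp (\<i> * of_real x * of_real lam)) 0 at_top)"
proof -
  interpret lax_setup u s lam
    using assms by unfold_locales auto
  interpret V: linear "vop alpha lessThan" by (rule linear_vop[OF msets_lessThan])
  interpret P: linear proj by (rule linear_proj)
  have bot: "((\<lambda>x. c + \<i> * W f x) \<longlongrightarrow> c + \<i> * 0) at_bot" for c f
    by (intro tendsto_add tendsto_mult tendsto_const W_at_bot)
  have top: "((\<lambda>x. c + \<i> * W f x) \<longlongrightarrow> c + \<i> * cint alpha (proj f)) at_top" for c f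
    by (intro tendsto_add tendsto_mult tendsto_const W_at_top)
  have "\<exists>f. f = bmul (\<lambda>t. 1) alpha + vop alpha lessThan (proj f)"
    by (rule volterra_solvable) (rule homogeneous_trivial[OF assms(3,4)])
  then obtain f where f: "f = bmul (\<lambda>t. 1) alpha + vop alpha lessThan (proj f)" ..
  \<comment> \<open>The limit at \<open>+\<infinity>\<close> of the solution normalised at
    \<open>-\<infinity>\<close>, after division by the plane wave.\<close>
  define d where "d = 1 + \<i> * cint alpha (proj f)"
  have "norm d = 1"
    using flux[OF f] by (simp add: d_def)
  then have d: "d \<noteq> 0" by auto
  define g where "g = bmul (\<lambda>t. 1 / d) f"
  have g: "g = bmul (\<lambda>t. 1 / d) alpha + vop alpha lessThan (proj g)"
  proof -
    have "g = bmul (\<lambda>t. 1 / d) (bmul (\<lambda>t. 1) alpha + vop alpha lessThan (proj f))"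
      unfolding g_def by (subst f) (rule refl)
    also have "\<dots> = bmul (\<lambda>t. 1 / d) alpha + vop alpha lessThan (proj g)"
      by (simp add: g_def bmul_add bmul_bmul proj_bmul_const vop_bmul_const[OF msets_lessThan])
    finally show ?thesis .
  qed
  have v: "1 / d + \<i> * cint alpha (proj g) = 1"
  proof -
    have "1 / d + \<i> * cint alpha (proj g) = (1 + \<i> * cint alpha (proj f)) / d"
      by (simp add: g_def proj_bmul_const cint_bmul_const_right add_divide_distrib)
    also have "\<dots> = d / d"
      by (simp only: d_def)
    finally show ?thesis using d by simp
  qed
  \<comment> \<open>The difference of two solutions normalised at \<open>+\<infinity>\<close> solves
    the equation with constant \<open>c - 1 / d\<close> and tends to 0 there, after division by the
    plane wave. By the flux identity its constant has modulus 0.\<close>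
  have uniq: "c = 1 / d" if h: "h = bmul (\<lambda>t. c) alpha + vop alpha lessThan (proj h)" "c + \<i> * cint alpha (proj h) = 1" for c h
  proof -
    have "bmul (\<lambda>t. c) alpha - bmul (\<lambda>t. 1 / d) alpha = bmul (\<lambda>t. c - 1 / d) alpha"
      unfolding bmul_def abs_diff[OF L2_cmult[OF rep_L2] L2_cmult[OF rep_L2], symmetric]
      by (simp only: left_diff_distrib)
    moreover have "h - g = (bmul (\<lambda>t. c) alpha + vop alpha lessThan (proj h)) - (bmul (\<lambda>t. 1 / d) alpha + vop alpha lessThan (proj g))"
      using h(1) g by (rule arg_cong2[where f = minus])
    ultimately have e: "h - g = bmul (\<lambda>t. c - 1 / d) alpha + vop alpha lessThan (proj (h - g))"
      by (simp add: V.diff P.diff algebra_simps)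
    have "cint alpha (proj (h - g)) + cint alpha (proj g) = cint alpha (proj h)"
      by (simp add: P.diff cint_add_right[symmetric])
    then have "c - 1 / d + \<i> * cint alpha (proj (h - g)) = (c + \<i> * cint alpha (proj h)) - (1 / d + \<i> * cint alpha (proj g))"
      by (simp add: algebra_simps flip: distrib_left)
    then have "c - 1 / d + \<i> * cint alpha (proj (h - g)) = 0"
      by (simp only: h(2) v diff_self)
    with flux[OF e] show ?thesis by simp
  qed
  show ?thesis
  proof
    show "ex1_ae (Linf_neg s) (\<lambda>\<psi>. dist_eq (Lax u \<psi>) (dist_of (\<lambda>x. of_real lam * \<psi> x)) \<and>
           ess_tendsto (\<lambda>x. \<psi> x - exp (\<i> * of_real x * of_real lam)) 0 at_bot)"
      by (rule ex1_solution[OF assms(3,4) inf_at_bot_ae bot f]) simp_all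
    show "ex1_ae (Linf_neg s) (\<lambda>\<psi>. dist_eq (Lax u \<psi>) (dist_of (\<lambda>x. of_real lam * \<psi> x)) \<and>
           ess_tendsto (\<lambda>x. \<psi> x - exp (\<i> * of_real x * of_real lam)) 0 at_top)"
      by (rule ex1_solution[OF assms(3,4) inf_at_top_ae top g v]) (rule uniq)
  qed
qed

end
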